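(* Let $d\in\{2,3\}$, let $\Omega\subset\mathbb{R}^d$ be a bounded domain whose (Lipschitz-continuous) boundary $\partial\Omega$ is moreover $C^2$ smooth, let $X=(H_0^1(\Omega))^d$, $Q=L_0^2(\Omega)$, let $f$ be in the dual space of $X$, and let $Re>0$. Assume that $$Re^2\,N\,|f|_*<1 .$$ Let $Q^h\subset Q$ and the nested ROM spaces $X^r\subset X^R\subset X$ be as described in the context; in particular $\int_\Omega(\nabla\cdot v^R)\,\chi^h\,dx=0$ for all $v^R\in X^R$, $\chi^h\in Q^h$. Let $(u,p)\in X\times Q$ be the unique solution of the weak steady Navier-Stokes system $$a(u,v)+b_{SKEW}(u;u,v)+c(p,v)=(f,v),\qquad c(q,u)=0\qquad\text{for all }(v,q)\in X\times Q,$$ and let $(u^r,u^R)\in X^r\times X^R$ be the unique solution of the two-level reduced order model $$a(u^r,v^r)+b_{SKEW}(u^r;u^r,v^r)=(f,v^r)\qquad\text{for all }v^r\in X^r,$$ $$a(u^R,v^R)+b_{SKEW}(u^R;u^r,v^R)+b_{SKEW}(u^r;u^R,v^R)=(f,v^R)+b_{SKEW}(u^r;u^r,v^R)\qquad\text{for all }v^R\in X^R$$ (under the assumption $Re^2N|f|_*<1$ both problems have a unique solution). Set $\alpha:=1-Re^2N_{R,r}|f|_*$, which is positive since $N_{R,r}\le N$. Then there is a constant $C(\Omega)>0$ depending only on $\Omega$ such that $$\begin{aligned} |u-u^R|_1\le{}&\inf_{v^R\in X^R}\Big\{(\alpha^{-1}+1)|u-v^R|_1+\alpha^{-1}Re\,C(\Omega)\,\|u-v^R\|_0^{1/2}\,|u-v^R|_1^{1/2}\,|u^r|_1\\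 &\qquad\qquad+\alpha^{-1}Re\,C(\Omega)\,\|u^r\|_0^{1/2}\,|u^r|_1^{1/2}\,|u-v^R|_1\Big\}\\ &+\alpha^{-1}Re\inf_{\chi^h\in Q^h}\|p-\chi^h\|_0+\alpha^{-1}Re\,C(\Omega)\,\|u-u^r\|_0^{1/2}\,|u-u^r|_1^{3/2}. \end{aligned}$$
   Context: Notation. $X=(H_0^1(\Omega))^d$ is the velocity space and $Q=L_0^2(\Omega)=\{q\in L^2(\Omega):\int_\Omega q\,dx=0\}$ is the pressure space. $\|\cdot\|_0$ is the $L^2(\Omega)$ norm (for scalar- or vector-valued functions), and $|v|_1=\|\nabla v\|_0$. The number $Re>0$ is the Reynolds number. For $f$ in the dual of $X$, $(f,v)$ denotes $\int_\Omega f\cdot v\,dx$, understood as the duality pairing. The forms are $$a(u,v)=Re^{-1}\int_\Omega\nabla u:\nabla v\,dx,\qquad b(u;v,w)=\int_\Omega (u\cdot\nabla)v\cdot w\,dx,$$ $$b_{SKEW}(u;v,w)=\tfrac12\big[b(u;v,w)-b(u;w,v)\big],\qquad c(p,v)=-\int_\Omega(\nabla\cdot v)\,p\,dx.$$ ROM spaces. Let $u_h^1,\dots,u_h^M\in X$ be finite element velocity solutions (snapshots) of the weak steady Navier-Stokes system for Reynolds numbers $Re_1,\dots,Re_M$, computed with a discrete pressure space $Q^h\subset Q$. They are discretely divergence-free: $c(\chi^h,u_h^j)=0$ for all $\chi^h\in Q^h$ and all $j$. Let $\{\varphi_1,\dots,\varphi_\ell\}$ be the orthonormal proper orthogonal decomposition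 (POD) basis constructed from these snapshots, where $\ell$ is the number of linearly independent snapshots; its span is the span of the snapshots. Hence every $v\in\mathrm{span}\{\varphi_1,\dots,\varphi_\ell\}$ satisfies $c(\chi^h,v)=0$ for all $\chi^h\in Q^h$. For integers $1\le r<R\le\ell$ put $X^r=\mathrm{span}\{\varphi_1,\dots,\varphi_r\}$ and $X^R=\mathrm{span}\{\varphi_1,\dots,\varphi_R\}$. Constants: $$N=\sup_{u,v,w\in X\setminus\{0\}}\frac{|b_{SKEW}(u;v,w)|}{|u|_1|v|_1|w|_1},\qquad N_{R,r}=\sup_{\substack{u^R,w^R\in X^R\setminus\{0\}\\ v^r\in X^r\setminus\{0\}}}\frac{|b_{SKEW}(u^R;v^r,w^R)|}{|u^R|_1|v^r|_1|w^R|_1},\qquad |f|_*=\sup_{v\in X\setminus\{0\}}\frac{|(f,v)|}{|v|_1}.$$ *)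

theory Defs
  imports "HOL-Analysis.Analysis"
begin

text \<open>
  Elements of \<open>L\<^sup>2\<close> and of the Sobolev spaces are represented by functions on the whole type whose
  values outside \<open>\<Omega>\<close> are irrelevant; the spaces below are closed under changes on null sets.
\<close>

section \<open>Smoothness of functions and of boundaries\<close>

text \<open>On an open set \<open>S\<close>: all iterated partial derivatives up to order \<open>k\<close> exist and are continuous.\<close>

primrec Ck_on :: "nat \<Rightarrow> ('a::euclidean_space \<Rightarrow> 'b::real_normed_vector) \<Rightarrow> 'a set \<Rightarrow> bool" where
  "Ck_on 0 f S \<longleftrightarrow> continuous_on S f"
| "Ck_on (Suc k) f S \<longleftrightarrow>
     (\<forall>x\<in>S. f differentiable (at x)) \<and>
     (\<forall>i\<in>Basis. Ck_on k (\<lambda>x. frechet_derivative f (at x) i) S)"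

text \<open>
  Near each boundary point, \<open>\<Omega>\<close> is the region above a graph with respect to some unit direction \<open>e\<close>.
  A function on the hyperplane orthogonal to \<open>e\<close> is encoded as a function on the whole space that
  is invariant under translation along \<open>e\<close>.
\<close>

definition graph_boundary :: "(('a::euclidean_space \<Rightarrow> real) \<Rightarrow> bool) \<Rightarrow> 'a set \<Rightarrow> bool" where
  "graph_boundary P \<Omega> \<longleftrightarrow>
     (\<forall>x\<in>frontier \<Omega>. \<exists>\<rho>>0. \<exists>e \<gamma>. norm e = 1 \<and> (\<forall>y t. \<gamma> (y + t *\<^sub>R e) = \<gamma> y) \<and> P \<gamma> \<and>
        \<Omega> \<inter> ball x \<rho> = {y \<in> ball x \<rho>. y \<bullet> e > \<gamma> y})"

definition lipschitz_boundary :: "'a::euclidean_space set \<Rightarrow> bool" where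
  "lipschitz_boundary \<Omega> \<longleftrightarrow> graph_boundary (\<lambda>\<gamma>. \<exists>L. L-lipschitz_on UNIV \<gamma>) \<Omega>"

definition C2_boundary :: "'a::euclidean_space set \<Rightarrow> bool" where
  "C2_boundary \<Omega> \<longleftrightarrow> graph_boundary (\<lambda>\<gamma>. Ck_on 2 \<gamma> UNIV) \<Omega>"

section \<open>Function spaces\<close>

definition L2 :: "'a::euclidean_space set \<Rightarrow> ('a \<Rightarrow> 'b::euclidean_space) set" where
  "L2 \<Omega> = {u. u \<in> borel_measurable (lebesgue_on \<Omega>) \<and>
              integrable (lebesgue_on \<Omega>) (\<lambda>x. (norm (u x))\<^sup>2)}"

definition l2_inner :: "'a::euclidean_space set \<Rightarrow> ('a \<Rightarrow> 'b::euclidean_space) \<Rightarrow> ('a \<Rightarrow> 'b) \<Rightarrow> real" where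
  "l2_inner \<Omega> u v = (LINT x|lebesgue_on \<Omega>. u x \<bullet> v x)"

definition l2_norm :: "'a::euclidean_space set \<Rightarrow> ('a \<Rightarrow> 'b::euclidean_space) \<Rightarrow> real" where
  "l2_norm \<Omega> u = sqrt (LINT x|lebesgue_on \<Omega>. (norm (u x))\<^sup>2)"

text \<open>\<open>C\<^sub>c\<^sup>\<infinity>(\<Omega>)\<close>, extended by zero to the whole space\<close>

definition test_functions :: "'a::euclidean_space set \<Rightarrow> ('a \<Rightarrow> real) set" where
  "test_functions \<Omega> = {\<phi>. (\<forall>k. Ck_on k \<phi> UNIV) \<and> (\<exists>K\<subseteq>\<Omega>. compact K \<and> (\<forall>x. x \<notin> K \<longrightarrow> \<phi> x = 0))}"

definition is_weak_gradient :: "'a::euclidean_space set \<Rightarrow> ('a \<Rightarrow> real) \<Rightarrow> ('a \<Rightarrow> 'a) \<Rightarrow> bool" where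
  "is_weak_gradient \<Omega> u g \<longleftrightarrow> g \<in> L2 \<Omega> \<and>
     (\<forall>\<phi>\<in>test_functions \<Omega>. \<forall>i\<in>Basis.
        (LINT x|lebesgue_on \<Omega>. u x * frechet_derivative \<phi> (at x) i) =
        - (LINT x|lebesgue_on \<Omega>. (g x \<bullet> i) * \<phi> x))"

definition weak_gradient :: "'a::euclidean_space set \<Rightarrow> ('a \<Rightarrow> real) \<Rightarrow> 'a \<Rightarrow> 'a" where
  "weak_gradient \<Omega> u = (SOME g. is_weak_gradient \<Omega> u g)"

definition H1 :: "'a::euclidean_space set \<Rightarrow> ('a \<Rightarrow> real) set" where
  "H1 \<Omega> = {u \<in> L2 \<Omega>. \<exists>g. is_weak_gradient \<Omega> u g}"

definition h1_norm :: "'a::euclidean_space set \<Rightarrow> ('a \<Rightarrow> real) \<Rightarrow> real" where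
  "h1_norm \<Omega> u = sqrt ((l2_norm \<Omega> u)\<^sup>2 + (l2_norm \<Omega> (weak_gradient \<Omega> u))\<^sup>2)"

definition H10 :: "'a::euclidean_space set \<Rightarrow> ('a \<Rightarrow> real) set" where
  "H10 \<Omega> = {u \<in> H1 \<Omega>. \<exists>\<phi>. (\<forall>k::nat. \<phi> k \<in> test_functions \<Omega>) \<and>
                       (\<lambda>k. h1_norm \<Omega> (\<lambda>x. u x - \<phi> k x)) \<longlonglongrightarrow> 0}"

definition X_space :: "(real^'n) set \<Rightarrow> (real^'n \<Rightarrow> real^'n) set" where
  "X_space \<Omega> = {v. \<forall>i. (\<lambda>x. v x $ i) \<in> H10 \<Omega>}"

definition Q_space :: "(real^'n) set \<Rightarrow> (real^'n \<Rightarrow> real) set" where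
  "Q_space \<Omega> = {q \<in> L2 \<Omega>. (LINT x|lebesgue_on \<Omega>. q x) = 0}"

text \<open>
  The \<open>(i,j)\<close> entry of \<open>grad \<Omega> v x\<close> is \<open>\<partial>\<^sub>j v\<^sub>i(x)\<close>. The inner product and norm on the matrix type are
  the Frobenius ones, \<open>(u \<cdot> \<nabla>)v\<close> is the matrix-vector product, and \<open>\<nabla> \<cdot> v\<close> is the trace.
\<close>

definition grad :: "(real^'n) set \<Rightarrow> (real^'n \<Rightarrow> real^'n) \<Rightarrow> real^'n \<Rightarrow> real^'n^'n" where
  "grad \<Omega> v x = (\<chi> i. weak_gradient \<Omega> (\<lambda>y. v y $ i) x)"

definition divergence :: "(real^'n) set \<Rightarrow> (real^'n \<Rightarrow> real^'n) \<Rightarrow> real^'n \<Rightarrow> real" where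
  "divergence \<Omega> v x = trace (grad \<Omega> v x)"

definition h1_inner0 :: "(real^'n) set \<Rightarrow> (real^'n \<Rightarrow> real^'n) \<Rightarrow> (real^'n \<Rightarrow> real^'n) \<Rightarrow> real" where
  "h1_inner0 \<Omega> u v = l2_inner \<Omega> (grad \<Omega> u) (grad \<Omega> v)"

definition h1_semi :: "(real^'n) set \<Rightarrow> (real^'n \<Rightarrow> real^'n) \<Rightarrow> real" where
  "h1_semi \<Omega> v = l2_norm \<Omega> (grad \<Omega> v)"

text \<open>Continuity with respect to \<open>|\<cdot>|\<^sub>1\<close>, which on bounded \<open>\<Omega>\<close> is a norm on \<open>X\<close> equivalent to the \<open>H\<^sup>1\<close> norm\<close>

definition X_dual :: "(real^'n) set \<Rightarrow> ((real^'n \<Rightarrow> real^'n) \<Rightarrow> real) set" where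
  "X_dual \<Omega> = {f.
     (\<forall>u\<in>X_space \<Omega>. \<forall>v\<in>X_space \<Omega>. f (\<lambda>x. u x + v x) = f u + f v) \<and>
     (\<forall>c. \<forall>v\<in>X_space \<Omega>. f (\<lambda>x. c *\<^sub>R v x) = c * f v) \<and>
     (\<exists>K. \<forall>v\<in>X_space \<Omega>. \<bar>f v\<bar> \<le> K * h1_semi \<Omega> v)}"

section \<open>Forms and the Navier-Stokes system\<close>

definition a_form :: "(real^'n) set \<Rightarrow> real \<Rightarrow> (real^'n \<Rightarrow> real^'n) \<Rightarrow> (real^'n \<Rightarrow> real^'n) \<Rightarrow> real" where
  "a_form \<Omega> Rey u v = inverse Rey * (LINT x|lebesgue_on \<Omega>. grad \<Omega> u x \<bullet> grad \<Omega> v x)"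

definition b_form ::
  "(real^'n) set \<Rightarrow> (real^'n \<Rightarrow> real^'n) \<Rightarrow> (real^'n \<Rightarrow> real^'n) \<Rightarrow> (real^'n \<Rightarrow> real^'n) \<Rightarrow> real" where
  "b_form \<Omega> u v w = (LINT x|lebesgue_on \<Omega>. (grad \<Omega> v x *v u x) \<bullet> w x)"

definition b_skew ::
  "(real^'n) set \<Rightarrow> (real^'n \<Rightarrow> real^'n) \<Rightarrow> (real^'n \<Rightarrow> real^'n) \<Rightarrow> (real^'n \<Rightarrow> real^'n) \<Rightarrow> real" where
  "b_skew \<Omega> u v w = (b_form \<Omega> u v w - b_form \<Omega> u w v) / 2"

definition c_form :: "(real^'n) set \<Rightarrow> (real^'n \<Rightarrow> real) \<Rightarrow> (real^'n \<Rightarrow> real^'n) \<Rightarrow> real" where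
  "c_form \<Omega> p v = - (LINT x|lebesgue_on \<Omega>. divergence \<Omega> v x * p x)"

text \<open>
  The weak steady system posed on a velocity space \<open>V\<close> and a pressure space \<open>P\<close>: the continuous
  problem for \<open>V = X\<close>, \<open>P = Q\<close>, and the conforming finite element problem for discrete subspaces.
\<close>

definition weak_NSE ::
  "(real^'n) set \<Rightarrow> (real^'n \<Rightarrow> real^'n) set \<Rightarrow> (real^'n \<Rightarrow> real) set \<Rightarrow> real \<Rightarrow>
   ((real^'n \<Rightarrow> real^'n) \<Rightarrow> real) \<Rightarrow> (real^'n \<Rightarrow> real^'n) \<Rightarrow> (real^'n \<Rightarrow> real) \<Rightarrow> bool" where
  "weak_NSE \<Omega> V P Rey f u p \<longleftrightarrow> u \<in> V \<and> p \<in> P \<and>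
     (\<forall>v\<in>V. \<forall>q\<in>P. a_form \<Omega> Rey u v + b_skew \<Omega> u u v + c_form \<Omega> p v = f v \<and> c_form \<Omega> q u = 0)"

definition two_level_ROM ::
  "(real^'n) set \<Rightarrow> (real^'n \<Rightarrow> real^'n) set \<Rightarrow> (real^'n \<Rightarrow> real^'n) set \<Rightarrow> real \<Rightarrow>
   ((real^'n \<Rightarrow> real^'n) \<Rightarrow> real) \<Rightarrow> (real^'n \<Rightarrow> real^'n) \<Rightarrow> (real^'n \<Rightarrow> real^'n) \<Rightarrow> bool" where
  "two_level_ROM \<Omega> Xr XR Rey f ur uR \<longleftrightarrow> ur \<in> Xr \<and> uR \<in> XR \<and>
     (\<forall>v\<in>Xr. a_form \<Omega> Rey ur v + b_skew \<Omega> ur ur v = f v) \<and>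
     (\<forall>v\<in>XR. a_form \<Omega> Rey uR v + b_skew \<Omega> uR ur v + b_skew \<Omega> ur uR v
                = f v + b_skew \<Omega> ur ur v)"

text \<open>
  The suprema are taken in the reals, where \<open>Sup\<close> of an unbounded set is unspecified. The sets are
  bounded: for \<open>f \<in> X_dual \<Omega>\<close> by definition, for the trilinear form by the Sobolev embedding theorem
  in dimension at most 4.
\<close>

definition nonzero :: "'a::euclidean_space set \<Rightarrow> ('a \<Rightarrow> 'b::real_normed_vector) set \<Rightarrow> ('a \<Rightarrow> 'b) set" where
  "nonzero \<Omega> V = {v \<in> V. \<not> (AE x in lebesgue_on \<Omega>. v x = 0)}"

definition N_const :: "(real^'n) set \<Rightarrow> real" where
  "N_const \<Omega> = Sup {\<bar>b_skew \<Omega> u v w\<bar> / (h1_semi \<Omega> u * h1_semi \<Omega> v * h1_semi \<Omega> w) | u v w.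
      u \<in> nonzero \<Omega> (X_space \<Omega>) \<and> v \<in> nonzero \<Omega> (X_space \<Omega>) \<and> w \<in> nonzero \<Omega> (X_space \<Omega>)}"

definition NRr_const ::
  "(real^'n) set \<Rightarrow> (real^'n \<Rightarrow> real^'n) set \<Rightarrow> (real^'n \<Rightarrow> real^'n) set \<Rightarrow> real" where
  "NRr_const \<Omega> XR Xr = Sup {\<bar>b_skew \<Omega> u v w\<bar> / (h1_semi \<Omega> u * h1_semi \<Omega> v * h1_semi \<Omega> w) | u v w.
      u \<in> nonzero \<Omega> XR \<and> v \<in> nonzero \<Omega> Xr \<and> w \<in> nonzero \<Omega> XR}"

definition dual_norm :: "(real^'n) set \<Rightarrow> ((real^'n \<Rightarrow> real^'n) \<Rightarrow> real) \<Rightarrow> real" where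
  "dual_norm \<Omega> f = Sup {\<bar>f v\<bar> / h1_semi \<Omega> v | v. v \<in> nonzero \<Omega> (X_space \<Omega>)}"

section \<open>Discrete spaces and proper orthogonal decomposition\<close>

text \<open>The span of \<open>\<phi>\<^sub>1,\<dots>,\<phi>\<^sub>k\<close>, modulo equality almost everywhere on \<open>\<Omega>\<close>\<close>

definition lin_span ::
  "'a::euclidean_space set \<Rightarrow> nat \<Rightarrow> (nat \<Rightarrow> 'a \<Rightarrow> 'b::euclidean_space) \<Rightarrow> ('a \<Rightarrow> 'b) set" where
  "lin_span \<Omega> k \<phi> = {v. \<exists>c. AE x in lebesgue_on \<Omega>. v x = (\<Sum>i=1..k. c i *\<^sub>R \<phi> i x)}"

definition finite_dim_subspace ::
  "'a::euclidean_space set \<Rightarrow> ('a \<Rightarrow> 'b::euclidean_space) set \<Rightarrow> ('a \<Rightarrow> 'b) set \<Rightarrow> bool" where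
  "finite_dim_subspace \<Omega> V W \<longleftrightarrow> (\<exists>m \<psi>. (\<forall>i\<in>{1..m}. \<psi> i \<in> W) \<and> V = lin_span \<Omega> m \<psi>)"

definition orthonormal_in_X ::
  "(real^'n) set \<Rightarrow> ((real^'n \<Rightarrow> real^'n) \<Rightarrow> (real^'n \<Rightarrow> real^'n) \<Rightarrow> real) \<Rightarrow>
   nat \<Rightarrow> (nat \<Rightarrow> real^'n \<Rightarrow> real^'n) \<Rightarrow> bool" where
  "orthonormal_in_X \<Omega> ip k \<phi> \<longleftrightarrow> (\<forall>i\<in>{1..k}. \<phi> i \<in> X_space \<Omega>) \<and>
     (\<forall>i\<in>{1..k}. \<forall>j\<in>{1..k}. ip (\<phi> i) (\<phi> j) = (if i = j then 1 else 0))"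

text \<open>Mean square error of the \<open>ip\<close>-orthogonal projection of the snapshots onto \<open>\<phi>\<^sub>1,\<dots>,\<phi>\<^sub>k\<close>\<close>

definition POD_error ::
  "((real^'n \<Rightarrow> real^'n) \<Rightarrow> (real^'n \<Rightarrow> real^'n) \<Rightarrow> real) \<Rightarrow> nat \<Rightarrow> (nat \<Rightarrow> real^'n \<Rightarrow> real^'n) \<Rightarrow>
   nat \<Rightarrow> (nat \<Rightarrow> real^'n \<Rightarrow> real^'n) \<Rightarrow> real" where
  "POD_error ip M us k \<phi> = (1 / real M) *
     (\<Sum>j=1..M. let w = (\<lambda>x. us j x - (\<Sum>i=1..k. ip (us j) (\<phi> i) *\<^sub>R \<phi> i x)) in ip w w)"

text \<open>
  \<open>\<phi>\<^sub>1,\<dots>,\<phi>\<^sub>l\<close> is an orthonormal basis of the span of the snapshots (so \<open>l\<close> is the number of linearly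
  independent snapshots) whose every initial segment is an optimal orthonormal system of its length.
\<close>

definition POD_basis ::
  "(real^'n) set \<Rightarrow> ((real^'n \<Rightarrow> real^'n) \<Rightarrow> (real^'n \<Rightarrow> real^'n) \<Rightarrow> real) \<Rightarrow>
   nat \<Rightarrow> (nat \<Rightarrow> real^'n \<Rightarrow> real^'n) \<Rightarrow> nat \<Rightarrow> (nat \<Rightarrow> real^'n \<Rightarrow> real^'n) \<Rightarrow> bool" where
  "POD_basis \<Omega> ip M us l \<phi> \<longleftrightarrow>
     orthonormal_in_X \<Omega> ip l \<phi> \<and> lin_span \<Omega> l \<phi> = lin_span \<Omega> M us \<and>
     (\<forall>k\<in>{1..l}. \<forall>\<psi>. orthonormal_in_X \<Omega> ip k \<psi> \<longrightarrow> POD_error ip M us k \<phi> \<le> POD_error ip M us k \<psi>)"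

end

theory Submission
  imports Defs
begin

text \<open>
  Let \<open>v \<in> X\<^sup>R\<close>, and put \<open>\<eta> = u - v\<close>, \<open>\<phi> = u\<^sup>R - v\<close> and \<open>d = u - u\<^sup>r\<close>. Subtracting the second reduced equation,
  tested with \<open>\<phi>\<close>, from the Navier-Stokes equation gives for every \<open>\<chi> \<in> Q\<^sup>h\<close>
  \<open>a(\<phi>,\<phi>) + b(\<phi>;u\<^sup>r,\<phi>) = a(\<eta>,\<phi>) + b(\<eta>;u\<^sup>r,\<phi>) + b(u\<^sup>r;\<eta>,\<phi>) + b(d;d,\<phi>) + c(p - \<chi>,\<phi>)\<close>
  (\<open>two_level_error_identity\<close>; \<open>b\<close> is the skew-symmetrised form). Here \<open>b(u\<^sup>r;\<phi>,\<phi>) = 0\<close> by skew symmetry,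
  \<open>b(d;d,\<phi>)\<close> is the quadratic remainder of the linearisation about \<open>u\<^sup>r\<close>, and \<open>\<chi>\<close> may be subtracted from
  the pressure because \<open>\<phi>\<close> is discretely divergence-free. Testing the first reduced equation with \<open>u\<^sup>r\<close>
  yields \<open>\<bar>u\<^sup>r\<bar>\<^sub>1 \<le> Re \<bar>f\<bar>\<^sub>*\<close>, so by definition of \<open>N\<^sub>R\<^sub>,\<^sub>r\<close> the left-hand side is at least \<open>Re\<^sup>-\<^sup>1 \<alpha> \<bar>\<phi>\<bar>\<^sub>1\<^sup>2\<close>.
  Bounding the right-hand side by a multiple of \<open>\<bar>\<phi>\<bar>\<^sub>1\<close> and using \<open>\<bar>u - u\<^sup>R\<bar>\<^sub>1 \<le> \<bar>\<eta>\<bar>\<^sub>1 + \<bar>\<phi>\<bar>\<^sub>1\<close> gives the estimate.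

  Two bounds carry the analysis. The first is
  \<open>\<bar>b(u;v,w)\<bar> \<le> C \<parallel>u\<parallel>\<^sub>0\<^sup>1\<^sup>/\<^sup>2 \<bar>u\<bar>\<^sub>1\<^sup>1\<^sup>/\<^sup>2 \<bar>v\<bar>\<^sub>1 \<bar>w\<bar>\<^sub>1\<close> (\<open>b_skew_bound\<close>). It reduces to an \<open>L\<^sup>2\<close> bound for products of
  scalar functions in \<open>H\<^sub>0\<^sup>1\<close>: \<open>\<integral>u\<^sup>2w\<^sup>2 \<le> \<parallel>u\<parallel>\<^sub>0 \<parallel>u w\<^sup>2\<parallel>\<^sub>0\<close>, and \<open>\<parallel>u w\<^sup>2\<parallel>\<^sub>0\<close> is controlled by the gradients through the
  embedding of \<open>H\<^sub>0\<^sup>1\<close> in \<open>L\<^sup>6\<close>. For test functions the embedding follows by integrating powers along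
  coordinate lines (\<open>plane_Sobolev\<close>, \<open>space_Sobolev\<close>), and Fatou's lemma extends it. Together with
  Poincare's inequality this bound also shows that the suprema in \<open>N\<close> and \<open>N\<^sub>R\<^sub>,\<^sub>r\<close> are finite, hence
  \<open>N\<^sub>R\<^sub>,\<^sub>r \<le> N\<close> and \<open>\<alpha> > 0\<close>. The second bound is \<open>\<parallel>\<nabla> \<cdot> v\<parallel>\<^sub>0 \<le> \<bar>v\<bar>\<^sub>1\<close> (\<open>divergence_le_h1_semi\<close>), which gives the
  pressure term the coefficient 1; it rests on \<open>\<integral>\<partial>\<^sub>i\<phi> \<partial>\<^sub>j\<psi> = \<integral>\<partial>\<^sub>j\<phi> \<partial>\<^sub>i\<psi>\<close> for \<open>\<phi>, \<psi> \<in> H\<^sub>0\<^sup>1\<close>.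

  Weak gradients are chosen by Hilbert's operator, so even the linearity of \<open>\<nabla>\<close> almost everywhere needs
  their uniqueness. This is the fundamental lemma of the calculus of variations, for which smooth
  bump functions converging to indicators of boxes are constructed.
\<close>

section \<open>Square integrable functions\<close>


text \<open>
  Completeness of the Lebesgue measure passes to subsets by extending functions by zero.
\<close>

lemma borel_measurable_lebesgue_on_cong_AE:
  fixes f g :: "'a::euclidean_space \<Rightarrow> 'b::euclidean_space"
  assumes S: "S \<in> sets lebesgue" and f: "f \<in> borel_measurable (lebesgue_on S)"
    and ae: "AE x in lebesgue_on S. f x = g x"
  shows "g \<in> borel_measurable (lebesgue_on S)"
proof -
  have "(\<lambda>x. if x \<in> S then f x else 0) \<in> borel_measurable lebesgue"
    using borel_measurable_if_I[OF f S] .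
  moreover have "AE x in lebesgue. (if x \<in> S then f x else 0) = (if x \<in> S then g x else 0)"
    using ae S by (simp add: AE_restrict_space_iff)
  ultimately have "(\<lambda>x. if x \<in> S then g x else 0) \<in> borel_measurable lebesgue"
    by (rule borel_measurable_AE)
  then show ?thesis
    using borel_measurable_if_D by blast
qed

lemma L2_measurable [measurable_dest]: "u \<in> L2 \<Omega> \<Longrightarrow> u \<in> borel_measurable (lebesgue_on \<Omega>)"
  by (simp add: L2_def)

lemma L2_integrable_sq: "u \<in> L2 \<Omega> \<Longrightarrow> integrable (lebesgue_on \<Omega>) (\<lambda>x. (norm (u x))\<^sup>2)"
  by (simp add: L2_def)

lemma l2_norm_nonneg [simp]: "l2_norm \<Omega> u \<ge> 0"
  by (simp add: l2_norm_def)

lemma l2_norm_sq: "(l2_norm \<Omega> u)\<^sup>2 = (LINT x|lebesgue_on \<Omega>. (norm (u x))\<^sup>2)"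
  by (simp add: l2_norm_def)

lemma l2_inner_self: "l2_inner \<Omega> u u = (l2_norm \<Omega> u)\<^sup>2"
  by (simp add: l2_norm_sq l2_inner_def power2_norm_eq_inner)

lemma L2_norm: "u \<in> L2 \<Omega> \<Longrightarrow> (\<lambda>x. norm (u x)) \<in> L2 \<Omega>"
  by (auto simp: L2_def)

lemma l2_norm_norm: "l2_norm \<Omega> (\<lambda>x. norm (u x)) = l2_norm \<Omega> u"
  by (simp add: l2_norm_def)

lemma norm_add_sq_le: "(norm (x + y))\<^sup>2 \<le> 2 * (norm x)\<^sup>2 + 2 * (norm (y::'b::real_inner))\<^sup>2"
proof -
  have "(norm (x + y))\<^sup>2 + (norm (x - y))\<^sup>2 = 2 * (norm x)\<^sup>2 + 2 * (norm y)\<^sup>2"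
    by (simp add: power2_norm_eq_inner inner_left_distrib inner_right_distrib inner_diff_left
        inner_diff_right)
  then show ?thesis
    using zero_le_power2[of "norm (x - y)"] by linarith
qed

lemma L2_bounded_by:
  fixes u :: "'a::euclidean_space \<Rightarrow> 'b::euclidean_space" and v :: "'a \<Rightarrow> 'c::euclidean_space"
  assumes "v \<in> L2 \<Omega>" "u \<in> borel_measurable (lebesgue_on \<Omega>)" "\<And>x. norm (u x) \<le> c * norm (v x)"
  shows "u \<in> L2 \<Omega>"
proof -
  have "integrable (lebesgue_on \<Omega>) (\<lambda>x. c\<^sup>2 * (norm (v x))\<^sup>2)"
    using L2_integrable_sq[OF assms(1)] by simp
  then have "integrable (lebesgue_on \<Omega>) (\<lambda>x. (norm (u x))\<^sup>2)"
    by (rule Bochner_Integration.integrable_bound)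
      (use assms in \<open>auto simp flip: power_mult_distrib intro!: power_mono\<close>)
  then show ?thesis
    using assms by (simp add: L2_def)
qed

lemma L2_add: "u \<in> L2 \<Omega> \<Longrightarrow> v \<in> L2 \<Omega> \<Longrightarrow> (\<lambda>x. u x + v x) \<in> L2 \<Omega>"
  unfolding L2_def mem_Collect_eq
proof (elim conjE, intro conjI)
  assume m: "u \<in> borel_measurable (lebesgue_on \<Omega>)" "v \<in> borel_measurable (lebesgue_on \<Omega>)"
    and i: "integrable (lebesgue_on \<Omega>) (\<lambda>x. (norm (u x))\<^sup>2)"
      "integrable (lebesgue_on \<Omega>) (\<lambda>x. (norm (v x))\<^sup>2)"
  from m show "(\<lambda>x. u x + v x) \<in> borel_measurable (lebesgue_on \<Omega>)"
    by (rule borel_measurable_add)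
  show "integrable (lebesgue_on \<Omega>) (\<lambda>x. (norm (u x + v x))\<^sup>2)"
  proof (rule Bochner_Integration.integrable_bound
      [where f="\<lambda>x. 2 * (norm (u x))\<^sup>2 + 2 * (norm (v x))\<^sup>2"])
    show "(\<lambda>x. (norm (u x + v x))\<^sup>2) \<in> borel_measurable (lebesgue_on \<Omega>)"
      using m by measurable
  qed (use i norm_add_sq_le in auto)
qed

lemma L2_scaleR: "u \<in> L2 \<Omega> \<Longrightarrow> (\<lambda>x. c *\<^sub>R u x) \<in> L2 \<Omega>"
  by (auto simp: L2_def power_mult_distrib)

lemma L2_uminus: "u \<in> L2 \<Omega> \<Longrightarrow> (\<lambda>x. - u x) \<in> L2 \<Omega>"
  by (auto simp: L2_def)

lemma L2_diff: "u \<in> L2 \<Omega> \<Longrightarrow> v \<in> L2 \<Omega> \<Longrightarrow> (\<lambda>x. u x - v x) \<in> L2 \<Omega>"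
  using L2_add[of u \<Omega> "\<lambda>x. - v x"] L2_uminus[of v \<Omega>] by simp

lemma L2_zero: "(\<lambda>x. 0) \<in> L2 \<Omega>"
  by (simp add: L2_def)

lemma L2_integrable_inner:
  assumes "u \<in> L2 \<Omega>" "v \<in> L2 \<Omega>"
  shows "integrable (lebesgue_on \<Omega>) (\<lambda>x. u x \<bullet> v x)"
proof (rule Bochner_Integration.integrable_bound
      [where f="\<lambda>x. (norm (u x))\<^sup>2 + (norm (v x))\<^sup>2"])
  show "AE x in lebesgue_on \<Omega>. norm (u x \<bullet> v x) \<le> norm ((norm (u x))\<^sup>2 + (norm (v x))\<^sup>2)"
  proof (intro AE_I2)
    fix x
    have "norm (u x \<bullet> v x) \<le> norm (u x) * norm (v x)"
      by (simp add: Cauchy_Schwarz_ineq2)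
    also have "\<dots> \<le> (norm (u x))\<^sup>2 + (norm (v x))\<^sup>2"
      using sum_squares_bound[of "norm (u x)" "norm (v x)"]
        mult_nonneg_nonneg[OF norm_ge_zero[of "u x"] norm_ge_zero[of "v x"]] by linarith
    finally show "norm (u x \<bullet> v x) \<le> norm ((norm (u x))\<^sup>2 + (norm (v x))\<^sup>2)"
      by simp
  qed
qed (use assms in \<open>auto simp: L2_def\<close>)

lemma L2_integrable_mult:
  fixes u v :: "'a::euclidean_space \<Rightarrow> real"
  shows "u \<in> L2 \<Omega> \<Longrightarrow> v \<in> L2 \<Omega> \<Longrightarrow> integrable (lebesgue_on \<Omega>) (\<lambda>x. u x * v x)"
  using L2_integrable_inner[of u \<Omega> v] by simp

lemma l2_inner_commute: "l2_inner \<Omega> u v = l2_inner \<Omega> v u"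
  by (simp add: l2_inner_def inner_commute)

lemma l2_inner_add_left:
  "u \<in> L2 \<Omega> \<Longrightarrow> u' \<in> L2 \<Omega> \<Longrightarrow> v \<in> L2 \<Omega> \<Longrightarrow>
   l2_inner \<Omega> (\<lambda>x. u x + u' x) v = l2_inner \<Omega> u v + l2_inner \<Omega> u' v"
  unfolding l2_inner_def inner_left_distrib
  by (intro Bochner_Integration.integral_add L2_integrable_inner)

lemma l2_inner_diff_left:
  "u \<in> L2 \<Omega> \<Longrightarrow> u' \<in> L2 \<Omega> \<Longrightarrow> v \<in> L2 \<Omega> \<Longrightarrow>
   l2_inner \<Omega> (\<lambda>x. u x - u' x) v = l2_inner \<Omega> u v - l2_inner \<Omega> u' v"
  unfolding l2_inner_def inner_diff_left
  by (intro Bochner_Integration.integral_diff L2_integrable_inner)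

lemma l2_inner_scaleR_left: "l2_inner \<Omega> (\<lambda>x. c *\<^sub>R u x) v = c * l2_inner \<Omega> u v"
  by (simp add: l2_inner_def)

lemma l2_inner_add_right:
  "u \<in> L2 \<Omega> \<Longrightarrow> u' \<in> L2 \<Omega> \<Longrightarrow> v \<in> L2 \<Omega> \<Longrightarrow>
   l2_inner \<Omega> v (\<lambda>x. u x + u' x) = l2_inner \<Omega> v u + l2_inner \<Omega> v u'"
  by (simp add: l2_inner_commute[of \<Omega> v] l2_inner_add_left)

lemma l2_inner_diff_right:
  "u \<in> L2 \<Omega> \<Longrightarrow> u' \<in> L2 \<Omega> \<Longrightarrow> v \<in> L2 \<Omega> \<Longrightarrow>
   l2_inner \<Omega> v (\<lambda>x. u x - u' x) = l2_inner \<Omega> v u - l2_inner \<Omega> v u'"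
  by (simp add: l2_inner_commute[of \<Omega> v] l2_inner_diff_left)

lemma l2_inner_scaleR_right: "l2_inner \<Omega> v (\<lambda>x. c *\<^sub>R u x) = c * l2_inner \<Omega> v u"
  by (simp add: l2_inner_def)

lemma l2_norm_scaleR: "l2_norm \<Omega> (\<lambda>x. c *\<^sub>R u x) = \<bar>c\<bar> * l2_norm \<Omega> u"
  by (simp add: l2_norm_def power_mult_distrib real_sqrt_mult)

lemma l2_norm_minus_commute: "l2_norm \<Omega> (\<lambda>x. u x - v x) = l2_norm \<Omega> (\<lambda>x. v x - u x)"
  by (simp add: l2_norm_def norm_minus_commute)

lemma l2_Cauchy_Schwarz:
  assumes u: "u \<in> L2 \<Omega>" and v: "v \<in> L2 \<Omega>"
  shows "\<bar>l2_inner \<Omega> u v\<bar> \<le> l2_norm \<Omega> u * l2_norm \<Omega> v"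
proof -
  let ?a = "l2_norm \<Omega> u" and ?b = "l2_norm \<Omega> v" and ?c = "l2_inner \<Omega> u v"
  have quad: "0 \<le> s\<^sup>2 * ?a\<^sup>2 - 2 * s * t * ?c + t\<^sup>2 * ?b\<^sup>2" for s t
  proof -
    have "(l2_norm \<Omega> (\<lambda>x. s *\<^sub>R u x - t *\<^sub>R v x))\<^sup>2 = s\<^sup>2 * ?a\<^sup>2 - 2 * s * t * ?c + t\<^sup>2 * ?b\<^sup>2"
      using u v l2_inner_commute[of \<Omega> v u]
      by (simp add: l2_inner_diff_left l2_inner_diff_right l2_inner_scaleR_left
          l2_inner_scaleR_right L2_scaleR L2_diff algebra_simps power2_eq_square[of s]
          power2_eq_square[of t] flip: l2_inner_self)
    from zero_le_power2[of "l2_norm \<Omega> (\<lambda>x. s *\<^sub>R u x - t *\<^sub>R v x)", unfolded this]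
    show ?thesis .
  qed
  show ?thesis
  proof (cases "?b = 0")
    case False
    \<comment> \<open>the minimising direction of the form; it degenerates if \<open>\<parallel>v\<parallel> = 0\<close>\<close>
    have "0 \<le> ?b\<^sup>2 * (?a\<^sup>2 * ?b\<^sup>2 - ?c\<^sup>2)"
      using quad[of "?b\<^sup>2" ?c] by (simp add: algebra_simps power2_eq_square)
    then have "?c\<^sup>2 \<le> (?a * ?b)\<^sup>2"
      using False by (simp add: zero_le_mult_iff power_mult_distrib)
    then have "\<bar>?c\<bar> \<le> \<bar>?a * ?b\<bar>"
      by (simp only: abs_le_square_iff)
    then show ?thesis
      by (simp add: abs_mult)
  next
    case True
    have "?c = 0"
    proof (rule ccontr)
      assume "?c \<noteq> 0"
      \<comment> \<open>the form is affine in \<open>t\<close> with slope \<open>- 2 \<langle>u, v\<rangle>\<close>; this \<open>t\<close> makes it negative\<close>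
      then have "0 \<le> ?a\<^sup>2 - 2 * (?a\<^sup>2 + 1)"
        using quad[of 1 "(?a\<^sup>2 + 1) / ?c"] True by simp
      then show False
        using zero_le_power2[of ?a] by (simp add: algebra_simps)
    qed
    then show ?thesis by simp
  qed
qed

lemma l2_norm_triangle:
  assumes u: "u \<in> L2 \<Omega>" and v: "v \<in> L2 \<Omega>"
  shows "l2_norm \<Omega> (\<lambda>x. u x + v x) \<le> l2_norm \<Omega> u + l2_norm \<Omega> v"
proof (rule power2_le_imp_le)
  have "(l2_norm \<Omega> (\<lambda>x. u x + v x))\<^sup>2 = (l2_norm \<Omega> u)\<^sup>2 + 2 * l2_inner \<Omega> u v + (l2_norm \<Omega> v)\<^sup>2"
    using u v l2_inner_commute[of \<Omega> v u]
    by (simp add: l2_inner_add_left l2_inner_add_right L2_add flip: l2_inner_self)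
  also have "\<dots> \<le> (l2_norm \<Omega> u + l2_norm \<Omega> v)\<^sup>2"
    using l2_Cauchy_Schwarz[OF u v] by (simp add: power2_sum)
  finally show "(l2_norm \<Omega> (\<lambda>x. u x + v x))\<^sup>2 \<le> (l2_norm \<Omega> u + l2_norm \<Omega> v)\<^sup>2" .
qed simp

lemma l2_norm_triangle_diff:
  assumes u: "u \<in> L2 \<Omega>" and v: "v \<in> L2 \<Omega>"
  shows "l2_norm \<Omega> (\<lambda>x. u x - v x) \<le> l2_norm \<Omega> u + l2_norm \<Omega> v"
  using l2_norm_triangle[OF u L2_uminus[OF v]] by (simp add: l2_norm_def)

lemma l2_norm_le_add_diff:
  assumes u: "u \<in> L2 \<Omega>" and v: "v \<in> L2 \<Omega>"
  shows "l2_norm \<Omega> u \<le> l2_norm \<Omega> v + l2_norm \<Omega> (\<lambda>x. u x - v x)"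
  using l2_norm_triangle[OF v L2_diff[OF u v]] by simp

lemma l2_norm_cong_AE:
  assumes "AE x in lebesgue_on \<Omega>. u x = v x"
    "u \<in> borel_measurable (lebesgue_on \<Omega>)" "v \<in> borel_measurable (lebesgue_on \<Omega>)"
  shows "l2_norm \<Omega> u = l2_norm \<Omega> v"
  unfolding l2_norm_def using assms by (intro arg_cong[where f=sqrt] integral_cong_AE) auto

lemma L2_cong_AE:
  assumes "u \<in> L2 \<Omega>" "\<Omega> \<in> sets lebesgue" "AE x in lebesgue_on \<Omega>. u x = v x"
  shows "v \<in> L2 \<Omega>"
proof -
  have m: "v \<in> borel_measurable (lebesgue_on \<Omega>)"
    using borel_measurable_lebesgue_on_cong_AE assms L2_measurable by blast
  moreover have "integrable (lebesgue_on \<Omega>) (\<lambda>x. (norm (v x))\<^sup>2)"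
    by (rule integrable_cong_AE_imp[OF L2_integrable_sq[OF assms(1)]]) (use assms m in auto)
  ultimately show ?thesis
    by (simp add: L2_def)
qed

lemma l2_norm_eq_0_iff:
  assumes "u \<in> L2 \<Omega>"
  shows "l2_norm \<Omega> u = 0 \<longleftrightarrow> (AE x in lebesgue_on \<Omega>. u x = 0)"
  using integral_nonneg_eq_0_iff_AE[OF L2_integrable_sq[OF assms]]
  by (simp add: l2_norm_def)

lemma l2_norm_tendsto:
  assumes "\<And>k. U k \<in> L2 \<Omega>" "u \<in> L2 \<Omega>" and lim: "(\<lambda>k. l2_norm \<Omega> (\<lambda>x. u x - U k x)) \<longlonglongrightarrow> 0"
  shows "(\<lambda>k. l2_norm \<Omega> (U k)) \<longlonglongrightarrow> l2_norm \<Omega> u"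
proof -
  have "\<bar>l2_norm \<Omega> (U k) - l2_norm \<Omega> u\<bar> \<le> l2_norm \<Omega> (\<lambda>x. u x - U k x)" for k
    using l2_norm_le_add_diff[of "U k" \<Omega> u] l2_norm_le_add_diff[of u \<Omega> "U k"] assms(1,2)
    by (simp add: l2_norm_minus_commute[of \<Omega> "U k" u] abs_le_iff)
  then have "(\<lambda>k. l2_norm \<Omega> (U k) - l2_norm \<Omega> u) \<longlonglongrightarrow> 0"
    by (intro Lim_null_comparison[OF _ lim]) simp
  then show ?thesis
    using LIM_zero_iff by blast
qed

lemma l2_inner_tendsto:
  assumes U: "\<And>k. U k \<in> L2 \<Omega>" and u: "u \<in> L2 \<Omega>" and V: "\<And>k. V k \<in> L2 \<Omega>" and v: "v \<in> L2 \<Omega>"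
    and limu: "(\<lambda>k. l2_norm \<Omega> (\<lambda>x. u x - U k x)) \<longlonglongrightarrow> 0"
    and limv: "(\<lambda>k. l2_norm \<Omega> (\<lambda>x. v x - V k x)) \<longlonglongrightarrow> 0"
  shows "(\<lambda>k. l2_inner \<Omega> (U k) (V k)) \<longlonglongrightarrow> l2_inner \<Omega> u v"
proof -
  have bound: "norm (l2_inner \<Omega> u v - l2_inner \<Omega> (U k) (V k))
      \<le> l2_norm \<Omega> (\<lambda>x. u x - U k x) * l2_norm \<Omega> v
        + l2_norm \<Omega> (U k) * l2_norm \<Omega> (\<lambda>x. v x - V k x)" for k
  proof -
    have "l2_inner \<Omega> u v - l2_inner \<Omega> (U k) (V k)
        = l2_inner \<Omega> (\<lambda>x. u x - U k x) v + l2_inner \<Omega> (\<lambda>x. v x - V k x) (U k)"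
      using U[of k] u V[of k] v
      by (simp add: l2_inner_diff_left l2_inner_commute[of \<Omega> v "U k"]
          l2_inner_commute[of \<Omega> "V k" "U k"])
    also have "norm \<dots> \<le> l2_norm \<Omega> (\<lambda>x. u x - U k x) * l2_norm \<Omega> v
        + l2_norm \<Omega> (\<lambda>x. v x - V k x) * l2_norm \<Omega> (U k)"
      unfolding real_norm_def
      by (intro order_trans[OF abs_triangle_ineq] add_mono l2_Cauchy_Schwarz L2_diff u U v V)
    finally show ?thesis by (simp add: mult.commute)
  qed
  have "(\<lambda>k. l2_norm \<Omega> (\<lambda>x. u x - U k x) * l2_norm \<Omega> v
        + l2_norm \<Omega> (U k) * l2_norm \<Omega> (\<lambda>x. v x - V k x)) \<longlonglongrightarrow> 0 * l2_norm \<Omega> v + l2_norm \<Omega> u * 0"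
    by (intro tendsto_intros limu limv l2_norm_tendsto U u)
  then have "(\<lambda>k. l2_norm \<Omega> (\<lambda>x. u x - U k x) * l2_norm \<Omega> v
        + l2_norm \<Omega> (U k) * l2_norm \<Omega> (\<lambda>x. v x - V k x)) \<longlonglongrightarrow> 0"
    by simp
  then have "(\<lambda>k. l2_inner \<Omega> u v - l2_inner \<Omega> (U k) (V k)) \<longlonglongrightarrow> 0"
    using bound by (metis (mono_tags, lifting) Lim_null_comparison eventuallyI)
  from tendsto_diff[OF tendsto_const[of "l2_inner \<Omega> u v"] this] show ?thesis
    by simp
qed

text \<open>
  Convergence in \<open>L\<^sup>2\<close> is convergence of the squared differences to zero in \<open>L\<^sup>1\<close>.
\<close>

lemma l2_convergence_AE_subseq:
  fixes u :: "'a::euclidean_space \<Rightarrow> real"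
  assumes U: "\<And>k. U k \<in> L2 \<Omega>" and u: "u \<in> L2 \<Omega>"
    and lim: "(\<lambda>k. l2_norm \<Omega> (\<lambda>x. u x - U k x)) \<longlonglongrightarrow> 0"
  shows "\<exists>r::nat\<Rightarrow>nat. strict_mono r \<and> (AE x in lebesgue_on \<Omega>. (\<lambda>k. U (r k) x) \<longlonglongrightarrow> u x)"
proof -
  have "(\<lambda>k. LINT x|lebesgue_on \<Omega>. norm ((u x - U k x)\<^sup>2)) \<longlonglongrightarrow> 0"
    using tendsto_power[OF lim, of 2] by (simp add: l2_norm_sq)
  moreover have "integrable (lebesgue_on \<Omega>) (\<lambda>x. (u x - U k x)\<^sup>2)" for k
    using L2_integrable_sq[OF L2_diff[OF u U]] by simp
  ultimately obtain r :: "nat \<Rightarrow> nat" where r: "strict_mono r"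
    "AE x in lebesgue_on \<Omega>. (\<lambda>k. (u x - U (r k) x)\<^sup>2) \<longlonglongrightarrow> 0"
    using tendsto_L1_AE_subseq[of "lebesgue_on \<Omega>" "\<lambda>k x. (u x - U k x)\<^sup>2"] by blast
  have "AE x in lebesgue_on \<Omega>. (\<lambda>k. U (r k) x) \<longlonglongrightarrow> u x"
    using r(2)
  proof eventually_elim
    case (elim x)
    then have "(\<lambda>k. sqrt ((u x - U (r k) x)\<^sup>2)) \<longlonglongrightarrow> sqrt 0"
      by (intro tendsto_real_sqrt)
    then have "(\<lambda>k. u x - U (r k) x) \<longlonglongrightarrow> 0"
      by (simp add: tendsto_rabs_zero_iff)
    from tendsto_diff[OF tendsto_const[of "u x"] this] show ?case
      by simp
  qed
  then show ?thesis
    using r(1) by blast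
qed


section \<open>Functions of class \<open>C\<^sup>k\<close>\<close>

lemma frechet_derivative_eqI:
  "(f has_derivative f') (at x) \<Longrightarrow> frechet_derivative f (at x) = f'"
  using frechet_derivative_at by metis

lemma differentiable_has_frechet_derivative:
  "f differentiable (at x) \<Longrightarrow> (f has_derivative frechet_derivative f (at x)) (at x)"
  by (simp add: frechet_derivative_works)

lemma Ck_on_SucD: "Ck_on (Suc k) f S \<Longrightarrow> Ck_on k f S"
proof (induction k arbitrary: f)
  case 0
  then show ?case
    by (simp add: differentiable_imp_continuous_on differentiable_at_imp_differentiable_on)
next
  case (Suc k)
  then show ?case
    by (metis Ck_on.simps(2))
qed

lemma Ck_on_const: "Ck_on k (\<lambda>x. c) UNIV"
proof (induction k arbitrary: c)
  case (Suc k)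
  then show ?case
    using frechet_derivative_eqI[OF has_derivative_const] by simp
qed simp

lemma frechet_derivative_add:
  assumes "f differentiable (at x)" "g differentiable (at x)"
  shows "frechet_derivative (\<lambda>x. f x + g x) (at x) i
    = frechet_derivative f (at x) i + frechet_derivative g (at x) i"
  using frechet_derivative_eqI[OF has_derivative_add[OF
        differentiable_has_frechet_derivative[OF assms(1)]
        differentiable_has_frechet_derivative[OF assms(2)]]]
  by simp

lemma frechet_derivative_scaleR:
  assumes "f differentiable (at x)"
  shows "frechet_derivative (\<lambda>x. c *\<^sub>R f x) (at x) i = c *\<^sub>R frechet_derivative f (at x) i"
  using frechet_derivative_eqI[OF has_derivative_scaleR_right[OF
        differentiable_has_frechet_derivative[OF assms]]]
  by simp

lemma frechet_derivative_mult:
  fixes f g :: "'a::euclidean_space \<Rightarrow> real"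
  assumes "f differentiable (at x)" "g differentiable (at x)"
  shows "frechet_derivative (\<lambda>x. f x * g x) (at x) i
    = f x * frechet_derivative g (at x) i + frechet_derivative f (at x) i * g x"
  using frechet_derivative_eqI[OF has_derivative_mult[OF
        differentiable_has_frechet_derivative[OF assms(1)]
        differentiable_has_frechet_derivative[OF assms(2)]]]
  by simp

lemma Ck_on_add: "Ck_on k f UNIV \<Longrightarrow> Ck_on k g UNIV \<Longrightarrow> Ck_on k (\<lambda>x. f x + g x) UNIV"
proof (induction k arbitrary: f g)
  case 0
  then show ?case by (auto intro: continuous_on_add)
next
  case (Suc k)
  then have d: "\<And>x. f differentiable (at x)" "\<And>x. g differentiable (at x)" by auto
  then show ?case
    using Suc by (auto simp: frechet_derivative_add intro: differentiable_add)
qed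

lemma Ck_on_scaleR: "Ck_on k f UNIV \<Longrightarrow> Ck_on k (\<lambda>x. c *\<^sub>R f x) UNIV"
proof (induction k arbitrary: f)
  case 0
  then show ?case by (auto intro: continuous_on_scaleR)
next
  case (Suc k)
  then have d: "\<And>x. f differentiable (at x)" by auto
  then show ?case
    using Suc by (auto simp: frechet_derivative_scaleR intro: differentiable_scaleR)
qed

lemma Ck_on_mult:
  fixes f g :: "'a::euclidean_space \<Rightarrow> real"
  shows "Ck_on k f UNIV \<Longrightarrow> Ck_on k g UNIV \<Longrightarrow> Ck_on k (\<lambda>x. f x * g x) UNIV"
proof (induction k arbitrary: f g)
  case 0
  then show ?case by (auto intro: continuous_on_mult)
next
  case (Suc k)
  then have d: "\<And>x. f differentiable (at x)" "\<And>x. g differentiable (at x)" by auto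
  have "Ck_on k f UNIV" "Ck_on k g UNIV"
    using Suc.prems Ck_on_SucD by blast+
  then show ?case
    using Suc d by (auto simp: frechet_derivative_mult intro!: differentiable_mult Ck_on_add)
qed

lemma Ck_on_prod:
  fixes f :: "'i \<Rightarrow> 'a::euclidean_space \<Rightarrow> real"
  assumes "finite I" "\<And>i. i \<in> I \<Longrightarrow> Ck_on k (f i) UNIV"
  shows "Ck_on k (\<lambda>x. \<Prod>i\<in>I. f i x) UNIV"
  using assms by (induction I rule: finite_induct) (auto intro: Ck_on_mult Ck_on_const)

section \<open>Continuously differentiable functions of compact support\<close>

text \<open>
  One derivative suffices for all integral identities below. Unlike the test functions of an open
  set, this class is closed under translations, on which their proofs are based.
\<close>

definition C1_compact :: "('a::euclidean_space \<Rightarrow> real) \<Rightarrow> bool" where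
  "C1_compact F \<longleftrightarrow> Ck_on 1 F UNIV \<and> (\<exists>K. compact K \<and> (\<forall>x. x \<notin> K \<longrightarrow> F x = 0))"

abbreviation partial :: "('a::euclidean_space \<Rightarrow> real) \<Rightarrow> 'a \<Rightarrow> 'a \<Rightarrow> real" where
  "partial F i x \<equiv> frechet_derivative F (at x) i"

lemma C1_compact_differentiable: "C1_compact F \<Longrightarrow> F differentiable (at x)"
  by (simp add: C1_compact_def)

lemma C1_compact_has_derivative: "C1_compact F \<Longrightarrow> (F has_derivative frechet_derivative F (at x)) (at x)"
  using C1_compact_differentiable differentiable_has_frechet_derivative by blast

lemma C1_compact_continuous: "C1_compact F \<Longrightarrow> continuous_on UNIV F"
  unfolding C1_compact_def using Ck_on_SucD[of 0 F UNIV] by simp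

lemma partial_zero_outside:
  fixes F :: "'a::euclidean_space \<Rightarrow> real"
  assumes "closed K" "\<And>x. x \<notin> K \<Longrightarrow> F x = 0" "x \<notin> K"
  shows "partial F i x = 0"
proof -
  have "(F has_derivative (\<lambda>h. 0)) (at x)"
    by (rule has_derivative_transform_within_open[where f="\<lambda>x. 0" and s="- K"])
      (use assms in \<open>auto simp: open_Compl\<close>)
  then show ?thesis
    by (simp add: frechet_derivative_eqI)
qed

lemma partial_expand:
  assumes "C1_compact F"
  shows "partial F e x = (\<Sum>i\<in>Basis. (e \<bullet> i) * partial F i x)"
proof -
  have "linear (frechet_derivative F (at x))"
    using C1_compact_has_derivative[OF assms] has_derivative_linear by blast
  then have "partial F (\<Sum>i\<in>Basis. (e \<bullet> i) *\<^sub>R i) x = (\<Sum>i\<in>Basis. (e \<bullet> i) * partial F i x)"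
    by (simp add: linear_sum linear_scale)
  then show ?thesis
    by (simp add: euclidean_representation)
qed

lemma partial_continuous:
  assumes "C1_compact F"
  shows "continuous_on UNIV (partial F e)"
proof -
  have "continuous_on UNIV (\<lambda>x. \<Sum>i\<in>Basis. (e \<bullet> i) * partial F i x)"
    using assms by (intro continuous_intros) (simp add: C1_compact_def)
  then show ?thesis
    by (rule continuous_on_eq) (rule partial_expand[OF assms, symmetric])
qed

lemma partial_uminus: "C1_compact F \<Longrightarrow> partial F (- e) x = - partial F e x"
  using linear_neg[OF has_derivative_linear[OF C1_compact_has_derivative]] by blast

lemma C1_compact_support:
  fixes F :: "'a::euclidean_space \<Rightarrow> real"
  assumes "C1_compact F"
  obtains r where "r > 0" "\<And>x. norm x > r \<Longrightarrow> F x = 0" "\<And>x i. norm x > r \<Longrightarrow> partial F i x = 0"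
proof -
  obtain K where K: "compact K" "\<And>x. x \<notin> K \<Longrightarrow> F x = 0"
    using assms C1_compact_def by blast
  obtain r where r: "r > 0" "\<And>x. x \<in> K \<Longrightarrow> norm x \<le> r"
    using compact_imp_bounded[OF K(1)] by (auto simp: bounded_pos)
  have z: "F x = 0" if "x \<notin> cball 0 r" for x
    using K(2) r(2) that by auto
  show ?thesis
    by (rule that[OF r(1)]) (auto intro!: z partial_zero_outside[OF closed_cball z])
qed

lemma continuous_compact_support_bounded:
  fixes F :: "'a::euclidean_space \<Rightarrow> real"
  assumes "continuous_on UNIV F" "\<And>x. norm x > r \<Longrightarrow> F x = 0"
  obtains B where "B > 0" "\<And>x. \<bar>F x\<bar> \<le> B"
proof -
  have "bounded (F ` cball 0 r)"
    using assms(1) by (intro compact_imp_bounded compact_continuous_image)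
      (auto intro: continuous_on_subset)
  then obtain B where B: "B > 0" "\<And>x. norm x \<le> r \<Longrightarrow> \<bar>F x\<bar> \<le> B"
    by (auto simp: bounded_pos)
  have "\<bar>F x\<bar> \<le> B" for x
    using B(2)[of x] assms(2)[of x] B(1) by (cases "norm x \<le> r") auto
  with B(1) that show ?thesis by blast
qed

lemma continuous_compact_support_integrable:
  fixes F :: "'a::euclidean_space \<Rightarrow> real"
  assumes "continuous_on UNIV F" "\<And>x. norm x > r \<Longrightarrow> F x = 0"
  shows "integrable lborel F"
proof -
  have "set_integrable lborel (cball 0 r) F"
    unfolding set_integrable_def
    by (intro borel_integrable_compact) (use assms in \<open>auto intro: continuous_on_subset\<close>)
  moreover have "(\<lambda>x. indicator (cball 0 r) x *\<^sub>R F x) = F"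
    using assms(2) by (auto simp: indicator_def fun_eq_iff)
  ultimately show ?thesis
    by (simp add: set_integrable_def)
qed

lemma C1_compact_mult:
  assumes "C1_compact F" "C1_compact G"
  shows "C1_compact (\<lambda>x. F x * G x)"
  using assms Ck_on_mult[of 1 F G] unfolding C1_compact_def by (metis mult_eq_0_iff)

lemma
  assumes "C1_compact F"
  shows C1_compact_shift: "C1_compact (\<lambda>x. F (x + a))"
    and partial_shift: "partial (\<lambda>x. F (x + a)) i x = partial F i (x + a)"
proof -
  have d: "((\<lambda>x. F (x + a)) has_derivative frechet_derivative F (at (x + a))) (at x)" for x
  proof -
    have "((\<lambda>x. x + a) has_derivative (\<lambda>h. h)) (at x)"
      by (auto intro!: derivative_eq_intros)
    from has_derivative_compose[OF this C1_compact_has_derivative[OF assms]] show ?thesis .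
  qed
  have p: "partial (\<lambda>x. F (x + a)) i x = partial F i (x + a)" for x i
    using frechet_derivative_eqI[OF d] by simp
  then show "partial (\<lambda>x. F (x + a)) i x = partial F i (x + a)" .
  obtain r where r: "\<And>x. norm x > r \<Longrightarrow> F x = 0"
    using C1_compact_support[OF assms] by metis
  have "F (x + a) = 0" if "x \<notin> cball (- a) r" for x
    using that by (intro r) (simp add: dist_norm norm_minus_commute add.commute)
  then have "\<exists>K. compact K \<and> (\<forall>x. x \<notin> K \<longrightarrow> F (x + a) = 0)"
    using compact_cball by blast
  moreover have "continuous_on UNIV (\<lambda>x. partial F i (x + a))" for i
    using partial_continuous[OF assms, of i]
    by (rule continuous_on_compose2) (auto intro!: continuous_intros)
  ultimately show "C1_compact (\<lambda>x. F (x + a))"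
    using d by (auto simp: C1_compact_def p differentiable_def)
qed

section \<open>Integration by parts\<close>

lemma lborel_integral_translate:
  fixes f :: "'a::euclidean_space \<Rightarrow> real"
  assumes "f \<in> borel_measurable borel"
  shows "(LINT x|lborel. f (x + a)) = (LINT x|lborel. f x)"
proof -
  have "(LINT x|lborel. f x) = (LINT x|distr lborel borel (\<lambda>x. a + x). f x)"
    using lborel_distr_plus[of a] by simp
  also have "\<dots> = (LINT x|lborel. f (a + x))"
    by (rule integral_distr) (use assms in auto)
  finally show ?thesis
    by (simp add: add.commute)
qed

lemma difference_quotient_bound:
  fixes F :: "'a::euclidean_space \<Rightarrow> real"
  assumes F: "C1_compact F" and B: "\<And>x. \<bar>partial F e x\<bar> \<le> B" and "h > 0"
  shows "\<bar>(F (x + h *\<^sub>R e) - F x) / h\<bar> \<le> B"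
proof -
  have "norm (F (x + h *\<^sub>R e) - F (x + 0 *\<^sub>R e)) \<le> B * norm (h - 0)"
  proof (rule differentiable_bound[where S=UNIV and f="\<lambda>t. F (x + t *\<^sub>R e)"
        and f'="\<lambda>t s. s * partial F e (x + t *\<^sub>R e)"])
    fix t :: real
    have "((\<lambda>t. x + t *\<^sub>R e) has_derivative (\<lambda>s. s *\<^sub>R e)) (at t)"
      by (auto intro!: derivative_eq_intros)
    from has_derivative_compose[OF this C1_compact_has_derivative[OF F]]
    show "((\<lambda>t. F (x + t *\<^sub>R e)) has_derivative (\<lambda>s. s * partial F e (x + t *\<^sub>R e))) (at t within UNIV)"
      using linear_scale[OF has_derivative_linear[OF C1_compact_has_derivative[OF F]]] by simp
    show "onorm (\<lambda>s. s * partial F e (x + t *\<^sub>R e)) \<le> B"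
    proof (rule onorm_bound)
      show "0 \<le> B" using B[of x] by linarith
      show "norm (s * partial F e (x + t *\<^sub>R e)) \<le> B * norm s" for s
        using mult_right_mono[OF B[of "x + t *\<^sub>R e"], of "\<bar>s\<bar>"]
        by (simp add: abs_mult mult.commute)
    qed
  qed auto
  then show ?thesis
    using \<open>h > 0\<close> by (simp add: field_simps)
qed

lemma difference_quotient_tendsto:
  fixes F :: "'a::euclidean_space \<Rightarrow> real"
  assumes F: "C1_compact F"
  shows "(\<lambda>n. (F (x + (1 / real (Suc n)) *\<^sub>R e) - F x) / (1 / real (Suc n))) \<longlonglongrightarrow> partial F e x"
proof -
  have "((\<lambda>t. F (x + t *\<^sub>R e)) has_derivative (\<lambda>s. s * partial F e x)) (at 0)"
  proof -
    have 1: "((\<lambda>t. x + t *\<^sub>R e) has_derivative (\<lambda>s. s *\<^sub>R e)) (at 0)"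
      by (auto intro!: derivative_eq_intros)
    have 2: "(F has_derivative frechet_derivative F (at x)) (at (x + 0 *\<^sub>R e))"
      using C1_compact_has_derivative[OF F] by simp
    from has_derivative_compose[OF 1 2] show ?thesis
      using linear_scale[OF has_derivative_linear[OF C1_compact_has_derivative[OF F]]] by simp
  qed
  then have "((\<lambda>t. F (x + t *\<^sub>R e)) has_real_derivative partial F e x) (at 0)"
    by (simp add: has_field_derivative_def mult_commute_abs)
  then have "((\<lambda>h. (F (x + h *\<^sub>R e) - F x) / h) \<longlongrightarrow> partial F e x) (at 0)"
    by (simp add: DERIV_def)
  moreover have "filterlim (\<lambda>n. 1 / real (Suc n)) (at 0) sequentially"
    unfolding filterlim_at using LIMSEQ_inverse_real_of_nat
    by (auto simp: inverse_eq_divide)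
  ultimately show ?thesis
    by (rule filterlim_compose)
qed

text \<open>
  By the mean value theorem the difference quotients are bounded by the supremum of the derivative,
  and for steps of length at most \<open>norm e\<close> they all vanish outside one ball, so that dominated
  convergence applies.
\<close>

lemma difference_quotient_integral_tendsto:
  fixes F G :: "'a::euclidean_space \<Rightarrow> real"
  assumes F: "C1_compact F" and G: "continuous_on UNIV G" "\<And>x. \<bar>G x\<bar> \<le> C"
  shows "(\<lambda>n. LINT x|lborel. G x * ((F (x + (1 / real (Suc n)) *\<^sub>R e) - F x) / (1 / real (Suc n))))
    \<longlonglongrightarrow> (LINT x|lborel. G x * partial F e x)"
proof -
  obtain r where r: "r > 0" "\<And>x. norm x > r \<Longrightarrow> F x = 0" "\<And>x i. norm x > r \<Longrightarrow> partial F i x = 0"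
    using C1_compact_support[OF F] by metis
  obtain B where B: "B > 0" "\<And>x. \<bar>partial F e x\<bar> \<le> B"
    using continuous_compact_support_bounded[OF partial_continuous[OF F, of e] r(3)] by metis
  have [measurable]: "F \<in> borel_measurable borel" "G \<in> borel_measurable borel"
    "partial F e \<in> borel_measurable borel"
    using C1_compact_continuous[OF F] G(1) partial_continuous[OF F, of e]
    by (auto intro: borel_measurable_continuous_onI)
  have C: "C \<ge> 0" using G(2)[of 0] by linarith
  let ?w = "\<lambda>x::'a. indicator (cball 0 (r + norm e)) x *\<^sub>R (C * B)"
  show ?thesis
  proof (rule integral_dominated_convergence[where w="?w"])
    show "integrable lborel ?w"
      by (intro integrable_real_indicator integrable_scaleR_left) (use emeasure_bounded_finite[OF bounded_cball] in auto)
    show "AE x in lborel. (\<lambda>n. G x * ((F (x + (1 / real (Suc n)) *\<^sub>R e) - F x) / (1 / real (Suc n))))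
        \<longlonglongrightarrow> G x * partial F e x"
      by (intro AE_I2 tendsto_mult tendsto_const difference_quotient_tendsto F)
    fix n
    let ?h = "1 / real (Suc n)"
    show "AE x in lborel. norm (G x * ((F (x + ?h *\<^sub>R e) - F x) / ?h)) \<le> ?w x"
    proof (intro AE_I2)
      fix x
      show "norm (G x * ((F (x + ?h *\<^sub>R e) - F x) / ?h)) \<le> ?w x"
      proof (cases "x \<in> cball 0 (r + norm e)")
        case True
        have "\<bar>G x\<bar> * \<bar>(F (x + ?h *\<^sub>R e) - F x) / ?h\<bar> \<le> C * B"
          by (intro mult_mono G difference_quotient_bound[OF F B(2)] C) auto
        then show ?thesis using True by (simp add: abs_mult)
      next
        case False
        then have n: "norm x > r + norm e" by simp
        have "norm (?h *\<^sub>R e) \<le> 1 * norm e"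
          unfolding norm_scaleR by (intro mult_right_mono) auto
        then have "norm (x + ?h *\<^sub>R e) > r"
          using n norm_triangle_ineq2[of x "- (?h *\<^sub>R e)"] by simp
        moreover have "norm x > r" using n norm_ge_zero[of e] by linarith
        ultimately have "F (x + ?h *\<^sub>R e) = 0" "F x = 0" using r(2) by auto
        then show ?thesis using False by simp
      qed
    qed
  qed measurable
qed

text \<open>
  By translation invariance, the integrals of all difference quotients vanish.
\<close>

lemma integral_partial_eq_0:
  assumes F: "C1_compact F"
  shows "(LINT x|lborel. partial F e x) = 0"
proof -
  obtain r where r: "\<And>x. norm x > r \<Longrightarrow> F x = 0"
    using C1_compact_support[OF F] by metis
  have i: "integrable lborel F"
    using continuous_compact_support_integrable[OF C1_compact_continuous[OF F] r] .
  have m: "F \<in> borel_measurable borel"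
    using C1_compact_continuous[OF F] by (rule borel_measurable_continuous_onI)
  have z: "(LINT x|lborel. 1 * ((F (x + h *\<^sub>R e) - F x) / h)) = 0" for h
  proof -
    obtain r' where r': "\<And>x. norm x > r' \<Longrightarrow> F (x + h *\<^sub>R e) = 0"
      using C1_compact_support[OF C1_compact_shift[OF F]] by metis
    have "integrable lborel (\<lambda>x. F (x + h *\<^sub>R e))"
      using continuous_compact_support_integrable[OF C1_compact_continuous[OF C1_compact_shift[OF F]] r'] .
    then show ?thesis
      using i lborel_integral_translate[OF m, of "h *\<^sub>R e"] by simp
  qed
  then have "(\<lambda>n. 0) \<longlonglongrightarrow> (LINT x|lborel. 1 * partial F e x)"
    using difference_quotient_integral_tendsto[OF F, of "\<lambda>x. 1" 1 e] unfolding z by simp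
  then show ?thesis
    by (simp add: LIMSEQ_const_iff)
qed

lemma C1_compact_mult_integrable:
  fixes F G :: "'a::euclidean_space \<Rightarrow> real"
  assumes "C1_compact F" "continuous_on UNIV G"
  shows "integrable lborel (\<lambda>x. F x * G x)" "integrable lborel (\<lambda>x. partial F e x * G x)"
    "integrable lborel (\<lambda>x. G x * F x)" "integrable lborel (\<lambda>x. G x * partial F e x)"
proof -
  obtain r where r: "r > 0" "\<And>x. norm x > r \<Longrightarrow> F x = 0" "\<And>x i. norm x > r \<Longrightarrow> partial F i x = 0"
    using C1_compact_support[OF assms(1)] by metis
  show "integrable lborel (\<lambda>x. F x * G x)" "integrable lborel (\<lambda>x. partial F e x * G x)"
    by (rule continuous_compact_support_integrable[where r=r],
        intro continuous_on_mult C1_compact_continuous partial_continuous assms, simp add: r)+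
  then show "integrable lborel (\<lambda>x. G x * F x)" "integrable lborel (\<lambda>x. G x * partial F e x)"
    by (simp_all add: mult.commute)
qed

lemma integration_by_parts:
  assumes F: "C1_compact F" and G: "C1_compact G"
  shows "(LINT x|lborel. F x * partial G e x) = - (LINT x|lborel. partial F e x * G x)"
proof -
  have "0 = (LINT x|lborel. F x * partial G e x + partial F e x * G x)"
    using integral_partial_eq_0[OF C1_compact_mult[OF F G], of e]
    by (simp add: frechet_derivative_mult C1_compact_differentiable F G)
  also have "\<dots> = (LINT x|lborel. F x * partial G e x) + (LINT x|lborel. partial F e x * G x)"
    by (intro Bochner_Integration.integral_add C1_compact_mult_integrable assms
        partial_continuous C1_compact_continuous)
  finally show ?thesis by simp
qed

text \<open>
  For twice differentiable \<open>G\<close>, both sides equal \<open>- \<integral>F \<partial>\<^sub>i\<partial>\<^sub>jG\<close>. Second derivatives are avoided by replacing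
  \<open>\<partial>\<^sub>jG\<close> by a difference quotient: translation invariance moves the difference to \<open>F\<close>, with the opposite
  sign of the step, and integration by parts moves \<open>\<partial>\<^sub>i\<close> to \<open>G\<close>.
\<close>

lemma integral_partial_partial_commute:
  assumes F: "C1_compact F" and G: "C1_compact G"
  shows "(LINT x|lborel. partial F i x * partial G j x) = (LINT x|lborel. partial F j x * partial G i x)"
proof -
  have eq: "(LINT x|lborel. partial F i x * ((G (x + h *\<^sub>R j) - G x) / h))
      = - (LINT x|lborel. partial G i x * ((F (x + h *\<^sub>R (- j)) - F x) / h))" for h
  proof -
    let ?G = "\<lambda>x. G (x + h *\<^sub>R j)" and ?F = "\<lambda>x. F (x + h *\<^sub>R (- j))"
    have G': "C1_compact ?G" and F': "C1_compact ?F"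
      by (rule C1_compact_shift[OF G], rule C1_compact_shift[OF F])
    have int: "integrable lborel (\<lambda>x. partial F i x * ?G x)" "integrable lborel (\<lambda>x. partial F i x * G x)"
      "integrable lborel (\<lambda>x. ?F x * partial G i x)" "integrable lborel (\<lambda>x. F x * partial G i x)"
      by (intro C1_compact_mult_integrable F G F' C1_compact_continuous partial_continuous G')+
    have m: "(\<lambda>x. F (x + h *\<^sub>R (- j)) * partial G i x) \<in> borel_measurable borel"
      by (intro borel_measurable_continuous_onI continuous_on_mult C1_compact_continuous
          partial_continuous F' G)
    have "(LINT x|lborel. partial F i x * ((?G x - G x) / h))
        = ((LINT x|lborel. partial F i x * ?G x) - (LINT x|lborel. partial F i x * G x)) / h"
      using int by (simp add: right_diff_distrib)
    also have "(LINT x|lborel. partial F i x * ?G x) = - (LINT x|lborel. F x * partial G i (x + h *\<^sub>R j))"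
      using integration_by_parts[OF F G', of i] by (simp add: partial_shift[OF G])
    also have "(LINT x|lborel. F x * partial G i (x + h *\<^sub>R j)) = (LINT x|lborel. ?F x * partial G i x)"
      using lborel_integral_translate[OF m, of "h *\<^sub>R j"] by simp
    also have "(LINT x|lborel. partial F i x * G x) = - (LINT x|lborel. F x * partial G i x)"
      using integration_by_parts[OF F G, of i] by simp
    also have "(- (LINT x|lborel. ?F x * partial G i x) - - (LINT x|lborel. F x * partial G i x)) / h
        = - (LINT x|lborel. ?F x * partial G i x - F x * partial G i x) / h"
      by (subst Bochner_Integration.integral_diff[OF int(3,4)]) simp
    also have "\<dots> = - (LINT x|lborel. (?F x * partial G i x - F x * partial G i x) / h)"
      by simp
    finally show ?thesis
      by (simp add: algebra_simps diff_divide_distrib)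
  qed
  obtain r where r: "\<And>x k. norm x > r \<Longrightarrow> partial F k x = 0"
    using C1_compact_support[OF F] by metis
  obtain B where B: "\<And>x. \<bar>partial F i x\<bar> \<le> B"
    using continuous_compact_support_bounded[OF partial_continuous[OF F] r] by metis
  obtain s where s: "\<And>x k. norm x > s \<Longrightarrow> partial G k x = 0"
    using C1_compact_support[OF G] by metis
  obtain C where C: "\<And>x. \<bar>partial G i x\<bar> \<le> C"
    using continuous_compact_support_bounded[OF partial_continuous[OF G] s] by metis
  have "(\<lambda>n. LINT x|lborel. partial F i x * ((G (x + (1 / real (Suc n)) *\<^sub>R j) - G x) / (1 / real (Suc n))))
      \<longlonglongrightarrow> (LINT x|lborel. partial F i x * partial G j x)"
    by (rule difference_quotient_integral_tendsto[OF G partial_continuous[OF F] B])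
  moreover have "(\<lambda>n. - (LINT x|lborel. partial G i x * ((F (x + (1 / real (Suc n)) *\<^sub>R (- j)) - F x) / (1 / real (Suc n)))))
      \<longlonglongrightarrow> - (LINT x|lborel. partial G i x * partial F (- j) x)"
    by (intro tendsto_minus difference_quotient_integral_tendsto[OF F partial_continuous[OF G] C])
  ultimately have "(LINT x|lborel. partial F i x * partial G j x)
      = - (LINT x|lborel. partial G i x * partial F (- j) x)"
    unfolding eq by (rule LIMSEQ_unique)
  then show ?thesis
    by (simp add: partial_uminus[OF F] mult.commute)
qed


section \<open>Smooth bump functions\<close>

definition exp_cutoff :: "real poly \<Rightarrow> real \<Rightarrow> real" where
  "exp_cutoff p t = (if t > 0 then poly p (1 / t) * exp (- (1 / t)) else 0)"

lemma poly_div_exp_tendsto_0: "((\<lambda>x::real. poly p x * exp (- x)) \<longlongrightarrow> 0) at_top"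
proof -
  have "((\<lambda>x::real. \<Sum>i\<le>degree p. coeff p i * (x ^ i / exp x)) \<longlongrightarrow> (\<Sum>i\<le>degree p. coeff p i * 0)) at_top"
    by (intro tendsto_intros tendsto_power_div_exp_0)
  then show ?thesis
    by (simp add: poly_altdef sum_distrib_right exp_minus sum_divide_distrib field_simps)
qed

text \<open>
  The family is closed under differentiation, whence its members are smooth. At the origin all
  derivatives vanish because the exponential beats every power of \<open>1/t\<close>.
\<close>

lemma exp_cutoff_has_derivative:
  "(exp_cutoff p has_real_derivative exp_cutoff ([:0, 0, 1:] * (p - pderiv p)) t) (at t)"
proof -
  consider "t > 0" | "t < 0" | "t = 0" by linarith
  then show ?thesis
  proof cases
    case 1
    have "((\<lambda>t. poly p (1 / t) * exp (- (1 / t))) has_real_derivative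
        exp_cutoff ([:0, 0, 1:] * (p - pderiv p)) t) (at t)"
      using 1 unfolding exp_cutoff_def
      by (auto intro!: derivative_eq_intros simp: field_simps power2_eq_square)
    then show ?thesis
      by (rule has_field_derivative_transform_within_open[where S="{0<..}"])
        (use 1 in \<open>auto simp: exp_cutoff_def\<close>)
  next
    case 2
    have "((\<lambda>t. 0) has_real_derivative exp_cutoff ([:0, 0, 1:] * (p - pderiv p)) t) (at t)"
      using 2 by (simp add: exp_cutoff_def)
    then show ?thesis
      by (rule has_field_derivative_transform_within_open[where S="{..<0}"])
        (use 2 in \<open>auto simp: exp_cutoff_def\<close>)
  next
    case 3
    have "((\<lambda>h. exp_cutoff p h / h) \<longlongrightarrow> 0) (at 0)"
    proof (rule filterlim_split_at)
      show "((\<lambda>h. exp_cutoff p h / h) \<longlongrightarrow> 0) (at_left 0)"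
        by (rule tendsto_eventually)
          (auto simp: exp_cutoff_def eventually_at_filter)
      have "((\<lambda>h. poly ([:0, 1:] * p) (inverse h) * exp (- inverse h)) \<longlongrightarrow> 0) (at_right (0::real))"
        by (rule filterlim_compose[OF poly_div_exp_tendsto_0 filterlim_inverse_at_top_right])
      then show "((\<lambda>h. exp_cutoff p h / h) \<longlongrightarrow> 0) (at_right 0)"
        by (rule Lim_transform_eventually)
          (auto simp: exp_cutoff_def eventually_at_filter field_simps)
    qed
    then show ?thesis
      using 3 by (simp add: DERIV_def exp_cutoff_def)
  qed
qed

lemma exp_cutoff_affine_has_derivative:
  "((\<lambda>x. exp_cutoff p (c * (x \<bullet> b) + a)) has_derivative
    (\<lambda>h. c * (h \<bullet> b) * exp_cutoff ([:0, 0, 1:] * (p - pderiv p)) (c * (x \<bullet> b) + a))) (at x)"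
proof -
  have "((\<lambda>x. c * (x \<bullet> b) + a) has_derivative (\<lambda>h. c * (h \<bullet> b))) (at x)"
    by (auto intro!: derivative_eq_intros)
  moreover have "(exp_cutoff p has_derivative
      (\<lambda>h. h * exp_cutoff ([:0, 0, 1:] * (p - pderiv p)) (c * (x \<bullet> b) + a))) (at (c * (x \<bullet> b) + a))"
    using exp_cutoff_has_derivative[of p "c * (x \<bullet> b) + a"]
    by (simp add: has_field_derivative_def mult_commute_abs)
  ultimately show ?thesis
    by (rule has_derivative_compose)
qed

lemma Ck_on_exp_cutoff:
  fixes b :: "'a::euclidean_space"
  shows "Ck_on k (\<lambda>x. exp_cutoff p (c * (x \<bullet> b) + a)) UNIV"
proof (induction k arbitrary: p)
  case 0
  have "(\<lambda>x. exp_cutoff p (c * (x \<bullet> b) + a)) differentiable_on UNIV"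
    by (intro differentiable_at_imp_differentiable_on differentiableI[OF exp_cutoff_affine_has_derivative])
  then show ?case
    by (simp add: differentiable_imp_continuous_on)
next
  case (Suc k)
  have "frechet_derivative (\<lambda>x. exp_cutoff p (c * (x \<bullet> b) + a)) (at x) i
      = (c * (i \<bullet> b)) *\<^sub>R exp_cutoff ([:0, 0, 1:] * (p - pderiv p)) (c * (x \<bullet> b) + a)" for x i
    by (simp only: frechet_derivative_eqI[OF exp_cutoff_affine_has_derivative] real_scaleR_def)
  then show ?case
    by (simp only: Ck_on.simps Ck_on_scaleR Suc.IH
        differentiableI[OF exp_cutoff_affine_has_derivative] ball_simps) simp
qed

text \<open>
  The dilates \<open>smooth_step (k t)\<close> increase to the indicator of \<open>t > 0\<close> as \<open>k\<close> tends to infinity. Hence the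
  bump functions below tend to the indicator of an open box, and vanish outside it for every \<open>k\<close>.
\<close>

definition smooth_step :: "real \<Rightarrow> real" where
  "smooth_step t = exp_cutoff 1 t"

definition box_bump :: "real \<Rightarrow> 'a::euclidean_space \<Rightarrow> 'a \<Rightarrow> 'a \<Rightarrow> real" where
  "box_bump k a b x = (\<Prod>i\<in>Basis. smooth_step (k * ((x - a) \<bullet> i)) * smooth_step (k * ((b - x) \<bullet> i)))"

lemma smooth_step_bounds: "0 \<le> smooth_step t" "smooth_step t \<le> 1"
  by (auto simp: smooth_step_def exp_cutoff_def)

lemma smooth_step_nonpos: "t \<le> 0 \<Longrightarrow> smooth_step t = 0"
  by (auto simp: smooth_step_def exp_cutoff_def)

lemma box_bump_test_function:
  assumes "cbox a b \<subseteq> \<Omega>" and k: "0 \<le> k"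
  shows "box_bump k a b \<in> test_functions \<Omega>"
proof -
  have "Ck_on m (\<lambda>x. smooth_step (k * ((x - a) \<bullet> i)) * smooth_step (k * ((b - x) \<bullet> i))) UNIV" for m i
  proof -
    have "(\<lambda>x. smooth_step (k * ((x - a) \<bullet> i)) * smooth_step (k * ((b - x) \<bullet> i)))
      = (\<lambda>x. exp_cutoff 1 (k * (x \<bullet> i) + (- k * (a \<bullet> i))) * exp_cutoff 1 (- k * (x \<bullet> i) + k * (b \<bullet> i)))"
      by (simp add: smooth_step_def inner_diff_left algebra_simps)
    then show ?thesis
      by (simp only: Ck_on_mult Ck_on_exp_cutoff)
  qed
  then have "Ck_on m (box_bump k a b) UNIV" for m
    unfolding box_bump_def[abs_def] by (intro Ck_on_prod) auto
  moreover have "box_bump k a b x = 0" if "x \<notin> cbox a b" for x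
  proof -
    from that obtain i where i: "i \<in> Basis" "x \<bullet> i < a \<bullet> i \<or> x \<bullet> i > b \<bullet> i"
      by (auto simp: mem_box not_le)
    then have "k * ((x - a) \<bullet> i) \<le> 0 \<or> k * ((b - x) \<bullet> i) \<le> 0"
      using k by (auto simp: inner_diff_left mult_le_0_iff)
    then have "smooth_step (k * ((x - a) \<bullet> i)) * smooth_step (k * ((b - x) \<bullet> i)) = 0"
      using smooth_step_nonpos by auto
    then show ?thesis
      unfolding box_bump_def using i(1) by (intro prod_zero) auto
  qed
  ultimately show ?thesis
    using assms by (auto simp: test_functions_def intro!: exI[of _ "cbox a b"])
qed

lemma box_bump_bounds: "0 \<le> box_bump k a b x" "box_bump k a b x \<le> 1"
  unfolding box_bump_def
  by (auto intro!: prod_nonneg prod_le_1 mult_nonneg_nonneg mult_le_one smooth_step_bounds)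

lemma smooth_step_tendsto:
  "(\<lambda>k. smooth_step (real k * t)) \<longlonglongrightarrow> (if t > 0 then 1 else 0)"
proof (cases "t > 0")
  case True
  have "(\<lambda>k. exp (- (inverse (real k) * inverse t))) \<longlonglongrightarrow> exp (- (0 * inverse t))"
    by (intro tendsto_intros lim_inverse_n)
  moreover have "eventually (\<lambda>k. exp (- (inverse (real k) * inverse t)) = smooth_step (real k * t)) sequentially"
    using eventually_gt_at_top[of 0]
    by eventually_elim (use True in \<open>auto simp: smooth_step_def exp_cutoff_def field_simps\<close>)
  ultimately show ?thesis
    using True Lim_transform_eventually by fastforce
next
  case False
  then have "smooth_step (real k * t) = 0" for k
    by (intro smooth_step_nonpos) (simp add: mult_le_0_iff)
  then show ?thesis using False by simp
qed

lemma box_bump_tendsto: "(\<lambda>k. box_bump (real k) a b x) \<longlonglongrightarrow> indicator (box a b) x"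
proof -
  have "(\<lambda>k. box_bump (real k) a b x) \<longlonglongrightarrow>
      (\<Prod>i\<in>Basis. (if (x - a) \<bullet> i > 0 then 1 else 0) * (if (b - x) \<bullet> i > 0 then 1 else 0))"
    unfolding box_bump_def by (intro tendsto_prod tendsto_mult smooth_step_tendsto)
  also have "(\<Prod>i\<in>Basis. (if (x - a) \<bullet> i > 0 then 1 else 0) * (if (b - x) \<bullet> i > 0 then 1 else (0::real)))
      = indicator (box a b) x"
  proof (cases "x \<in> box a b")
    case False
    then obtain i where "i \<in> Basis" "\<not> ((x - a) \<bullet> i > 0) \<or> \<not> ((b - x) \<bullet> i > 0)"
      by (auto simp: mem_box inner_diff_left)
    with False show ?thesis
      by (auto intro!: prod_zero)
  qed (auto simp: mem_box inner_diff_left)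
  finally show ?thesis .
qed

section \<open>The fundamental lemma of the calculus of variations\<close>

text \<open>
  Boxes form an intersection-stable generator of the Borel sets, so the sets over which \<open>h\<close> has
  integral zero contain all Borel sets; complements are handled by the integral over the whole space.
\<close>

lemma AE_zero_if_box_integrals_zero:
  fixes h :: "'a::euclidean_space \<Rightarrow> real"
  assumes h: "integrable lborel h"
    and zero: "\<And>a b. (LINT x|lborel. indicator (box a b) x * h x) = 0"
    and total: "(LINT x|lborel. h x) = 0"
  shows "AE x in lborel. h x = 0"
proof (rule sigma_finite_measure.density_zero[OF lborel.sigma_finite_measure_axioms h])
  fix A :: "'a set" assume "A \<in> sets lborel"
  then have A: "A \<in> sigma_sets UNIV (range (\<lambda>(a, b). box a b))"
    by (simp add: borel_eq_box)
  have S: "Int_stable (range (\<lambda>(a, b). box a b :: 'a set))"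
    by (auto simp: Int_stable_def box_Int_box)
  have borel: "B \<in> sets borel" if "B \<in> sigma_sets UNIV (range (\<lambda>(a, b). box a b :: 'a set))" for B
    using that by (simp add: borel_eq_box)
  have si: "set_integrable lborel B h" if "B \<in> sets borel" for B
    unfolding set_integrable_def using h that by (intro integrable_mult_indicator) auto
  show "set_lebesgue_integral lborel A h = 0"
  proof (rule sigma_sets_induct_disjoint[OF S _ A])
    show "range (\<lambda>(a, b). box a b) \<subseteq> Pow (UNIV::'a set)" by simp
    show "set_lebesgue_integral lborel B h = 0" if "B \<in> range (\<lambda>(a, b). box a b)" for B
      using that zero by (auto simp: set_lebesgue_integral_def)
    show "set_lebesgue_integral lborel {} h = 0"
      by (simp add: set_lebesgue_integral_def)
    show "set_lebesgue_integral lborel (UNIV - B) h = 0"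
      if B: "B \<in> sigma_sets UNIV (range (\<lambda>(a, b). box a b))" and "set_lebesgue_integral lborel B h = 0" for B
    proof -
      have "(LINT x:B \<union> (UNIV - B)|lborel. h x) = (LINT x:B|lborel. h x) + (LINT x:UNIV - B|lborel. h x)"
        using borel[OF B] by (intro set_integral_Un si) auto
      moreover have "(LINT x:B \<union> (UNIV - B)|lborel. h x) = (LINT x|lborel. h x)"
        by (simp add: set_lebesgue_integral_def)
      ultimately show ?thesis
        using that(2) total by simp
    qed
    show "set_lebesgue_integral lborel (\<Union> (range D)) h = 0"
      if "disjoint_family D" "range D \<subseteq> sigma_sets UNIV (range (\<lambda>(a, b). box a b))"
        "\<And>i. set_lebesgue_integral lborel (D i) h = 0" for D :: "nat \<Rightarrow> 'a set"
    proof -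
      have D: "D i \<in> sets borel" for i using borel that(2) by blast
      have "(LINT x:(\<Union>i. D i)|lborel. h x) = (\<Sum>i. (LINT x:(D i)|lborel. h x))"
        using D that(1)
        by (intro lebesgue_integral_countable_add si) (auto simp: disjoint_family_on_def)
      then show ?thesis
        using that(3) by simp
    qed
  qed
qed

lemma test_function_continuous: "\<phi> \<in> test_functions \<Omega> \<Longrightarrow> continuous_on UNIV \<phi>"
  using Ck_on.simps(1) unfolding test_functions_def by blast

lemma test_function_measurable:
  "\<phi> \<in> test_functions \<Omega> \<Longrightarrow> \<phi> \<in> borel_measurable borel"
  using test_function_continuous borel_measurable_continuous_onI by blast

text \<open>
  Testing with bump functions shows that the integral over each box with closure in \<open>\<Omega>\<close> is zero.
  Boxes contained in one such box \<open>B\<close> determine \<open>g\<close> on \<open>B\<close>, and countably many \<open>B\<close> cover \<open>\<Omega>\<close>.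
\<close>

theorem fundamental_lemma_calculus_of_variations:
  fixes g :: "'a::euclidean_space \<Rightarrow> real"
  assumes \<Omega>: "open \<Omega>" and g: "integrable (lebesgue_on \<Omega>) g"
    and zero: "\<And>\<phi>. \<phi> \<in> test_functions \<Omega> \<Longrightarrow> (LINT x|lebesgue_on \<Omega>. g x * \<phi> x) = 0"
  shows "AE x in lebesgue_on \<Omega>. g x = 0"
proof -
  have \<Omega>s[measurable]: "\<Omega> \<in> sets lebesgue" using \<Omega> by auto
  define G where "G x = indicator \<Omega> x * g x" for x
  have G: "integrable lebesgue G"
    unfolding G_def using g \<Omega>s by (simp add: integrable_restrict_space)
  have Gm: "G \<in> borel_measurable lebesgue" using G by simp
  have box_m: "indicat_real (box a b) \<in> borel_measurable lebesgue" for a b :: 'a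
    by (intro measurable_completion) simp
  have box0: "(LINT x|lebesgue. indicator (box a b) x * G x) = 0" if "cbox a b \<subseteq> \<Omega>" for a b
  proof -
    have "(\<lambda>k. LINT x|lebesgue. box_bump (real k) a b x * G x)
        \<longlonglongrightarrow> (LINT x|lebesgue. indicator (box a b) x * G x)"
    proof (rule integral_dominated_convergence[where w="\<lambda>x. \<bar>G x\<bar>"])
      show "AE x in lebesgue. (\<lambda>k. box_bump (real k) a b x * G x) \<longlonglongrightarrow> indicator (box a b) x * G x"
        by (intro AE_I2 tendsto_intros box_bump_tendsto)
      show "AE x in lebesgue. norm (box_bump (real k) a b x * G x) \<le> \<bar>G x\<bar>" for k
        using box_bump_bounds[of "real k" a b]
        by (intro AE_I2) (auto simp: abs_mult intro: mult_left_le_one_le)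
      have "box_bump (real k) a b \<in> borel_measurable lebesgue" for k
        using test_function_measurable[OF box_bump_test_function[OF that of_nat_0_le_iff]]
        by (intro measurable_completion) simp
      then show "(\<lambda>x. box_bump (real k) a b x * G x) \<in> borel_measurable lebesgue" for k
        using G by measurable
      show "(\<lambda>x. indicator (box a b) x * G x) \<in> borel_measurable lebesgue"
        by (intro borel_measurable_times box_m Gm)
    qed (use G in auto)
    moreover have "(LINT x|lebesgue. box_bump (real k) a b x * G x) = 0" for k
    proof -
      have "(LINT x|lebesgue. box_bump (real k) a b x * G x)
          = (LINT x|lebesgue. indicator \<Omega> x *\<^sub>R (g x * box_bump (real k) a b x))"
        by (intro Bochner_Integration.integral_cong) (simp_all add: G_def mult_ac)
      also have "\<dots> = (LINT x|lebesgue_on \<Omega>. g x * box_bump (real k) a b x)"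
        using \<Omega>s by (simp add: integral_restrict_space)
      finally show ?thesis
        using zero[OF box_bump_test_function[OF that of_nat_0_le_iff]] by simp
    qed
    ultimately show ?thesis
      by (simp add: LIMSEQ_const_iff)
  qed
  \<comment> \<open>boxes generate the Borel sets only, so \<open>G\<close> is replaced by a Borel function\<close>
  obtain G' where G'[measurable]: "G' \<in> borel_measurable borel" and GG': "AE x in lborel. G x = G' x"
    using completion_ex_borel_measurable_real[of G lborel] G by auto
  have GG'2: "AE x in lebesgue. G x = G' x"
    by (rule AE_completion[OF GG'])
  have G'i: "integrable lborel G'"
  proof -
    have "integrable lebesgue G'"
      by (rule integrable_cong_AE_imp[OF G]) (use GG'2 G' in \<open>auto intro: measurable_completion\<close>)
    then show ?thesis
      by (simp add: integrable_completion)
  qed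
  have box1: "(LINT x|lborel. indicator (box a b) x * G' x) = 0" if "cbox a b \<subseteq> \<Omega>" for a b
  proof -
    have m: "(\<lambda>x. indicator (box a b) x * G' x) \<in> borel_measurable borel" by measurable
    have "(LINT x|lborel. indicator (box a b) x * G' x) = (LINT x|lebesgue. indicator (box a b) x * G' x)"
      using m by (simp add: integral_completion)
    also have "\<dots> = (LINT x|lebesgue. indicator (box a b) x * G x)"
    proof (rule integral_cong_AE)
      show "(\<lambda>x. indicat_real (box a b) x * G' x) \<in> borel_measurable lebesgue"
        using m by (intro measurable_completion) simp
      show "(\<lambda>x. indicat_real (box a b) x * G x) \<in> borel_measurable lebesgue"
        by (intro borel_measurable_times box_m Gm)
      show "AE x in lebesgue. indicat_real (box a b) x * G' x = indicat_real (box a b) x * G x"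
        using GG'2 by eventually_elim simp
    qed
    finally show ?thesis using box0[OF that] by simp
  qed
  have AEbox: "AE x in lborel. x \<in> box p q \<longrightarrow> G' x = 0" if pq: "cbox p q \<subseteq> \<Omega>" for p q
  proof -
    have "AE x in lborel. indicator (box p q) x * G' x = 0"
    proof (rule AE_zero_if_box_integrals_zero)
      show "integrable lborel (\<lambda>x. indicator (box p q) x * G' x)"
        using integrable_mult_indicator[OF _ G'i, of "box p q"] by simp
      show "(LINT x|lborel. indicator (box p q) x * G' x) = 0"
        by (rule box1[OF pq])
      fix a b
      have "(LINT x|lborel. indicator (box a b) x * (indicator (box p q) x * G' x))
          = (LINT x|lborel. indicator (box a b \<inter> box p q) x * G' x)"
        by (simp add: indicator_inter_arith mult.assoc)
      moreover have "(LINT x|lborel. indicator (box a b \<inter> box p q) x * G' x) = 0"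
      proof -
        let ?c = "\<Sum>i\<in>Basis. max (a \<bullet> i) (p \<bullet> i) *\<^sub>R i" and ?d = "\<Sum>i\<in>Basis. min (b \<bullet> i) (q \<bullet> i) *\<^sub>R i"
        have "cbox ?c ?d \<subseteq> \<Omega>"
          using pq Int_interval[of a b p q] by auto
        then show ?thesis
          unfolding box_Int_box by (rule box1)
      qed
      ultimately show "(LINT x|lborel. indicator (box a b) x * (indicator (box p q) x * G' x)) = 0"
        by simp
    qed
    then show ?thesis
      by eventually_elim (auto simp: indicator_def)
  qed
  obtain D where D: "countable D" "D \<subseteq> Pow \<Omega>" "\<And>X. X \<in> D \<Longrightarrow> \<exists>a b. X = cbox a b" "\<Union>D = \<Omega>"
    using open_countable_Union_open_cbox[OF \<Omega>] by metis
  have "AE x in lebesgue. \<forall>X\<in>D. x \<in> X \<longrightarrow> G x = 0"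
  proof (subst AE_ball_countable[OF D(1)], intro ballI)
    fix X assume X: "X \<in> D"
    then obtain p q where pq: "X = cbox p q" using D(3) by blast
    then have sub: "cbox p q \<subseteq> \<Omega>" using X D(2) by blast
    have "AE x in lebesgue. x \<notin> cbox p q - box p q"
      using negligible_frontier_interval[of p q] AE_not_in unfolding negligible_iff_null_sets by blast
    then show "AE x in lebesgue. x \<in> X \<longrightarrow> G x = 0"
      using AE_completion[OF AEbox[OF sub]] GG'2
      by eventually_elim (auto simp: pq)
  qed
  then show ?thesis
    unfolding AE_restrict_space_iff[of \<Omega> lebesgue, simplified]
    by eventually_elim (use D(4) in \<open>auto simp: G_def indicator_def split: if_splits\<close>)
qed


section \<open>Weak gradients\<close>

lemma test_function_C1_compact: "\<phi> \<in> test_functions \<Omega> \<Longrightarrow> C1_compact \<phi>"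
  unfolding test_functions_def C1_compact_def by blast

lemma test_functions_add:
  assumes "\<phi> \<in> test_functions \<Omega>" "\<psi> \<in> test_functions \<Omega>"
  shows "(\<lambda>x. \<phi> x + \<psi> x) \<in> test_functions \<Omega>"
proof -
  obtain K L where "K \<subseteq> \<Omega>" "compact K" "\<And>x. x \<notin> K \<Longrightarrow> \<phi> x = 0"
    "L \<subseteq> \<Omega>" "compact L" "\<And>x. x \<notin> L \<Longrightarrow> \<psi> x = 0"
    using assms by (auto simp: test_functions_def)
  then show ?thesis
    using assms by (auto simp: test_functions_def Ck_on_add intro!: exI[of _ "K \<union> L"])
qed

lemma test_functions_scaleR:
  assumes "\<phi> \<in> test_functions \<Omega>"
  shows "(\<lambda>x. c * \<phi> x) \<in> test_functions \<Omega>"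
proof -
  obtain K where K: "K \<subseteq> \<Omega>" "compact K" "\<And>x. x \<notin> K \<Longrightarrow> \<phi> x = 0"
    using assms by (auto simp: test_functions_def)
  have "Ck_on k (\<lambda>x. c *\<^sub>R \<phi> x) UNIV" for k
    using assms by (intro Ck_on_scaleR) (simp add: test_functions_def)
  then show ?thesis
    unfolding test_functions_def mem_Collect_eq using K by (intro conjI allI exI[of _ K]) auto
qed

lemma test_function_outside:
  assumes "\<phi> \<in> test_functions \<Omega>" "x \<notin> \<Omega>"
  shows "\<phi> x = 0" "partial \<phi> e x = 0"
proof -
  obtain K where K: "K \<subseteq> \<Omega>" "compact K" "\<And>x. x \<notin> K \<Longrightarrow> \<phi> x = 0"
    using assms by (auto simp: test_functions_def)
  show "\<phi> x = 0" using K assms by auto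
  show "partial \<phi> e x = 0"
    using K assms by (intro partial_zero_outside[where K=K]) (auto simp: compact_imp_closed)
qed

lemma
  fixes H :: "'a::euclidean_space \<Rightarrow> real"
  assumes "open \<Omega>" "H \<in> borel_measurable borel" "\<And>x. x \<notin> \<Omega> \<Longrightarrow> H x = 0"
  shows integral_lebesgue_on_eq_lborel: "(LINT x|lebesgue_on \<Omega>. H x) = (LINT x|lborel. H x)"
    and integrable_lebesgue_on_iff_lborel: "integrable (lebesgue_on \<Omega>) H \<longleftrightarrow> integrable lborel H"
proof -
  have eq: "(\<lambda>x. indicator \<Omega> x *\<^sub>R H x) = H"
    using assms(3) by (auto simp: indicator_def fun_eq_iff)
  have s: "\<Omega> \<inter> space lebesgue \<in> sets lebesgue" using assms(1) by simp
  show "(LINT x|lebesgue_on \<Omega>. H x) = (LINT x|lborel. H x)"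
    using integral_restrict_space[OF s, of H] assms(2) unfolding eq
    by (simp add: integral_completion)
  show "integrable (lebesgue_on \<Omega>) H \<longleftrightarrow> integrable lborel H"
    using integrable_restrict_space[OF s, of H] assms(2) unfolding eq
    by (simp add: integrable_completion)
qed

lemma C1_compact_products_measurable:
  assumes F: "C1_compact F" and G: "C1_compact G"
  shows "(\<lambda>x. F x * partial G e x) \<in> borel_measurable borel"
    "(\<lambda>x. partial F e x * G x) \<in> borel_measurable borel"
    "(\<lambda>x. partial F e x * partial G a x) \<in> borel_measurable borel"
  using borel_measurable_integrable[OF C1_compact_mult_integrable(1)[OF F partial_continuous[OF G]]]
    borel_measurable_integrable[OF C1_compact_mult_integrable(2)[OF F C1_compact_continuous[OF G]]]
    borel_measurable_integrable[OF C1_compact_mult_integrable(2)[OF F partial_continuous[OF G]]]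
  by simp_all

definition classical_gradient :: "('a::euclidean_space \<Rightarrow> real) \<Rightarrow> 'a \<Rightarrow> 'a" where
  "classical_gradient \<phi> x = (\<Sum>i\<in>Basis. partial \<phi> i x *\<^sub>R i)"

lemma classical_gradient_inner: "i \<in> Basis \<Longrightarrow> classical_gradient \<phi> x \<bullet> i = partial \<phi> i x"
  by (simp add: classical_gradient_def inner_sum_left_Basis)

lemma L2_componentI:
  fixes g :: "'a::euclidean_space \<Rightarrow> 'b::euclidean_space"
  assumes "\<And>i. i \<in> Basis \<Longrightarrow> (\<lambda>x. g x \<bullet> i) \<in> L2 \<Omega>"
  shows "g \<in> L2 \<Omega>"
proof -
  have "g \<in> borel_measurable (lebesgue_on \<Omega>)"
    by (rule borel_measurable_euclidean_space[THEN iffD2]) (use assms in \<open>auto simp: L2_def\<close>)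
  moreover have "integrable (lebesgue_on \<Omega>) (\<lambda>x. \<Sum>i\<in>Basis. (g x \<bullet> i)\<^sup>2)"
    using assms by (intro Bochner_Integration.integrable_sum) (auto simp: L2_def)
  moreover have "(norm (g x))\<^sup>2 = (\<Sum>i\<in>Basis. (g x \<bullet> i)\<^sup>2)" for x
    unfolding power2_norm_eq_inner by (subst euclidean_inner) (simp add: power2_eq_square)
  ultimately show ?thesis
    by (simp add: L2_def)
qed

lemma L2_component:
  fixes g :: "'a::euclidean_space \<Rightarrow> 'b::euclidean_space"
  assumes "g \<in> L2 \<Omega>"
  shows "(\<lambda>x. g x \<bullet> i) \<in> L2 \<Omega>"
  by (rule L2_bounded_by[OF assms, where c="norm i"])
    (use assms in \<open>auto simp: L2_def Cauchy_Schwarz_ineq2 mult.commute[of "norm i"]\<close>)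

lemma is_weak_gradient_L2: "is_weak_gradient \<Omega> u g \<Longrightarrow> g \<in> L2 \<Omega>"
  unfolding is_weak_gradient_def by (rule conjunct1)

lemma is_weak_gradientD:
  "is_weak_gradient \<Omega> u g \<Longrightarrow> \<phi> \<in> test_functions \<Omega> \<Longrightarrow> i \<in> Basis \<Longrightarrow>
    (LINT x|lebesgue_on \<Omega>. u x * partial \<phi> i x) = - (LINT x|lebesgue_on \<Omega>. (g x \<bullet> i) * \<phi> x)"
  unfolding is_weak_gradient_def by blast

locale bounded_open_set =
  fixes \<Omega> :: "'a::euclidean_space set"
  assumes open_domain: "open \<Omega>" and bounded_domain: "bounded \<Omega>"
begin

lemma domain_sets [simp]: "\<Omega> \<in> sets lebesgue"
  using open_domain by auto

lemma integrable_one: "integrable (lebesgue_on \<Omega>) (\<lambda>x. 1::real)"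
  using lmeasurable_iff_integrable[THEN iffD1, OF bounded_set_imp_lmeasurable[OF bounded_domain domain_sets]]
  by (simp add: integrable_restrict_space)

lemma L2_imp_integrable:
  fixes g :: "'a \<Rightarrow> real"
  assumes "g \<in> L2 \<Omega>"
  shows "integrable (lebesgue_on \<Omega>) g"
proof (rule Bochner_Integration.integrable_bound[where f="\<lambda>x. 1 + (norm (g x))\<^sup>2"])
  show "integrable (lebesgue_on \<Omega>) (\<lambda>x. 1 + (norm (g x))\<^sup>2)"
    by (intro Bochner_Integration.integrable_add integrable_one L2_integrable_sq assms)
  show "AE x in lebesgue_on \<Omega>. norm (g x) \<le> norm (1 + (norm (g x))\<^sup>2)"
  proof (intro AE_I2)
    fix x
    have "0 \<le> (\<bar>g x\<bar> - 1)\<^sup>2" by simp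
    then have "2 * \<bar>g x\<bar> \<le> 1 + (g x)\<^sup>2"
      by (simp add: power2_diff)
    then show "norm (g x) \<le> norm (1 + (norm (g x))\<^sup>2)"
      by simp
  qed
qed (use assms in \<open>auto simp: L2_def\<close>)

lemma test_function_L2:
  assumes "\<phi> \<in> test_functions \<Omega>"
  shows "\<phi> \<in> L2 \<Omega>" "partial \<phi> e \<in> L2 \<Omega>"
proof -
  note C = test_function_C1_compact[OF assms]
  have L2I: "H \<in> L2 \<Omega>" if H: "continuous_on UNIV H" "\<And>x. x \<notin> \<Omega> \<Longrightarrow> H x = 0"
    "integrable lborel (\<lambda>x. H x * H x)" for H :: "'a \<Rightarrow> real"
  proof -
    have "(\<lambda>x. H x * H x) \<in> borel_measurable borel"
      using H(1) by (intro borel_measurable_continuous_onI continuous_intros)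
    then have "integrable (lebesgue_on \<Omega>) (\<lambda>x. H x * H x)"
      using integrable_lebesgue_on_iff_lborel[OF open_domain] H(2,3) by simp
    moreover have "H \<in> borel_measurable (lebesgue_on \<Omega>)"
      using borel_measurable_continuous_onI[OF H(1)]
      by (intro measurable_restrict_space1 measurable_completion) simp
    ultimately show ?thesis
      by (simp add: L2_def power2_eq_square)
  qed
  show "\<phi> \<in> L2 \<Omega>"
    by (rule L2I[OF C1_compact_continuous[OF C] test_function_outside(1)[OF assms]
          C1_compact_mult_integrable(1)[OF C C1_compact_continuous[OF C]]])
  show "partial \<phi> e \<in> L2 \<Omega>"
    by (rule L2I[OF partial_continuous[OF C] test_function_outside(2)[OF assms]
          C1_compact_mult_integrable(2)[OF C partial_continuous[OF C]]])
qed

lemma classical_gradient_L2: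
  "\<phi> \<in> test_functions \<Omega> \<Longrightarrow> classical_gradient \<phi> \<in> L2 \<Omega>"
  by (rule L2_componentI) (simp add: classical_gradient_inner test_function_L2)

lemma is_weak_gradient_classical:
  assumes \<phi>: "\<phi> \<in> test_functions \<Omega>"
  shows "is_weak_gradient \<Omega> \<phi> (classical_gradient \<phi>)"
  unfolding is_weak_gradient_def
proof (intro conjI ballI classical_gradient_L2 \<phi>)
  fix \<psi> i assume \<psi>: "\<psi> \<in> test_functions \<Omega>" and i: "i \<in> (Basis :: 'a set)"
  note C = test_function_C1_compact[OF \<phi>] test_function_C1_compact[OF \<psi>]
  have "(LINT x|lebesgue_on \<Omega>. \<phi> x * partial \<psi> i x) = (LINT x|lborel. \<phi> x * partial \<psi> i x)"
    using test_function_outside[OF \<phi>]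
    by (intro integral_lebesgue_on_eq_lborel[OF open_domain C1_compact_products_measurable(1)[OF C]]) simp
  also have "\<dots> = - (LINT x|lborel. partial \<phi> i x * \<psi> x)"
    by (rule integration_by_parts[OF C])
  also have "(LINT x|lborel. partial \<phi> i x * \<psi> x) = (LINT x|lebesgue_on \<Omega>. partial \<phi> i x * \<psi> x)"
    using test_function_outside[OF \<phi>]
    by (intro integral_lebesgue_on_eq_lborel[OF open_domain C1_compact_products_measurable(2)[OF C], symmetric]) simp
  finally show "(LINT x|lebesgue_on \<Omega>. \<phi> x * partial \<psi> i x)
      = - (LINT x|lebesgue_on \<Omega>. (classical_gradient \<phi> x \<bullet> i) * \<psi> x)"
    by (simp add: classical_gradient_inner i)
qed

lemma weak_gradient_unique:
  assumes g: "is_weak_gradient \<Omega> u g" and h: "is_weak_gradient \<Omega> u h"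
  shows "AE x in lebesgue_on \<Omega>. g x = h x"
proof -
  have L: "g \<in> L2 \<Omega>" "h \<in> L2 \<Omega>"
    by (rule is_weak_gradient_L2[OF g], rule is_weak_gradient_L2[OF h])
  have "AE x in lebesgue_on \<Omega>. (g x - h x) \<bullet> i = 0" if i: "i \<in> Basis" for i
  proof (rule fundamental_lemma_calculus_of_variations[OF open_domain])
    show "integrable (lebesgue_on \<Omega>) (\<lambda>x. (g x - h x) \<bullet> i)"
      by (intro L2_imp_integrable L2_component L2_diff L)
    fix \<phi> assume \<phi>: "\<phi> \<in> test_functions \<Omega>"
    have "(LINT x|lebesgue_on \<Omega>. (g x - h x) \<bullet> i * \<phi> x)
        = (LINT x|lebesgue_on \<Omega>. (g x \<bullet> i) * \<phi> x) - (LINT x|lebesgue_on \<Omega>. (h x \<bullet> i) * \<phi> x)"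
      unfolding inner_diff_left left_diff_distrib
      by (intro Bochner_Integration.integral_diff L2_integrable_mult L2_component L test_function_L2 \<phi>)
    also have "\<dots> = 0"
      using is_weak_gradientD[OF g \<phi> i] is_weak_gradientD[OF h \<phi> i] by linarith
    finally show "(LINT x|lebesgue_on \<Omega>. (g x - h x) \<bullet> i * \<phi> x) = 0" .
  qed
  then have "AE x in lebesgue_on \<Omega>. \<forall>i\<in>Basis. (g x - h x) \<bullet> i = 0"
    by (simp add: AE_finite_all)
  then show ?thesis
    by eventually_elim (metis euclidean_all_zero_iff eq_iff_diff_eq_0)
qed

lemma is_weak_gradient_add:
  assumes u: "u \<in> L2 \<Omega>" "is_weak_gradient \<Omega> u g" and v: "v \<in> L2 \<Omega>" "is_weak_gradient \<Omega> v h"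
  shows "is_weak_gradient \<Omega> (\<lambda>x. u x + v x) (\<lambda>x. g x + h x)"
  unfolding is_weak_gradient_def
proof (intro conjI ballI)
  have L: "g \<in> L2 \<Omega>" "h \<in> L2 \<Omega>"
    by (rule is_weak_gradient_L2[OF u(2)], rule is_weak_gradient_L2[OF v(2)])
  then show "(\<lambda>x. g x + h x) \<in> L2 \<Omega>" by (rule L2_add)
  fix \<phi> i assume \<phi>: "\<phi> \<in> test_functions \<Omega>" and i: "i \<in> (Basis :: 'a set)"
  have "(LINT x|lebesgue_on \<Omega>. (u x + v x) * partial \<phi> i x)
      = (LINT x|lebesgue_on \<Omega>. u x * partial \<phi> i x) + (LINT x|lebesgue_on \<Omega>. v x * partial \<phi> i x)"
    unfolding distrib_right
    by (intro Bochner_Integration.integral_add L2_integrable_mult u v test_function_L2 \<phi>)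
  also have "\<dots> = - ((LINT x|lebesgue_on \<Omega>. (g x \<bullet> i) * \<phi> x) + (LINT x|lebesgue_on \<Omega>. (h x \<bullet> i) * \<phi> x))"
    using is_weak_gradientD[OF u(2) \<phi> i] is_weak_gradientD[OF v(2) \<phi> i] by linarith
  also have "(LINT x|lebesgue_on \<Omega>. (g x \<bullet> i) * \<phi> x) + (LINT x|lebesgue_on \<Omega>. (h x \<bullet> i) * \<phi> x)
      = (LINT x|lebesgue_on \<Omega>. ((g x + h x) \<bullet> i) * \<phi> x)"
    unfolding distrib_right inner_add_left
    by (intro Bochner_Integration.integral_add[symmetric] L2_integrable_mult L2_component L test_function_L2 \<phi>)
  finally show "(LINT x|lebesgue_on \<Omega>. (u x + v x) * partial \<phi> i x)
      = - (LINT x|lebesgue_on \<Omega>. ((g x + h x) \<bullet> i) * \<phi> x)" .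
qed

lemma is_weak_gradient_scaleR:
  assumes "is_weak_gradient \<Omega> u g"
  shows "is_weak_gradient \<Omega> (\<lambda>x. c * u x) (\<lambda>x. c *\<^sub>R g x)"
  unfolding is_weak_gradient_def
proof (intro conjI ballI)
  show "(\<lambda>x. c *\<^sub>R g x) \<in> L2 \<Omega>"
    by (rule L2_scaleR[OF is_weak_gradient_L2[OF assms]])
  fix \<phi> i assume "\<phi> \<in> test_functions \<Omega>" "i \<in> (Basis :: 'a set)"
  from is_weak_gradientD[OF assms this]
  show "(LINT x|lebesgue_on \<Omega>. c * u x * partial \<phi> i x)
      = - (LINT x|lebesgue_on \<Omega>. (c *\<^sub>R g x) \<bullet> i * \<phi> x)"
    by (simp add: mult.assoc)
qed

lemma is_weak_gradient_cong_AE: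
  assumes "is_weak_gradient \<Omega> u g" "u \<in> L2 \<Omega>" and ae: "AE x in lebesgue_on \<Omega>. u x = v x"
  shows "is_weak_gradient \<Omega> v g"
proof -
  have v: "v \<in> L2 \<Omega>"
    by (rule L2_cong_AE[OF assms(2) domain_sets ae])
  have "(LINT x|lebesgue_on \<Omega>. v x * partial \<phi> i x) = (LINT x|lebesgue_on \<Omega>. u x * partial \<phi> i x)"
    if \<phi>: "\<phi> \<in> test_functions \<Omega>" for \<phi> i
  proof (rule integral_cong_AE)
    show "AE x in lebesgue_on \<Omega>. v x * partial \<phi> i x = u x * partial \<phi> i x"
      using ae by eventually_elim simp
  qed (intro borel_measurable_times L2_measurable assms(2) v test_function_L2[OF \<phi>])+
  then show ?thesis
    unfolding is_weak_gradient_def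
    by (intro conjI ballI is_weak_gradient_L2[OF assms(1)])
      (simp add: is_weak_gradientD[OF assms(1)])
qed

section \<open>The spaces \<open>H\<^sup>1\<close> and \<open>H\<^sub>0\<^sup>1\<close>\<close>

lemma H1_L2: "u \<in> H1 \<Omega> \<Longrightarrow> u \<in> L2 \<Omega>"
  by (simp add: H1_def)

lemma is_weak_gradient_weak_gradient:
  assumes "u \<in> H1 \<Omega>"
  shows "is_weak_gradient \<Omega> u (weak_gradient \<Omega> u)"
proof -
  have "\<exists>g. is_weak_gradient \<Omega> u g"
    using assms by (simp add: H1_def)
  then show ?thesis
    unfolding weak_gradient_def by (rule someI_ex)
qed

lemma weak_gradient_L2: "u \<in> H1 \<Omega> \<Longrightarrow> weak_gradient \<Omega> u \<in> L2 \<Omega>"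
  by (rule is_weak_gradient_L2[OF is_weak_gradient_weak_gradient])

lemma H1I: "u \<in> L2 \<Omega> \<Longrightarrow> is_weak_gradient \<Omega> u g \<Longrightarrow> u \<in> H1 \<Omega>"
  by (auto simp: H1_def)

lemma weak_gradient_AE:
  "u \<in> L2 \<Omega> \<Longrightarrow> is_weak_gradient \<Omega> u g \<Longrightarrow> AE x in lebesgue_on \<Omega>. weak_gradient \<Omega> u x = g x"
  by (rule weak_gradient_unique[OF is_weak_gradient_weak_gradient[OF H1I]])

lemma test_function_H1: "\<phi> \<in> test_functions \<Omega> \<Longrightarrow> \<phi> \<in> H1 \<Omega>"
  by (rule H1I[OF test_function_L2(1) is_weak_gradient_classical])

lemma
  assumes "u \<in> H1 \<Omega>" "v \<in> H1 \<Omega>"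
  shows H1_add: "(\<lambda>x. u x + v x) \<in> H1 \<Omega>"
    and weak_gradient_add: "AE x in lebesgue_on \<Omega>.
      weak_gradient \<Omega> (\<lambda>x. u x + v x) x = weak_gradient \<Omega> u x + weak_gradient \<Omega> v x"
proof -
  note L = L2_add[OF H1_L2[OF assms(1)] H1_L2[OF assms(2)]]
  note g = is_weak_gradient_add[OF H1_L2[OF assms(1)] is_weak_gradient_weak_gradient[OF assms(1)]
      H1_L2[OF assms(2)] is_weak_gradient_weak_gradient[OF assms(2)]]
  show "(\<lambda>x. u x + v x) \<in> H1 \<Omega>"
    by (rule H1I[OF L g])
  show "AE x in lebesgue_on \<Omega>.
      weak_gradient \<Omega> (\<lambda>x. u x + v x) x = weak_gradient \<Omega> u x + weak_gradient \<Omega> v x"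
    by (rule weak_gradient_AE[OF L g])
qed

lemma
  assumes "u \<in> H1 \<Omega>"
  shows H1_scaleR: "(\<lambda>x. c * u x) \<in> H1 \<Omega>"
    and weak_gradient_scaleR: "AE x in lebesgue_on \<Omega>.
      weak_gradient \<Omega> (\<lambda>x. c * u x) x = c *\<^sub>R weak_gradient \<Omega> u x"
proof -
  have L: "(\<lambda>x. c * u x) \<in> L2 \<Omega>"
    using L2_scaleR[OF H1_L2[OF assms], of c] by simp
  note g = is_weak_gradient_scaleR[OF is_weak_gradient_weak_gradient[OF assms], of c]
  show "(\<lambda>x. c * u x) \<in> H1 \<Omega>"
    by (rule H1I[OF L g])
  show "AE x in lebesgue_on \<Omega>. weak_gradient \<Omega> (\<lambda>x. c * u x) x = c *\<^sub>R weak_gradient \<Omega> u x"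
    by (rule weak_gradient_AE[OF L g])
qed

lemma
  assumes "u \<in> H1 \<Omega>" and ae: "AE x in lebesgue_on \<Omega>. u x = v x"
  shows H1_cong_AE: "v \<in> H1 \<Omega>"
    and weak_gradient_cong_AE: "AE x in lebesgue_on \<Omega>. weak_gradient \<Omega> u x = weak_gradient \<Omega> v x"
proof -
  note v = L2_cong_AE[OF H1_L2[OF assms(1)] domain_sets ae]
  note g = is_weak_gradient_cong_AE[OF is_weak_gradient_weak_gradient[OF assms(1)] H1_L2[OF assms(1)] ae]
  show "v \<in> H1 \<Omega>" by (rule H1I[OF v g])
  show "AE x in lebesgue_on \<Omega>. weak_gradient \<Omega> u x = weak_gradient \<Omega> v x"
    using weak_gradient_AE[OF v g] by eventually_elim simp
qed

lemma
  assumes "u \<in> H1 \<Omega>" "v \<in> H1 \<Omega>"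
  shows H1_diff: "(\<lambda>x. u x - v x) \<in> H1 \<Omega>"
    and weak_gradient_diff: "AE x in lebesgue_on \<Omega>.
      weak_gradient \<Omega> (\<lambda>x. u x - v x) x = weak_gradient \<Omega> u x - weak_gradient \<Omega> v x"
proof -
  have n: "(\<lambda>x. - 1 * v x) \<in> H1 \<Omega>" by (rule H1_scaleR[OF assms(2)])
  show "(\<lambda>x. u x - v x) \<in> H1 \<Omega>"
    using H1_add[OF assms(1) n] by simp
  show "AE x in lebesgue_on \<Omega>. weak_gradient \<Omega> (\<lambda>x. u x - v x) x
      = weak_gradient \<Omega> u x - weak_gradient \<Omega> v x"
    using weak_gradient_add[OF assms(1) n] weak_gradient_scaleR[OF assms(2), of "- 1"]
    by eventually_elim simp
qed

lemma l2_norm_weak_gradient_diff_classical: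
  assumes "u \<in> H1 \<Omega>" "\<phi> \<in> test_functions \<Omega>"
  shows "l2_norm \<Omega> (weak_gradient \<Omega> (\<lambda>x. u x - \<phi> x))
    = l2_norm \<Omega> (\<lambda>x. weak_gradient \<Omega> u x - classical_gradient \<phi> x)"
proof (rule l2_norm_cong_AE)
  note \<phi> = test_function_H1[OF assms(2)]
  show "AE x in lebesgue_on \<Omega>. weak_gradient \<Omega> (\<lambda>x. u x - \<phi> x) x
      = weak_gradient \<Omega> u x - classical_gradient \<phi> x"
    using weak_gradient_diff[OF assms(1) \<phi>]
      weak_gradient_AE[OF H1_L2[OF \<phi>] is_weak_gradient_classical[OF assms(2)]]
    by eventually_elim simp
  show "weak_gradient \<Omega> (\<lambda>x. u x - \<phi> x) \<in> borel_measurable (lebesgue_on \<Omega>)"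
    by (intro L2_measurable weak_gradient_L2 H1_diff assms \<phi>)
  show "(\<lambda>x. weak_gradient \<Omega> u x - classical_gradient \<phi> x) \<in> borel_measurable (lebesgue_on \<Omega>)"
    by (intro L2_measurable L2_diff weak_gradient_L2 classical_gradient_L2 assms)
qed

text \<open>
  Convergence in the \<open>H\<^sup>1\<close> norm means convergence of values and gradients in \<open>L\<^sup>2\<close>, and weak gradients of
  test functions are classical ones. Here the arbitrary choice of weak gradients of the differences
  \<open>u - \<phi>\<^sub>k\<close> is eliminated.
\<close>

lemma H10_iff:
  "u \<in> H10 \<Omega> \<longleftrightarrow> u \<in> H1 \<Omega> \<and> (\<exists>\<phi>. (\<forall>k. \<phi> k \<in> test_functions \<Omega>) \<and>
     (\<lambda>k. l2_norm \<Omega> (\<lambda>x. u x - \<phi> k x)) \<longlonglongrightarrow> 0 \<and>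
     (\<lambda>k. l2_norm \<Omega> (\<lambda>x. weak_gradient \<Omega> u x - classical_gradient (\<phi> k) x)) \<longlonglongrightarrow> 0)"
proof -
  have "(\<lambda>k. h1_norm \<Omega> (\<lambda>x. u x - \<phi> k x)) \<longlonglongrightarrow> 0 \<longleftrightarrow>
     (\<lambda>k. l2_norm \<Omega> (\<lambda>x. u x - \<phi> k x)) \<longlonglongrightarrow> 0 \<and>
     (\<lambda>k. l2_norm \<Omega> (\<lambda>x. weak_gradient \<Omega> u x - classical_gradient (\<phi> k) x)) \<longlonglongrightarrow> 0"
    if u: "u \<in> H1 \<Omega>" and \<phi>: "\<forall>k. \<phi> k \<in> test_functions \<Omega>" for \<phi>
  proof -
    let ?a = "\<lambda>k. l2_norm \<Omega> (\<lambda>x. u x - \<phi> k x)"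
    let ?b = "\<lambda>k. l2_norm \<Omega> (\<lambda>x. weak_gradient \<Omega> u x - classical_gradient (\<phi> k) x)"
    have h: "h1_norm \<Omega> (\<lambda>x. u x - \<phi> k x) = sqrt ((?a k)\<^sup>2 + (?b k)\<^sup>2)" for k
      using \<phi> by (simp add: h1_norm_def l2_norm_weak_gradient_diff_classical u)
    show ?thesis
      unfolding h
    proof
      assume lim: "(\<lambda>k. sqrt ((?a k)\<^sup>2 + (?b k)\<^sup>2)) \<longlonglongrightarrow> 0"
      have le: "norm (?a k) \<le> sqrt ((?a k)\<^sup>2 + (?b k)\<^sup>2)" "norm (?b k) \<le> sqrt ((?a k)\<^sup>2 + (?b k)\<^sup>2)" for k
        by (simp_all add: real_le_rsqrt)
      show "?a \<longlonglongrightarrow> 0 \<and> ?b \<longlonglongrightarrow> 0"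
        by (intro conjI Lim_null_comparison[OF eventuallyI[OF le(1)] lim]
            Lim_null_comparison[OF eventuallyI[OF le(2)] lim])
    next
      assume "?a \<longlonglongrightarrow> 0 \<and> ?b \<longlonglongrightarrow> 0"
      then have "(\<lambda>k. sqrt ((?a k)\<^sup>2 + (?b k)\<^sup>2)) \<longlonglongrightarrow> sqrt (0\<^sup>2 + 0\<^sup>2)"
        by (intro tendsto_intros) auto
      then show "(\<lambda>k. sqrt ((?a k)\<^sup>2 + (?b k)\<^sup>2)) \<longlonglongrightarrow> 0" by simp
    qed
  qed
  then show ?thesis
    unfolding H10_def by blast
qed

lemma H10_H1: "u \<in> H10 \<Omega> \<Longrightarrow> u \<in> H1 \<Omega>"
  by (simp add: H10_def)

lemma H10I:
  "u \<in> H1 \<Omega> \<Longrightarrow> (\<And>k. \<phi> k \<in> test_functions \<Omega>) \<Longrightarrow>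
    (\<lambda>k. h1_norm \<Omega> (\<lambda>x. u x - \<phi> k x)) \<longlonglongrightarrow> 0 \<Longrightarrow> u \<in> H10 \<Omega>"
  unfolding H10_def by blast

lemma H10_add:
  assumes u: "u \<in> H10 \<Omega>" and v: "v \<in> H10 \<Omega>"
  shows "(\<lambda>x. u x + v x) \<in> H10 \<Omega>"
proof -
  obtain \<phi> where \<phi>: "\<And>k. \<phi> k \<in> test_functions \<Omega>" "(\<lambda>k. h1_norm \<Omega> (\<lambda>x. u x - \<phi> k x)) \<longlonglongrightarrow> 0"
    using u by (auto simp: H10_def)
  obtain \<psi> where \<psi>: "\<And>k. \<psi> k \<in> test_functions \<Omega>" "(\<lambda>k. h1_norm \<Omega> (\<lambda>x. v x - \<psi> k x)) \<longlonglongrightarrow> 0"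
    using v by (auto simp: H10_def)
  note H = H10_H1[OF u] H10_H1[OF v]
  \<comment> \<open>a quasi-triangle inequality is enough for convergence to zero\<close>
  have "h1_norm \<Omega> (\<lambda>x. f x + g x) \<le> 2 * (h1_norm \<Omega> f + h1_norm \<Omega> g)"
    if fg: "f \<in> H1 \<Omega>" "g \<in> H1 \<Omega>" for f g
  proof -
    have le: "l2_norm \<Omega> w \<le> h1_norm \<Omega> w" "l2_norm \<Omega> (weak_gradient \<Omega> w) \<le> h1_norm \<Omega> w" for w
      by (simp_all add: h1_norm_def real_le_rsqrt)
    have "l2_norm \<Omega> (weak_gradient \<Omega> (\<lambda>x. f x + g x))
        = l2_norm \<Omega> (\<lambda>x. weak_gradient \<Omega> f x + weak_gradient \<Omega> g x)"
      using fg by (intro l2_norm_cong_AE weak_gradient_add L2_measurable weak_gradient_L2 H1_add L2_add)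
    then have "h1_norm \<Omega> (\<lambda>x. f x + g x)
        \<le> l2_norm \<Omega> (\<lambda>x. f x + g x) + l2_norm \<Omega> (\<lambda>x. weak_gradient \<Omega> f x + weak_gradient \<Omega> g x)"
      by (simp add: h1_norm_def sqrt_sum_squares_le_sum)
    also have "\<dots> \<le> (l2_norm \<Omega> f + l2_norm \<Omega> g)
        + (l2_norm \<Omega> (weak_gradient \<Omega> f) + l2_norm \<Omega> (weak_gradient \<Omega> g))"
      using fg by (intro add_mono l2_norm_triangle H1_L2 weak_gradient_L2)
    also have "\<dots> \<le> 2 * (h1_norm \<Omega> f + h1_norm \<Omega> g)"
      using le[of f] le[of g] by simp
    finally show ?thesis .
  qed
  note tri = this
  have "norm (h1_norm \<Omega> (\<lambda>x. (u x + v x) - (\<phi> k x + \<psi> k x)))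
      \<le> 2 * (h1_norm \<Omega> (\<lambda>x. u x - \<phi> k x) + h1_norm \<Omega> (\<lambda>x. v x - \<psi> k x))" for k
    using tri[OF H1_diff[OF H(1) test_function_H1[OF \<phi>(1)]] H1_diff[OF H(2) test_function_H1[OF \<psi>(1)]], of k k]
    by (simp add: h1_norm_def algebra_simps)
  moreover have "(\<lambda>k. 2 * (h1_norm \<Omega> (\<lambda>x. u x - \<phi> k x) + h1_norm \<Omega> (\<lambda>x. v x - \<psi> k x))) \<longlonglongrightarrow> 0"
    using tendsto_mult[OF tendsto_const[of 2] tendsto_add[OF \<phi>(2) \<psi>(2)]] by simp
  ultimately have "(\<lambda>k. h1_norm \<Omega> (\<lambda>x. (u x + v x) - (\<phi> k x + \<psi> k x))) \<longlonglongrightarrow> 0"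
    by (metis (mono_tags, lifting) Lim_null_comparison eventuallyI)
  then show ?thesis
    by (rule H10I[where \<phi>="\<lambda>k x. \<phi> k x + \<psi> k x", OF H1_add[OF H] test_functions_add[OF \<phi>(1) \<psi>(1)]])
qed

lemma H10_scaleR:
  assumes u: "u \<in> H10 \<Omega>"
  shows "(\<lambda>x. c * u x) \<in> H10 \<Omega>"
proof -
  obtain \<phi> where \<phi>: "\<And>k. \<phi> k \<in> test_functions \<Omega>" "(\<lambda>k. h1_norm \<Omega> (\<lambda>x. u x - \<phi> k x)) \<longlonglongrightarrow> 0"
    using u by (auto simp: H10_def)
  note H = H10_H1[OF u]
  have "h1_norm \<Omega> (\<lambda>x. c * u x - c * \<phi> k x) = \<bar>c\<bar> * h1_norm \<Omega> (\<lambda>x. u x - \<phi> k x)" for k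
  proof -
    let ?w = "\<lambda>x. u x - \<phi> k x"
    have w: "?w \<in> H1 \<Omega>" by (rule H1_diff[OF H test_function_H1[OF \<phi>(1)]])
    have "l2_norm \<Omega> (weak_gradient \<Omega> (\<lambda>x. c * ?w x)) = l2_norm \<Omega> (\<lambda>x. c *\<^sub>R weak_gradient \<Omega> ?w x)"
      by (intro l2_norm_cong_AE weak_gradient_scaleR L2_measurable weak_gradient_L2 H1_scaleR L2_scaleR w)
    then have "h1_norm \<Omega> (\<lambda>x. c * ?w x) = \<bar>c\<bar> * h1_norm \<Omega> ?w"
      using l2_norm_scaleR[of \<Omega> c ?w] l2_norm_scaleR[of \<Omega> c "weak_gradient \<Omega> ?w"]
      by (simp add: h1_norm_def power_mult_distrib real_sqrt_mult flip: distrib_left)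
    then show ?thesis
      by (simp add: right_diff_distrib)
  qed
  then have "(\<lambda>k. h1_norm \<Omega> (\<lambda>x. c * u x - c * \<phi> k x)) \<longlonglongrightarrow> 0"
    using tendsto_mult[OF tendsto_const[of "\<bar>c\<bar>"] \<phi>(2)] by simp
  then show ?thesis
    by (rule H10I[where \<phi>="\<lambda>k x. c * \<phi> k x", OF H1_scaleR[OF H] test_functions_scaleR[OF \<phi>(1)]])
qed

lemma H10_cong_AE:
  assumes u: "u \<in> H10 \<Omega>" and ae: "AE x in lebesgue_on \<Omega>. u x = v x"
  shows "v \<in> H10 \<Omega>"
proof -
  obtain \<phi> where \<phi>: "\<And>k. \<phi> k \<in> test_functions \<Omega>" "(\<lambda>k. l2_norm \<Omega> (\<lambda>x. u x - \<phi> k x)) \<longlonglongrightarrow> 0"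
    "(\<lambda>k. l2_norm \<Omega> (\<lambda>x. weak_gradient \<Omega> u x - classical_gradient (\<phi> k) x)) \<longlonglongrightarrow> 0"
    using u unfolding H10_iff by blast
  note H = H10_H1[OF u]
  note v = H1_cong_AE[OF H ae]
  have "l2_norm \<Omega> (\<lambda>x. v x - \<phi> k x) = l2_norm \<Omega> (\<lambda>x. u x - \<phi> k x)" for k
  proof (rule l2_norm_cong_AE)
    show "AE x in lebesgue_on \<Omega>. v x - \<phi> k x = u x - \<phi> k x"
      using ae by eventually_elim simp
  qed (intro L2_measurable L2_diff H1_L2 v H test_function_L2 \<phi>)+
  moreover have "l2_norm \<Omega> (\<lambda>x. weak_gradient \<Omega> v x - classical_gradient (\<phi> k) x)
      = l2_norm \<Omega> (\<lambda>x. weak_gradient \<Omega> u x - classical_gradient (\<phi> k) x)" for k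
  proof (rule l2_norm_cong_AE)
    show "AE x in lebesgue_on \<Omega>. weak_gradient \<Omega> v x - classical_gradient (\<phi> k) x
        = weak_gradient \<Omega> u x - classical_gradient (\<phi> k) x"
      using weak_gradient_cong_AE[OF H ae] by eventually_elim simp
  qed (intro L2_measurable L2_diff weak_gradient_L2 v H classical_gradient_L2 \<phi>)+
  ultimately have "(\<lambda>k. l2_norm \<Omega> (\<lambda>x. v x - \<phi> k x)) \<longlonglongrightarrow> 0"
    "(\<lambda>k. l2_norm \<Omega> (\<lambda>x. weak_gradient \<Omega> v x - classical_gradient (\<phi> k) x)) \<longlonglongrightarrow> 0"
    using \<phi>(2,3) by simp_all
  then show ?thesis
    unfolding H10_iff using v \<phi>(1) by blast
qed

text \<open>
  Both sides are continuous in the \<open>H\<^sup>1\<close> norm, so the identity extends from test functions by density.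
\<close>

lemma H10_partial_partial_commute:
  assumes u: "u \<in> H10 \<Omega>" and v: "v \<in> H10 \<Omega>" and ij: "i \<in> Basis" "j \<in> Basis"
  shows "(LINT x|lebesgue_on \<Omega>. (weak_gradient \<Omega> u x \<bullet> i) * (weak_gradient \<Omega> v x \<bullet> j))
    = (LINT x|lebesgue_on \<Omega>. (weak_gradient \<Omega> u x \<bullet> j) * (weak_gradient \<Omega> v x \<bullet> i))"
proof -
  obtain \<phi> where \<phi>: "\<And>k. \<phi> k \<in> test_functions \<Omega>"
    "(\<lambda>k. l2_norm \<Omega> (\<lambda>x. weak_gradient \<Omega> u x - classical_gradient (\<phi> k) x)) \<longlonglongrightarrow> 0"
    using u unfolding H10_iff by blast
  obtain \<psi> where \<psi>: "\<And>k. \<psi> k \<in> test_functions \<Omega>"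
    "(\<lambda>k. l2_norm \<Omega> (\<lambda>x. weak_gradient \<Omega> v x - classical_gradient (\<psi> k) x)) \<longlonglongrightarrow> 0"
    using v unfolding H10_iff by blast
  have comp: "(\<lambda>k. l2_norm \<Omega> (\<lambda>x. weak_gradient \<Omega> w x \<bullet> e - classical_gradient (\<eta> k) x \<bullet> e)) \<longlonglongrightarrow> 0"
    if e: "e \<in> Basis" and w: "w \<in> H10 \<Omega>" and \<eta>: "\<And>k. \<eta> k \<in> test_functions \<Omega>"
      "(\<lambda>k. l2_norm \<Omega> (\<lambda>x. weak_gradient \<Omega> w x - classical_gradient (\<eta> k) x)) \<longlonglongrightarrow> 0" for e w \<eta>
  proof (rule Lim_null_comparison[OF eventuallyI \<eta>(2)])
    fix k
    let ?d = "\<lambda>x. weak_gradient \<Omega> w x - classical_gradient (\<eta> k) x"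
    have d: "?d \<in> L2 \<Omega>"
      by (intro L2_diff weak_gradient_L2 H10_H1 w classical_gradient_L2 \<eta>)
    have "(norm (?d x \<bullet> e))\<^sup>2 \<le> (norm (?d x))\<^sup>2" for x
      using Basis_le_norm[OF e] by (intro power_mono) auto
    then have "l2_norm \<Omega> (\<lambda>x. ?d x \<bullet> e) \<le> l2_norm \<Omega> ?d"
      unfolding l2_norm_def
      by (intro real_sqrt_le_mono integral_mono L2_integrable_sq L2_component d)
    then show "norm (l2_norm \<Omega> (\<lambda>x. weak_gradient \<Omega> w x \<bullet> e - classical_gradient (\<eta> k) x \<bullet> e))
        \<le> l2_norm \<Omega> ?d"
      by (simp add: inner_diff_left)
  qed
  have lim: "(\<lambda>k. l2_inner \<Omega> (\<lambda>x. classical_gradient (\<phi> k) x \<bullet> a) (\<lambda>x. classical_gradient (\<psi> k) x \<bullet> b))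
     \<longlonglongrightarrow> l2_inner \<Omega> (\<lambda>x. weak_gradient \<Omega> u x \<bullet> a) (\<lambda>x. weak_gradient \<Omega> v x \<bullet> b)"
    if "a \<in> Basis" "b \<in> Basis" for a b
    using that
    by (intro l2_inner_tendsto comp u v \<phi> \<psi> L2_component weak_gradient_L2 H10_H1 classical_gradient_L2)
  have eq: "l2_inner \<Omega> (\<lambda>x. classical_gradient (\<phi> k) x \<bullet> i) (\<lambda>x. classical_gradient (\<psi> k) x \<bullet> j)
      = l2_inner \<Omega> (\<lambda>x. classical_gradient (\<phi> k) x \<bullet> j) (\<lambda>x. classical_gradient (\<psi> k) x \<bullet> i)" for k
  proof -
    note C = test_function_C1_compact[OF \<phi>(1)[of k]] test_function_C1_compact[OF \<psi>(1)[of k]]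
    have L: "l2_inner \<Omega> (\<lambda>x. classical_gradient (\<phi> k) x \<bullet> a) (\<lambda>x. classical_gradient (\<psi> k) x \<bullet> b)
        = (LINT x|lborel. partial (\<phi> k) a x * partial (\<psi> k) b x)" if "a \<in> Basis" "b \<in> Basis" for a b
      unfolding l2_inner_def inner_real_def classical_gradient_inner[OF that(1)] classical_gradient_inner[OF that(2)]
      using test_function_outside[OF \<phi>(1)]
      by (intro integral_lebesgue_on_eq_lborel[OF open_domain C1_compact_products_measurable(3)[OF C]]) simp
    show ?thesis
      using integral_partial_partial_commute[OF C] ij by (simp add: L)
  qed
  have "l2_inner \<Omega> (\<lambda>x. weak_gradient \<Omega> u x \<bullet> i) (\<lambda>x. weak_gradient \<Omega> v x \<bullet> j)
      = l2_inner \<Omega> (\<lambda>x. weak_gradient \<Omega> u x \<bullet> j) (\<lambda>x. weak_gradient \<Omega> v x \<bullet> i)"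
    using LIMSEQ_unique[OF lim[OF ij] lim[OF ij(2,1), folded eq]] .
  then show ?thesis
    by (simp add: l2_inner_def)
qed

end


section \<open>Sobolev inequalities in the plane and in space\<close>

lemma nn_integral_derivative_bound:
  fixes g g' :: "real \<Rightarrow> real"
  assumes deriv: "\<And>s. (g has_real_derivative g' s) (at s)" and cont: "continuous_on UNIV g'"
    and a: "a \<le> x" "g a = 0"
  shows "ennreal \<bar>g x\<bar> \<le> (\<integral>\<^sup>+s. ennreal \<bar>g' s\<bar> \<partial>lborel)"
proof -
  have int: "set_integrable lborel {a..x} g'"
    using cont by (intro borel_integrable_atLeastAtMost') (auto intro: continuous_on_subset)
  have "(LINT s|lborel. indicator {a..x} s *\<^sub>R g' s) = g x - g a"
    using a(1) cont deriv
    by (intro integral_FTC_atLeastAtMost)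
      (auto simp: has_real_derivative_iff_has_vector_derivative[symmetric]
        intro: has_field_derivative_at_within continuous_on_subset)
  then have "ennreal \<bar>g x\<bar> = ennreal (norm (LINT s|lborel. indicator {a..x} s *\<^sub>R g' s))"
    using a(2) by simp
  also have "\<dots> \<le> (\<integral>\<^sup>+s. norm (indicator {a..x} s *\<^sub>R g' s) \<partial>lborel)"
    using int unfolding set_integrable_def by (rule integral_norm_bound_ennreal)
  also have "\<dots> \<le> (\<integral>\<^sup>+s. ennreal \<bar>g' s\<bar> \<partial>lborel)"
    by (intro nn_integral_mono) (auto simp: indicator_def)
  finally show ?thesis .
qed

lemma nn_integral_power_derivative_bound:
  fixes g g' :: "real \<Rightarrow> real"
  assumes deriv: "\<And>s. (g has_real_derivative g' s) (at s)" and cont: "continuous_on UNIV g'"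
    and supp: "\<And>s. \<bar>s\<bar> > r \<Longrightarrow> g s = 0" and "m > 0"
  shows "ennreal (\<bar>g x\<bar> ^ m) \<le> (\<integral>\<^sup>+s. ennreal (real m * \<bar>g s\<bar> ^ (m - 1) * \<bar>g' s\<bar>) \<partial>lborel)"
proof -
  have g: "continuous_on UNIV g"
    using deriv by (meson DERIV_continuous continuous_at_imp_continuous_on)
  \<comment> \<open>a point to the left of \<open>x\<close> and of the support\<close>
  define a where "a = min x (- r - 1)"
  have "g a = 0" by (rule supp) (auto simp: a_def min_def)
  have "ennreal \<bar>g x ^ m\<bar> \<le> (\<integral>\<^sup>+s. ennreal \<bar>real m * g s ^ (m - 1) * g' s\<bar> \<partial>lborel)"
  proof (rule nn_integral_derivative_bound[where a=a and g="\<lambda>s. g s ^ m"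
        and g'="\<lambda>s. real m * g s ^ (m - 1) * g' s"])
    show "((\<lambda>s. g s ^ m) has_real_derivative real m * g s ^ (m - 1) * g' s) (at s)" for s
      using DERIV_power[OF deriv[of s], of m] by (simp add: mult_ac)
  qed (use g cont \<open>g a = 0\<close> \<open>m > 0\<close> in \<open>auto simp: a_def intro!: continuous_intros\<close>)
  then show ?thesis
    by (simp add: abs_mult power_abs)
qed

lemma
  fixes f :: "'a::euclidean_space \<times> 'b::euclidean_space \<Rightarrow> ennreal"
  assumes "f \<in> borel_measurable borel"
  shows nn_integral_lborel_fst: "(\<integral>\<^sup>+x. \<integral>\<^sup>+y. f (x, y) \<partial>lborel \<partial>lborel) = (\<integral>\<^sup>+p. f p \<partial>lborel)"
    and nn_integral_lborel_snd: "(\<integral>\<^sup>+y. \<integral>\<^sup>+x. f (x, y) \<partial>lborel \<partial>lborel) = (\<integral>\<^sup>+p. f p \<partial>lborel)"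
proof -
  have "f \<in> borel_measurable (lborel \<Otimes>\<^sub>M lborel)"
    using assms by (simp add: lborel_prod)
  from lborel.nn_integral_fst[OF this] lborel_pair.nn_integral_snd[OF this]
  show "(\<integral>\<^sup>+x. \<integral>\<^sup>+y. f (x, y) \<partial>lborel \<partial>lborel) = (\<integral>\<^sup>+p. f p \<partial>lborel)"
    "(\<integral>\<^sup>+y. \<integral>\<^sup>+x. f (x, y) \<partial>lborel \<partial>lborel) = (\<integral>\<^sup>+p. f p \<partial>lborel)"
    by (simp_all add: lborel_prod)
qed

lemma measurable_nn_integral_slice:
  fixes f :: "'a::euclidean_space \<times> 'b::euclidean_space \<Rightarrow> ennreal"
  assumes "f \<in> borel_measurable borel"
  shows "(\<lambda>x. \<integral>\<^sup>+y. f (x, y) \<partial>lborel) \<in> borel_measurable borel"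
    "(\<lambda>y. \<integral>\<^sup>+x. f (x, y) \<partial>lborel) \<in> borel_measurable borel"
proof -
  have f: "f \<in> borel_measurable (lborel \<Otimes>\<^sub>M lborel)"
    using assms by (simp add: lborel_prod)
  from lborel.borel_measurable_nn_integral_fst[OF this]
  show "(\<lambda>x. \<integral>\<^sup>+y. f (x, y) \<partial>lborel) \<in> borel_measurable borel" by simp
  have "(\<lambda>p. f (snd p, fst p)) \<in> borel_measurable (lborel \<Otimes>\<^sub>M lborel)"
    using measurable_compose[OF measurable_pair_swap' f] by (simp add: case_prod_unfold)
  from lborel.borel_measurable_nn_integral_fst[OF this]
  show "(\<lambda>y. \<integral>\<^sup>+x. f (x, y) \<partial>lborel) \<in> borel_measurable borel" by simp
qed

lemma ennreal_mult_le_of_squares_le: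
  fixes x y c :: ennreal
  assumes "x\<^sup>2 \<le> c" "y\<^sup>2 \<le> c"
  shows "x * y \<le> c"
proof (cases "x \<le> y")
  case True
  then have "x * y \<le> y * y" by (intro mult_right_mono) auto
  then show ?thesis using assms(2) by (simp add: power2_eq_square)
next
  case False
  then have "x * y \<le> x * x" by (intro mult_left_mono) auto
  then show ?thesis using assms(1) by (simp add: power2_eq_square)
qed

text \<open>
  Cauchy-Schwarz for the integrals that arise when a power of \<open>f\<close> is differentiated; \<open>d\<close> is the
  derivative, and \<open>g\<close> stands for the squared length of the gradient.
\<close>

lemma nn_integral_power_derivative_sq_le:
  fixes f d g :: "'a::euclidean_space \<Rightarrow> real"
  assumes [measurable]: "f \<in> borel_measurable borel" "d \<in> borel_measurable borel" "g \<in> borel_measurable borel"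
    and g: "\<And>p. (d p)\<^sup>2 \<le> g p"
  shows "(\<integral>\<^sup>+p. ennreal (real m * \<bar>f p\<bar> ^ k * \<bar>d p\<bar>) \<partial>lborel)\<^sup>2
    \<le> ennreal ((real m)\<^sup>2) * (\<integral>\<^sup>+p. ennreal (\<bar>f p\<bar> ^ (2 * k)) \<partial>lborel) * (\<integral>\<^sup>+p. ennreal (g p) \<partial>lborel)"
proof -
  have "(\<integral>\<^sup>+p. ennreal (real m * \<bar>f p\<bar> ^ k * \<bar>d p\<bar>) \<partial>lborel)\<^sup>2
      = (\<integral>\<^sup>+p. ennreal (real m * \<bar>f p\<bar> ^ k) * ennreal \<bar>d p\<bar> \<partial>lborel)\<^sup>2"
    by (simp add: ennreal_mult)
  also have "\<dots> \<le> (\<integral>\<^sup>+p. (ennreal (real m * \<bar>f p\<bar> ^ k))\<^sup>2 \<partial>lborel) * (\<integral>\<^sup>+p. (ennreal \<bar>d p\<bar>)\<^sup>2 \<partial>lborel)"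
    by (intro Cauchy_Schwarz_nn_integral) measurable
  also have "(\<integral>\<^sup>+p. (ennreal (real m * \<bar>f p\<bar> ^ k))\<^sup>2 \<partial>lborel)
      = (\<integral>\<^sup>+p. ennreal ((real m)\<^sup>2) * ennreal (\<bar>f p\<bar> ^ (2 * k)) \<partial>lborel)"
    by (intro nn_integral_cong)
      (simp add: ennreal_power power_mult_distrib power_mult mult.commute flip: ennreal_mult power_mult)
  also have "\<dots> = ennreal ((real m)\<^sup>2) * (\<integral>\<^sup>+p. ennreal (\<bar>f p\<bar> ^ (2 * k)) \<partial>lborel)"
    by (intro nn_integral_cmult) measurable
  also have "\<dots> * (\<integral>\<^sup>+p. (ennreal \<bar>d p\<bar>)\<^sup>2 \<partial>lborel) \<le> \<dots> * (\<integral>\<^sup>+p. ennreal (g p) \<partial>lborel)"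
    using g by (intro mult_left_mono nn_integral_mono) (simp_all add: ennreal_power ennreal_leI)
  finally show ?thesis .
qed

text \<open>
  Integrating the derivative of \<open>f\<^sup>3\<close> along lines bounds \<open>\<bar>f(x,y)\<bar>\<^sup>3\<close> both by a function \<open>a\<close> of \<open>y\<close> alone and by
  a function \<open>b\<close> of \<open>x\<close> alone. The integral of \<open>f\<^sup>6 \<le> a(y) b(x)\<close> therefore factors into \<open>\<integral>a \<cdot> \<integral>b\<close>, and each
  factor has the form \<open>\<integral> 3 f\<^sup>2 \<bar>\<partial>f\<bar>\<close>.
\<close>

lemma plane_L6_bound:
  fixes f fx fy g :: "real \<times> real \<Rightarrow> real"
  assumes cont: "continuous_on UNIV f" "continuous_on UNIV fx" "continuous_on UNIV fy"
    and g: "g \<in> borel_measurable borel" "\<And>p. (fx p)\<^sup>2 \<le> g p" "\<And>p. (fy p)\<^sup>2 \<le> g p"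
    and dx: "\<And>x y. ((\<lambda>x. f (x, y)) has_real_derivative fx (x, y)) (at x)"
    and dy: "\<And>x y. ((\<lambda>y. f (x, y)) has_real_derivative fy (x, y)) (at y)"
    and supp: "\<And>x y. \<bar>x\<bar> > r \<or> \<bar>y\<bar> > r \<Longrightarrow> f (x, y) = 0"
  shows "(\<integral>\<^sup>+p. ennreal (\<bar>f p\<bar> ^ 6) \<partial>lborel)
    \<le> 9 * (\<integral>\<^sup>+p. ennreal (\<bar>f p\<bar> ^ 4) \<partial>lborel) * (\<integral>\<^sup>+p. ennreal (g p) \<partial>lborel)"
proof -
  have m: "f \<in> borel_measurable borel" "fx \<in> borel_measurable borel" "fy \<in> borel_measurable borel"
    using cont by (auto intro: borel_measurable_continuous_onI)
  define A B where "A p = ennreal (real 3 * \<bar>f p\<bar> ^ 2 * \<bar>fx p\<bar>)"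
    and "B p = ennreal (real 3 * \<bar>f p\<bar> ^ 2 * \<bar>fy p\<bar>)" for p
  have AB [measurable]: "A \<in> borel_measurable borel" "B \<in> borel_measurable borel"
    unfolding A_def B_def using m by measurable
  have slices: "continuous_on UNIV (\<lambda>x. fx (x, y))" "continuous_on UNIV (\<lambda>y. fy (x, y))" for x y
    by (rule continuous_on_compose2[OF cont(2)] continuous_on_compose2[OF cont(3)];
        auto intro!: continuous_intros)+
  define a b where "a y = (\<integral>\<^sup>+x. A (x, y) \<partial>lborel)" and "b x = (\<integral>\<^sup>+y. B (x, y) \<partial>lborel)" for x y
  have le_a: "ennreal (\<bar>f (x, y)\<bar> ^ 3) \<le> a y" for x y
    using nn_integral_power_derivative_bound[OF dx slices(1), of r y 3 x] supp
    by (simp add: a_def A_def)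
  have le_b: "ennreal (\<bar>f (x, y)\<bar> ^ 3) \<le> b x" for x y
    using nn_integral_power_derivative_bound[OF dy slices(2), of r x 3 y] supp
    by (simp add: b_def B_def)
  have ab_m [measurable]: "a \<in> borel_measurable borel" "b \<in> borel_measurable borel"
    unfolding a_def b_def by (rule measurable_nn_integral_slice AB)+
  have "(\<integral>\<^sup>+p. ennreal (\<bar>f p\<bar> ^ 6) \<partial>lborel) \<le> (\<integral>\<^sup>+p. b (fst p) * a (snd p) \<partial>lborel)"
  proof (rule nn_integral_mono)
    fix p :: "real \<times> real"
    obtain x y where p: "p = (x, y)" by force
    have "ennreal (\<bar>f p\<bar> ^ 6) = ennreal (\<bar>f p\<bar> ^ 3) * ennreal (\<bar>f p\<bar> ^ 3)"
      by (simp flip: ennreal_mult power_add)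
    also have "\<dots> \<le> b (fst p) * a (snd p)"
      unfolding p by (intro mult_mono) (use le_a le_b in auto)
    finally show "ennreal (\<bar>f p\<bar> ^ 6) \<le> b (fst p) * a (snd p)" .
  qed
  also have "\<dots> = (\<integral>\<^sup>+x. \<integral>\<^sup>+y. b x * a y \<partial>lborel \<partial>lborel)"
    by (subst nn_integral_lborel_fst[symmetric]) (auto simp: borel_prod[symmetric])
  also have "\<dots> = (\<integral>\<^sup>+x. b x \<partial>lborel) * (\<integral>\<^sup>+y. a y \<partial>lborel)"
    by (simp add: nn_integral_cmult nn_integral_multc)
  also have "\<dots> = (\<integral>\<^sup>+p. B p \<partial>lborel) * (\<integral>\<^sup>+p. A p \<partial>lborel)"
    unfolding a_def b_def by (simp add: nn_integral_lborel_fst nn_integral_lborel_snd AB)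
  also have "\<dots> \<le> 9 * (\<integral>\<^sup>+p. ennreal (\<bar>f p\<bar> ^ 4) \<partial>lborel) * (\<integral>\<^sup>+p. ennreal (g p) \<partial>lborel)"
    using nn_integral_power_derivative_sq_le[OF m(1,3) g(1,3), of 3 2]
      nn_integral_power_derivative_sq_le[OF m(1,2) g(1,2), of 3 2]
    by (intro ennreal_mult_le_of_squares_le) (simp_all add: A_def B_def)
  finally show ?thesis .
qed

text \<open>
  In the applications \<open>I\<close> is \<open>\<integral>f\<^sup>6\<close> and \<open>S\<close> is a bound for \<open>\<integral>f\<^sup>4\<close> in terms of \<open>\<surd>I\<close>. Squaring the first
  inequality leaves one spare factor \<open>I\<close>, which cancels because it is finite.
\<close>

lemma ennreal_absorb_sqrt:
  fixes I G S :: ennreal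
  assumes "I \<le> 9 * S * G" "S\<^sup>2 \<le> c * I * G" "I < top"
  shows "I \<le> 81 * c * G ^ 3"
proof (cases "I = 0")
  case False
  have "I * I \<le> (9 * S * G) * (9 * S * G)"
    by (intro mult_mono assms(1)) auto
  also have "\<dots> = 81 * S\<^sup>2 * G\<^sup>2"
    by (simp add: power2_eq_square algebra_simps)
  also have "\<dots> \<le> 81 * (c * I * G) * G\<^sup>2"
    by (intro mult_right_mono mult_left_mono assms(2)) auto
  also have "\<dots> = I * (81 * c * G ^ 3)"
    by (simp add: power2_eq_square power3_eq_cube algebra_simps)
  finally show ?thesis
    using False assms(3) by (simp add: ennreal_mult_le_mult_iff)
qed simp

lemma continuous_compact_support_nn_integral_finite:
  fixes F :: "'a::euclidean_space \<Rightarrow> real"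
  assumes "continuous_on UNIV F" "\<And>x. norm x > r \<Longrightarrow> F x = 0"
  shows "(\<integral>\<^sup>+p. ennreal (\<bar>F p\<bar> ^ Suc k) \<partial>lborel) < top"
proof -
  have "integrable lborel (\<lambda>p. \<bar>F p\<bar> ^ Suc k)"
    using assms by (intro continuous_compact_support_integrable[where r=r] continuous_intros) auto
  then show ?thesis
    by (simp add: integrable_iff_bounded power_abs)
qed

text \<open>
  By \<open>plane_L6_bound\<close>, only \<open>\<integral>f\<^sup>4\<close> has to be estimated. It is at most \<open>2r\<close> times the integral over \<open>y\<close> of
  the supremum over \<open>x\<close>, which is obtained by integrating \<open>\<partial>\<^sub>x(f\<^sup>4)\<close>; this is where the bounded support
  enters. The constant is \<open>5184 r\<^sup>2 = 81 \<cdot> (2r)\<^sup>2 \<cdot> 16\<close>.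
\<close>

lemma plane_Sobolev:
  fixes f fx fy g :: "real \<times> real \<Rightarrow> real"
  assumes cont: "continuous_on UNIV f" "continuous_on UNIV fx" "continuous_on UNIV fy"
    and g: "g \<in> borel_measurable borel" "\<And>p. (fx p)\<^sup>2 \<le> g p" "\<And>p. (fy p)\<^sup>2 \<le> g p"
    and dx: "\<And>x y. ((\<lambda>x. f (x, y)) has_real_derivative fx (x, y)) (at x)"
    and dy: "\<And>x y. ((\<lambda>y. f (x, y)) has_real_derivative fy (x, y)) (at y)"
    and supp: "\<And>x y. \<bar>x\<bar> > r \<or> \<bar>y\<bar> > r \<Longrightarrow> f (x, y) = 0" and r: "r > 0"
  shows "(\<integral>\<^sup>+p. ennreal (\<bar>f p\<bar> ^ 6) \<partial>lborel) \<le> ennreal (5184 * r\<^sup>2) * (\<integral>\<^sup>+p. ennreal (g p) \<partial>lborel) ^ 3"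
proof -
  have m [measurable]: "f \<in> borel_measurable borel" "fx \<in> borel_measurable borel" "fy \<in> borel_measurable borel"
    using cont by (auto intro: borel_measurable_continuous_onI)
  define A where "A p = ennreal (real 4 * \<bar>f p\<bar> ^ 3 * \<bar>fx p\<bar>)" for p
  have A [measurable]: "A \<in> borel_measurable borel"
    unfolding A_def using m by measurable
  define a where "a y = (\<integral>\<^sup>+x. A (x, y) \<partial>lborel)" for y
  have [measurable]: "a \<in> borel_measurable borel"
    unfolding a_def by (rule measurable_nn_integral_slice A)+
  have le_a: "ennreal (\<bar>f (x, y)\<bar> ^ 4) \<le> indicator {-r..r} x * a y" for x y
  proof (cases "\<bar>x\<bar> > r")
    case True then show ?thesis using supp by simp
  next
    case False
    have "continuous_on UNIV (\<lambda>x. fx (x, y))"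
      by (rule continuous_on_compose2[OF cont(2)]) (auto intro!: continuous_intros)
    from nn_integral_power_derivative_bound[OF dx this, of r 4 x] supp
    have "ennreal (\<bar>f (x, y)\<bar> ^ 4) \<le> a y"
      by (simp add: a_def A_def)
    moreover have "x \<in> {-r..r}" using False by auto
    ultimately show ?thesis by simp
  qed
  have "(\<integral>\<^sup>+p. ennreal (\<bar>f p\<bar> ^ 4) \<partial>lborel) = (\<integral>\<^sup>+x. \<integral>\<^sup>+y. ennreal (\<bar>f (x, y)\<bar> ^ 4) \<partial>lborel \<partial>lborel)"
    by (subst nn_integral_lborel_fst[symmetric]) auto
  also have "\<dots> \<le> (\<integral>\<^sup>+x. \<integral>\<^sup>+y. indicator {-r..r} x * a y \<partial>lborel \<partial>lborel)"
    by (intro nn_integral_mono le_a)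
  also have "\<dots> = (\<integral>\<^sup>+x. indicator {-r..r} (x::real) \<partial>lborel) * (\<integral>\<^sup>+y. a y \<partial>lborel)"
    by (simp add: nn_integral_cmult nn_integral_multc del: nn_integral_indicator)
  also have "\<dots> = ennreal (2 * r) * (\<integral>\<^sup>+p. A p \<partial>lborel)"
    using r unfolding a_def by (simp add: nn_integral_lborel_snd)
  finally have I4: "(\<integral>\<^sup>+p. ennreal (\<bar>f p\<bar> ^ 4) \<partial>lborel) \<le> ennreal (2 * r) * (\<integral>\<^sup>+p. A p \<partial>lborel)" .
  have "(\<integral>\<^sup>+p. ennreal (\<bar>f p\<bar> ^ 6) \<partial>lborel) \<le> 81 * (ennreal ((2 * r)\<^sup>2) * 16) * (\<integral>\<^sup>+p. ennreal (g p) \<partial>lborel) ^ 3"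
  proof (rule ennreal_absorb_sqrt)
    show "(\<integral>\<^sup>+p. ennreal (\<bar>f p\<bar> ^ 6) \<partial>lborel)
        \<le> 9 * (ennreal (2 * r) * (\<integral>\<^sup>+p. A p \<partial>lborel)) * (\<integral>\<^sup>+p. ennreal (g p) \<partial>lborel)"
    proof -
      have "(\<integral>\<^sup>+p. ennreal (\<bar>f p\<bar> ^ 6) \<partial>lborel)
          \<le> 9 * (\<integral>\<^sup>+p. ennreal (\<bar>f p\<bar> ^ 4) \<partial>lborel) * (\<integral>\<^sup>+p. ennreal (g p) \<partial>lborel)"
        by (rule plane_L6_bound[OF cont g dx dy, where r=r]) (use supp in auto)
      also have "\<dots> \<le> 9 * (ennreal (2 * r) * (\<integral>\<^sup>+p. A p \<partial>lborel)) * (\<integral>\<^sup>+p. ennreal (g p) \<partial>lborel)"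
        by (intro mult_right_mono mult_left_mono I4 zero_le)
      finally show ?thesis .
    qed
    have "(ennreal (2 * r) * (\<integral>\<^sup>+p. A p \<partial>lborel))\<^sup>2 = ennreal ((2 * r)\<^sup>2) * (\<integral>\<^sup>+p. A p \<partial>lborel)\<^sup>2"
      using r by (simp add: power_mult_distrib ennreal_power)
    also have "\<dots> \<le> ennreal ((2 * r)\<^sup>2) * (16 * (\<integral>\<^sup>+p. ennreal (\<bar>f p\<bar> ^ 6) \<partial>lborel) * (\<integral>\<^sup>+p. ennreal (g p) \<partial>lborel))"
      using nn_integral_power_derivative_sq_le[OF m(1,2) g(1,2), of 4 3]
      by (intro mult_left_mono) (simp_all add: A_def)
    finally show "(ennreal (2 * r) * (\<integral>\<^sup>+p. A p \<partial>lborel))\<^sup>2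
        \<le> (ennreal ((2 * r)\<^sup>2) * 16) * (\<integral>\<^sup>+p. ennreal (\<bar>f p\<bar> ^ 6) \<partial>lborel) * (\<integral>\<^sup>+p. ennreal (g p) \<partial>lborel)"
      by (simp only: mult.assoc)
    have "f p = 0" if "norm p > 2 * r" for p
    proof -
      obtain x y where p: "p = (x, y)" by force
      have "\<bar>x\<bar> > r \<or> \<bar>y\<bar> > r"
        using that norm_Pair_le[of x y] by (auto simp: p)
      then show ?thesis using supp p by simp
    qed
    then show "(\<integral>\<^sup>+p. ennreal (\<bar>f p\<bar> ^ 6) \<partial>lborel) < top"
      using continuous_compact_support_nn_integral_finite[OF cont(1), of "2 * r" 5] by simp
  qed
  also have "81 * (ennreal ((2 * r)\<^sup>2) * 16) = ennreal (81 * ((2 * r)\<^sup>2 * 16))"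
    by (subst ennreal_mult, simp, simp, subst ennreal_mult, simp, simp, simp only: ennreal_numeral)
  also have "81 * ((2 * r)\<^sup>2 * 16) = 5184 * r\<^sup>2"
    by (simp add: power_mult_distrib)
  finally show ?thesis .
qed

text \<open>
  The plane estimate is applied on each plane \<open>z = const\<close> and integrated over \<open>z\<close>. There \<open>\<integral>f\<^sup>4\<close> is bounded
  uniformly in \<open>z\<close> by integrating \<open>\<partial>\<^sub>z(f\<^sup>4)\<close> in the third direction. This uses all three derivatives, and
  the constant \<open>1296 = 81 \<cdot> 16\<close> is independent of the support.
\<close>

lemma space_Sobolev:
  fixes f fx fy fz g :: "(real \<times> real) \<times> real \<Rightarrow> real"
  assumes cont: "continuous_on UNIV f" "continuous_on UNIV fx" "continuous_on UNIV fy" "continuous_on UNIV fz"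
    and g: "g \<in> borel_measurable borel" "\<And>p. (fx p)\<^sup>2 \<le> g p" "\<And>p. (fy p)\<^sup>2 \<le> g p" "\<And>p. (fz p)\<^sup>2 \<le> g p"
    and dx: "\<And>x y z. ((\<lambda>x. f ((x, y), z)) has_real_derivative fx ((x, y), z)) (at x)"
    and dy: "\<And>x y z. ((\<lambda>y. f ((x, y), z)) has_real_derivative fy ((x, y), z)) (at y)"
    and dz: "\<And>q z. ((\<lambda>z. f (q, z)) has_real_derivative fz (q, z)) (at z)"
    and supp: "\<And>x y z. \<bar>x\<bar> > r \<or> \<bar>y\<bar> > r \<or> \<bar>z\<bar> > r \<Longrightarrow> f ((x, y), z) = 0"
  shows "(\<integral>\<^sup>+p. ennreal (\<bar>f p\<bar> ^ 6) \<partial>lborel) \<le> 1296 * (\<integral>\<^sup>+p. ennreal (g p) \<partial>lborel) ^ 3"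
proof -
  have m [measurable]: "f \<in> borel_measurable borel" "fx \<in> borel_measurable borel"
    "fy \<in> borel_measurable borel" "fz \<in> borel_measurable borel"
    using cont by (auto intro: borel_measurable_continuous_onI)
  note g(1) [measurable]
  define A where "A p = ennreal (real 4 * \<bar>f p\<bar> ^ 3 * \<bar>fz p\<bar>)" for p
  have A [measurable]: "A \<in> borel_measurable borel"
    unfolding A_def using m by measurable
  define S where "S = (\<integral>\<^sup>+p. A p \<partial>lborel)"
  have slice: "continuous_on UNIV (\<lambda>q. h (q, z))" if "continuous_on UNIV h"
    for h :: "(real \<times> real) \<times> real \<Rightarrow> real" and z
    by (rule continuous_on_compose2[OF that]) (auto intro!: continuous_intros)
  have I4: "(\<integral>\<^sup>+q. ennreal (\<bar>f (q, z)\<bar> ^ 4) \<partial>lborel) \<le> S" for z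
  proof -
    have "ennreal (\<bar>f (q, z)\<bar> ^ 4) \<le> (\<integral>\<^sup>+z. A (q, z) \<partial>lborel)" for q
    proof -
      obtain x y where q: "q = (x, y)" by force
      have "continuous_on UNIV (\<lambda>z. fz (q, z))"
        by (rule continuous_on_compose2[OF cont(4)]) (auto intro!: continuous_intros)
      from nn_integral_power_derivative_bound[OF dz this, of r 4 z] supp[of x y] show ?thesis
        by (simp add: A_def q)
    qed
    then have "(\<integral>\<^sup>+q. ennreal (\<bar>f (q, z)\<bar> ^ 4) \<partial>lborel) \<le> (\<integral>\<^sup>+q. \<integral>\<^sup>+z. A (q, z) \<partial>lborel \<partial>lborel)"
      by (intro nn_integral_mono)
    then show ?thesis
      by (simp add: S_def nn_integral_lborel_fst)
  qed
  have I6: "(\<integral>\<^sup>+q. ennreal (\<bar>f (q, z)\<bar> ^ 6) \<partial>lborel) \<le> 9 * S * (\<integral>\<^sup>+q. ennreal (g (q, z)) \<partial>lborel)" for z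
  proof -
    have gz: "(\<lambda>q. g (q, z)) \<in> borel_measurable borel" by measurable
    have "(\<integral>\<^sup>+q. ennreal (\<bar>f (q, z)\<bar> ^ 6) \<partial>lborel)
        \<le> 9 * (\<integral>\<^sup>+q. ennreal (\<bar>f (q, z)\<bar> ^ 4) \<partial>lborel) * (\<integral>\<^sup>+q. ennreal (g (q, z)) \<partial>lborel)"
      by (rule plane_L6_bound[OF slice[OF cont(1)] slice[OF cont(2)] slice[OF cont(3)] gz g(2,3) dx dy,
            where r=r]) (use supp in auto)
    also have "\<dots> \<le> 9 * S * (\<integral>\<^sup>+q. ennreal (g (q, z)) \<partial>lborel)"
      by (intro mult_mono I4) auto
    finally show ?thesis .
  qed
  have "(\<integral>\<^sup>+p. ennreal (\<bar>f p\<bar> ^ 6) \<partial>lborel) \<le> 81 * 16 * (\<integral>\<^sup>+p. ennreal (g p) \<partial>lborel) ^ 3"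
  proof (rule ennreal_absorb_sqrt)
    have "(\<integral>\<^sup>+p. ennreal (\<bar>f p\<bar> ^ 6) \<partial>lborel) = (\<integral>\<^sup>+z. \<integral>\<^sup>+q. ennreal (\<bar>f (q, z)\<bar> ^ 6) \<partial>lborel \<partial>lborel)"
      by (subst nn_integral_lborel_snd[symmetric]) auto
    also have "\<dots> \<le> (\<integral>\<^sup>+z. 9 * S * (\<integral>\<^sup>+q. ennreal (g (q, z)) \<partial>lborel) \<partial>lborel)"
      by (intro nn_integral_mono I6)
    also have "\<dots> = 9 * S * (\<integral>\<^sup>+z. \<integral>\<^sup>+q. ennreal (g (q, z)) \<partial>lborel \<partial>lborel)"
      by (intro nn_integral_cmult) measurable
    also have "(\<integral>\<^sup>+z. \<integral>\<^sup>+q. ennreal (g (q, z)) \<partial>lborel \<partial>lborel) = (\<integral>\<^sup>+p. ennreal (g p) \<partial>lborel)"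
      by (subst nn_integral_lborel_snd) auto
    finally show "(\<integral>\<^sup>+p. ennreal (\<bar>f p\<bar> ^ 6) \<partial>lborel) \<le> 9 * S * (\<integral>\<^sup>+p. ennreal (g p) \<partial>lborel)" .
    show "S\<^sup>2 \<le> 16 * (\<integral>\<^sup>+p. ennreal (\<bar>f p\<bar> ^ 6) \<partial>lborel) * (\<integral>\<^sup>+p. ennreal (g p) \<partial>lborel)"
      using nn_integral_power_derivative_sq_le[OF m(1,4) g(1,4), of 4 3]
      by (simp add: S_def A_def)
    have "f p = 0" if "norm p > 3 * r" for p
    proof -
      obtain x y z where p: "p = ((x, y), z)" by (metis prod.exhaust)
      have "\<bar>x\<bar> > r \<or> \<bar>y\<bar> > r \<or> \<bar>z\<bar> > r"
        using that norm_Pair_le[of "(x, y)" z] norm_Pair_le[of x y] by (auto simp: p)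
      then show ?thesis using supp p by simp
    qed
    then show "(\<integral>\<^sup>+p. ennreal (\<bar>f p\<bar> ^ 6) \<partial>lborel) < top"
      using continuous_compact_support_nn_integral_finite[OF cont(1), of "3 * r" 5] by simp
  qed
  then show ?thesis by simp
qed


section \<open>Transfer to Cartesian coordinates\<close>

lemma prod_Basis_cart:
  fixes v :: "real^'n"
  shows "(\<Prod>b\<in>Basis. v \<bullet> b) = (\<Prod>m\<in>UNIV. v $ m)"
proof -
  have B: "(Basis :: (real^'n) set) = (\<lambda>m. axis m 1) ` UNIV"
    by (auto simp: Basis_vec_def)
  have "inj (\<lambda>m::'n. axis m (1::real))"
    by (auto simp: inj_def axis_eq_axis)
  then show ?thesis
    unfolding B by (simp add: prod.reindex cart_eq_inner_axis)
qed

lemma emeasure_lborel_Times: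
  fixes A :: "'a::euclidean_space set" and B :: "'b::euclidean_space set"
  assumes "A \<in> sets borel" "B \<in> sets borel"
  shows "emeasure lborel (A \<times> B) = emeasure lborel A * emeasure lborel B"
  using lborel.emeasure_pair_measure_Times[of A lborel B] assms by (simp add: lborel_prod)

text \<open>
  Index types with two and three elements: \<open>i\<close> indexes the first coordinate, \<open>j\<close> the second one of
  three, and the remaining index the last coordinate.
\<close>

definition plane_embedding :: "'n \<Rightarrow> real \<times> real \<Rightarrow> real^'n" where
  "plane_embedding i p = (\<chi> m. if m = i then fst p else snd p)"

definition space_embedding :: "'n \<Rightarrow> 'n \<Rightarrow> (real \<times> real) \<times> real \<Rightarrow> real^'n" where
  "space_embedding i j p = (\<chi> m. if m = i then fst (fst p) else if m = j then snd (fst p) else snd p)"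

lemma plane_embedding_continuous: "continuous_on UNIV (plane_embedding i)"
  unfolding plane_embedding_def
proof (intro continuous_on_vec_lambda)
  show "continuous_on UNIV (\<lambda>p. if m = i then fst p else snd p)" for m
    by (cases "m = i") (auto intro!: continuous_intros)
qed

lemma space_embedding_continuous: "continuous_on UNIV (space_embedding i j)"
  unfolding space_embedding_def
proof (intro continuous_on_vec_lambda)
  show "continuous_on UNIV
      (\<lambda>p. if m = i then fst (fst p) else if m = j then snd (fst p) else snd p)" for m
    by (cases "m = i"; cases "m = j") (auto intro!: continuous_intros)
qed

lemma lborel_eq_distr_plane_embedding:
  assumes U: "(UNIV :: 'n::finite set) = {i, j}" and ij: "i \<noteq> j"
  shows "(lborel :: (real^'n) measure) = distr lborel borel (plane_embedding i)"
proof (rule lborel_eqI)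
  have m: "plane_embedding i \<in> borel_measurable borel"
    by (rule borel_measurable_continuous_onI[OF plane_embedding_continuous])
  fix l u :: "real^'n" assume le: "\<And>b. b \<in> Basis \<Longrightarrow> l \<bullet> b \<le> u \<bullet> b"
  then have le': "l $ m \<le> u $ m" for m
    using le[of "axis m 1"] by (simp add: cart_eq_inner_axis)
  have all: "(\<forall>m. P m) \<longleftrightarrow> P i \<and> P j" for P
    using U by (metis (full_types) UNIV_I insertE singletonD)
  have "plane_embedding i -` box l u = {l $ i <..< u $ i} \<times> {l $ j <..< u $ j}"
    using ij by (auto simp: plane_embedding_def mem_box_cart all)
  then have "emeasure (distr lborel borel (plane_embedding i)) (box l u)
      = emeasure lborel ({l $ i <..< u $ i} \<times> {l $ j <..< u $ j})"
    using m by (simp add: emeasure_distr)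
  also have "\<dots> = ennreal (\<Prod>m\<in>UNIV. (u - l) $ m)"
    unfolding U using ij le' by (simp add: emeasure_lborel_Times ennreal_mult)
  finally show "emeasure (distr lborel borel (plane_embedding i)) (box l u) = (\<Prod>b\<in>Basis. (u - l) \<bullet> b)"
    by (simp add: prod_Basis_cart)
qed simp

lemma lborel_eq_distr_space_embedding:
  assumes U: "(UNIV :: 'n::finite set) = {i, j, k}" and ij: "i \<noteq> j" "i \<noteq> k" "j \<noteq> k"
  shows "(lborel :: (real^'n) measure) = distr lborel borel (space_embedding i j)"
proof (rule lborel_eqI)
  have m: "space_embedding i j \<in> borel_measurable borel"
    by (rule borel_measurable_continuous_onI[OF space_embedding_continuous])
  fix l u :: "real^'n" assume le: "\<And>b. b \<in> Basis \<Longrightarrow> l \<bullet> b \<le> u \<bullet> b"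
  then have le': "l $ m \<le> u $ m" for m
    using le[of "axis m 1"] by (simp add: cart_eq_inner_axis)
  have all: "(\<forall>m. P m) \<longleftrightarrow> P i \<and> P j \<and> P k" for P
    using U by (metis (full_types) UNIV_I insertE singletonD)
  have "space_embedding i j -` box l u
      = ({l $ i <..< u $ i} \<times> {l $ j <..< u $ j}) \<times> {l $ k <..< u $ k}"
    using ij by (auto simp: space_embedding_def mem_box_cart all)
  then have "emeasure (distr lborel borel (space_embedding i j)) (box l u)
      = emeasure lborel (({l $ i <..< u $ i} \<times> {l $ j <..< u $ j}) \<times> {l $ k <..< u $ k})"
    using m by (simp add: emeasure_distr)
  also have "\<dots> = ennreal (\<Prod>m\<in>UNIV. (u - l) $ m)"
    unfolding U using ij le'
    by (simp add: emeasure_lborel_Times ennreal_mult mult.assoc borel_Times)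
  finally show "emeasure (distr lborel borel (space_embedding i j)) (box l u) = (\<Prod>b\<in>Basis. (u - l) \<bullet> b)"
    by (simp add: prod_Basis_cart)
qed simp

lemma C1_compact_line_derivative:
  assumes F: "C1_compact F" and T: "\<And>t. T t = c + t *\<^sub>R e"
  shows "((\<lambda>t. F (T t)) has_real_derivative partial F e (T s)) (at s)"
proof -
  have "(T has_derivative (\<lambda>h. h *\<^sub>R e)) (at s)"
    unfolding T[abs_def] by (auto intro!: derivative_eq_intros)
  from has_derivative_compose[OF this C1_compact_has_derivative[OF F]]
  have "((\<lambda>t. F (T t)) has_derivative (\<lambda>h. h * partial F e (T s))) (at s)"
    using linear_scale[OF has_derivative_linear[OF C1_compact_has_derivative[OF F]]] by simp
  then show ?thesis
    by (simp add: has_field_derivative_def mult_commute_abs)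
qed

lemma classical_gradient_continuous:
  "C1_compact F \<Longrightarrow> continuous_on UNIV (classical_gradient F)"
  unfolding classical_gradient_def[abs_def]
  by (intro continuous_on_sum continuous_on_scaleR partial_continuous continuous_on_const)

lemma partial_le_norm_classical_gradient:
  "e \<in> Basis \<Longrightarrow> (partial F e x)\<^sup>2 \<le> (norm (classical_gradient F x))\<^sup>2"
  using Basis_le_norm[of e "classical_gradient F x"]
  by (simp add: classical_gradient_inner abs_le_square_iff[symmetric])

lemma C1_compact_Sobolev_plane:
  fixes F :: "real^'n \<Rightarrow> real"
  assumes F: "C1_compact F" and card: "CARD('n) = 2"
    and supp: "\<And>x. norm x > r \<Longrightarrow> F x = 0" and r: "r > 0"
  shows "(\<integral>\<^sup>+x. ennreal (\<bar>F x\<bar> ^ 6) \<partial>lborel)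
    \<le> ennreal (5184 * r\<^sup>2) * (\<integral>\<^sup>+x. ennreal ((norm (classical_gradient F x))\<^sup>2) \<partial>lborel) ^ 3"
proof -
  obtain i j :: 'n where U: "UNIV = {i, j}" and ij: "i \<noteq> j"
    using card by (metis card_2_iff)
  let ?T = "plane_embedding i :: real \<times> real \<Rightarrow> real^'n"
  have Tc: "continuous_on UNIV (\<lambda>p. h (?T p))" if "continuous_on UNIV h" for h :: "real^'n \<Rightarrow> real"
    by (rule continuous_on_compose2[OF that plane_embedding_continuous]) simp
  have Tm [measurable]: "?T \<in> borel_measurable borel"
    by (rule borel_measurable_continuous_onI[OF plane_embedding_continuous])
  have int: "(\<integral>\<^sup>+x. h x \<partial>lborel) = (\<integral>\<^sup>+p. h (?T p) \<partial>lborel)" if "h \<in> borel_measurable borel" for h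
    using that by (subst lborel_eq_distr_plane_embedding[OF U ij]) (simp add: nn_integral_distr)
  have B: "axis m (1::real) \<in> Basis" for m :: 'n by (simp add: axis_in_Basis_iff Basis_real_def)
  have cF: "continuous_on UNIV (\<lambda>x. norm (classical_gradient F x))"
    by (intro continuous_on_norm classical_gradient_continuous F)
  have mF: "F \<in> borel_measurable borel" "(\<lambda>x. norm (classical_gradient F x)) \<in> borel_measurable borel"
    using C1_compact_continuous[OF F] cF by (auto intro: borel_measurable_continuous_onI)
  have "(\<integral>\<^sup>+p. ennreal (\<bar>F (?T p)\<bar> ^ 6) \<partial>lborel)
    \<le> ennreal (5184 * r\<^sup>2) * (\<integral>\<^sup>+p. ennreal ((norm (classical_gradient F (?T p)))\<^sup>2) \<partial>lborel) ^ 3"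
  proof (rule plane_Sobolev)
    show "continuous_on UNIV (\<lambda>p. F (?T p))" "continuous_on UNIV (\<lambda>p. partial F (axis i 1) (?T p))"
      "continuous_on UNIV (\<lambda>p. partial F (axis j 1) (?T p))"
      by (intro Tc C1_compact_continuous partial_continuous F)+
    show "(\<lambda>p. (norm (classical_gradient F (?T p)))\<^sup>2) \<in> borel_measurable borel"
      using measurable_compose[OF Tm mF(2)] by measurable
    show "(partial F (axis i 1) (?T p))\<^sup>2 \<le> (norm (classical_gradient F (?T p)))\<^sup>2"
      "(partial F (axis j 1) (?T p))\<^sup>2 \<le> (norm (classical_gradient F (?T p)))\<^sup>2" for p
      by (intro partial_le_norm_classical_gradient B)+
    show "((\<lambda>x. F (?T (x, y))) has_real_derivative partial F (axis i 1) (?T (x, y))) (at x)" for x y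
      by (rule C1_compact_line_derivative[OF F, where c="?T (0, y)"])
        (auto simp: plane_embedding_def vec_eq_iff axis_def)
    show "((\<lambda>y. F (?T (x, y))) has_real_derivative partial F (axis j 1) (?T (x, y))) (at y)" for x y
      by (rule C1_compact_line_derivative[OF F, where c="?T (x, 0)"])
        (use U ij in \<open>auto simp: plane_embedding_def vec_eq_iff axis_def\<close>)
    show "F (?T (x, y)) = 0" if "\<bar>x\<bar> > r \<or> \<bar>y\<bar> > r" for x y
    proof (rule supp)
      have "\<bar>x\<bar> \<le> norm (?T (x, y))" "\<bar>y\<bar> \<le> norm (?T (x, y))"
        using component_le_norm_cart[of "?T (x, y)" i] component_le_norm_cart[of "?T (x, y)" j] ij
        by (simp_all add: plane_embedding_def)
      then show "norm (?T (x, y)) > r" using that by linarith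
    qed
  qed (rule r)
  then show ?thesis
    using mF by (simp add: int)
qed

lemma C1_compact_Sobolev_space:
  fixes F :: "real^'n \<Rightarrow> real"
  assumes F: "C1_compact F" and card: "CARD('n) = 3"
  shows "(\<integral>\<^sup>+x. ennreal (\<bar>F x\<bar> ^ 6) \<partial>lborel)
    \<le> 1296 * (\<integral>\<^sup>+x. ennreal ((norm (classical_gradient F x))\<^sup>2) \<partial>lborel) ^ 3"
proof -
  obtain r where supp: "\<And>x. norm x > r \<Longrightarrow> F x = 0"
    using C1_compact_support[OF F] by metis
  obtain i j k :: 'n where U: "UNIV = {i, j, k}" and ij: "i \<noteq> j" "i \<noteq> k" "j \<noteq> k"
    using card by (metis card_3_iff)
  let ?T = "space_embedding i j :: (real \<times> real) \<times> real \<Rightarrow> real^'n"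
  have Tc: "continuous_on UNIV (\<lambda>p. h (?T p))" if "continuous_on UNIV h" for h :: "real^'n \<Rightarrow> real"
    by (rule continuous_on_compose2[OF that space_embedding_continuous]) simp
  have Tm [measurable]: "?T \<in> borel_measurable borel"
    by (rule borel_measurable_continuous_onI[OF space_embedding_continuous])
  have int: "(\<integral>\<^sup>+x. h x \<partial>lborel) = (\<integral>\<^sup>+p. h (?T p) \<partial>lborel)" if "h \<in> borel_measurable borel" for h
    using that by (subst lborel_eq_distr_space_embedding[OF U ij]) (simp add: nn_integral_distr)
  have B: "axis m (1::real) \<in> Basis" for m :: 'n by (simp add: axis_in_Basis_iff Basis_real_def)
  have cF: "continuous_on UNIV (\<lambda>x. norm (classical_gradient F x))"
    by (intro continuous_on_norm classical_gradient_continuous F)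
  have mF: "F \<in> borel_measurable borel" "(\<lambda>x. norm (classical_gradient F x)) \<in> borel_measurable borel"
    using C1_compact_continuous[OF F] cF by (auto intro: borel_measurable_continuous_onI)
  have all: "(\<forall>m. P m) \<longleftrightarrow> P i \<and> P j \<and> P k" for P
    using U by (metis (full_types) UNIV_I insertE singletonD)
  have "(\<integral>\<^sup>+p. ennreal (\<bar>F (?T p)\<bar> ^ 6) \<partial>lborel)
    \<le> 1296 * (\<integral>\<^sup>+p. ennreal ((norm (classical_gradient F (?T p)))\<^sup>2) \<partial>lborel) ^ 3"
  proof (rule space_Sobolev)
    show "continuous_on UNIV (\<lambda>p. F (?T p))" "continuous_on UNIV (\<lambda>p. partial F (axis i 1) (?T p))"
      "continuous_on UNIV (\<lambda>p. partial F (axis j 1) (?T p))"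
      "continuous_on UNIV (\<lambda>p. partial F (axis k 1) (?T p))"
      by (intro Tc C1_compact_continuous partial_continuous F)+
    show "(\<lambda>p. (norm (classical_gradient F (?T p)))\<^sup>2) \<in> borel_measurable borel"
      using measurable_compose[OF Tm mF(2)] by measurable
    show "(partial F (axis i 1) (?T p))\<^sup>2 \<le> (norm (classical_gradient F (?T p)))\<^sup>2"
      "(partial F (axis j 1) (?T p))\<^sup>2 \<le> (norm (classical_gradient F (?T p)))\<^sup>2"
      "(partial F (axis k 1) (?T p))\<^sup>2 \<le> (norm (classical_gradient F (?T p)))\<^sup>2" for p
      by (intro partial_le_norm_classical_gradient B)+
    show "((\<lambda>x. F (?T ((x, y), z))) has_real_derivative partial F (axis i 1) (?T ((x, y), z))) (at x)" for x y z
      by (rule C1_compact_line_derivative[OF F, where c="?T ((0, y), z)"])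
        (use ij in \<open>auto simp: space_embedding_def vec_eq_iff axis_def all\<close>)
    show "((\<lambda>y. F (?T ((x, y), z))) has_real_derivative partial F (axis j 1) (?T ((x, y), z))) (at y)" for x y z
      by (rule C1_compact_line_derivative[OF F, where c="?T ((x, 0), z)"])
        (use ij in \<open>auto simp: space_embedding_def vec_eq_iff axis_def all\<close>)
    show "((\<lambda>z. F (?T (q, z))) has_real_derivative partial F (axis k 1) (?T (q, z))) (at z)" for q z
      by (rule C1_compact_line_derivative[OF F, where c="?T (q, 0)"])
        (use ij in \<open>auto simp: space_embedding_def vec_eq_iff axis_def all\<close>)
    show "F (?T ((x, y), z)) = 0" if "\<bar>x\<bar> > r \<or> \<bar>y\<bar> > r \<or> \<bar>z\<bar> > r" for x y z
    proof (rule supp)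
      have "\<bar>x\<bar> \<le> norm (?T ((x, y), z))" "\<bar>y\<bar> \<le> norm (?T ((x, y), z))" "\<bar>z\<bar> \<le> norm (?T ((x, y), z))"
        using component_le_norm_cart[of "?T ((x, y), z)" i] component_le_norm_cart[of "?T ((x, y), z)" j]
          component_le_norm_cart[of "?T ((x, y), z)" k] ij
        by (simp_all add: space_embedding_def)
      then show "norm (?T ((x, y), z)) > r" using that by linarith
    qed
  qed
  then show ?thesis
    using mF by (simp add: int)
qed

text \<open>
  In the plane the constant depends on the radius of a ball containing \<open>\<Omega>\<close>; in space it is absolute.
\<close>

lemma test_functions_Sobolev:
  fixes \<Omega> :: "(real^'n) set"
  assumes "bounded \<Omega>" "CARD('n) \<in> {2, 3}"
  obtains K where "K > 0" "\<And>\<phi>. \<phi> \<in> test_functions \<Omega> \<Longrightarrow>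
    (\<integral>\<^sup>+x. ennreal (\<bar>\<phi> x\<bar> ^ 6) \<partial>lborel)
      \<le> ennreal K * (\<integral>\<^sup>+x. ennreal ((norm (classical_gradient \<phi> x))\<^sup>2) \<partial>lborel) ^ 3"
proof (cases "CARD('n) = 2")
  case True
  obtain r where r: "r > 0" "\<And>x. x \<in> \<Omega> \<Longrightarrow> norm x \<le> r"
    using assms(1) by (auto simp: bounded_pos)
  show ?thesis
  proof (rule that)
    show "5184 * r\<^sup>2 > 0" using r(1) by simp
    fix \<phi> assume \<phi>: "\<phi> \<in> test_functions \<Omega>"
    have "\<phi> x = 0" if "norm x > r" for x
      using r(2)[of x] that by (intro test_function_outside(1)[OF \<phi>]) auto
    then show "(\<integral>\<^sup>+x. ennreal (\<bar>\<phi> x\<bar> ^ 6) \<partial>lborel)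
      \<le> ennreal (5184 * r\<^sup>2) * (\<integral>\<^sup>+x. ennreal ((norm (classical_gradient \<phi> x))\<^sup>2) \<partial>lborel) ^ 3"
      by (rule C1_compact_Sobolev_plane[OF test_function_C1_compact[OF \<phi>] True _ r(1)])
  qed
next
  case False
  show ?thesis
    by (rule that[of 1296])
      (use False assms(2) C1_compact_Sobolev_space test_function_C1_compact in auto)
qed


section \<open>Sobolev and Poincare inequalities on \<open>H\<^sub>0\<^sup>1\<close>\<close>

text \<open>
  The dependence of all further constants on the domain is through \<open>K\<close> and the measure of \<open>\<Omega>\<close>.
\<close>

locale Sobolev_domain = bounded_open_set \<Omega> for \<Omega> :: "(real^'n) set" +
  fixes K :: real
  assumes K_pos: "K > 0"
    and Sobolev_test: "\<And>\<phi>. \<phi> \<in> test_functions \<Omega> \<Longrightarrow>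
      (\<integral>\<^sup>+x. ennreal (\<bar>\<phi> x\<bar> ^ 6) \<partial>lborel)
        \<le> ennreal K * (\<integral>\<^sup>+x. ennreal ((norm (classical_gradient \<phi> x))\<^sup>2) \<partial>lborel) ^ 3"
begin

lemma Sobolev_test_domain:
  assumes \<phi>: "\<phi> \<in> test_functions \<Omega>"
  shows "(\<integral>\<^sup>+x. ennreal (\<bar>\<phi> x\<bar> ^ 6) \<partial>lebesgue_on \<Omega>) \<le> ennreal (K * l2_norm \<Omega> (classical_gradient \<phi>) ^ 6)"
proof -
  note C = test_function_C1_compact[OF \<phi>]
  let ?g = "\<lambda>x. (norm (classical_gradient \<phi> x))\<^sup>2"
  have m: "(\<lambda>x. ennreal (\<bar>\<phi> x\<bar> ^ 6)) \<in> borel_measurable borel"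
    using test_function_measurable[OF \<phi>] by measurable
  have gm: "?g \<in> borel_measurable borel"
    by (intro borel_measurable_continuous_onI continuous_on_power continuous_on_norm
        classical_gradient_continuous C)
  have g0: "?g x = 0" if "x \<notin> \<Omega>" for x
    using test_function_outside(2)[OF \<phi> that] by (simp add: classical_gradient_def)
  have "(\<integral>\<^sup>+x. ennreal (\<bar>\<phi> x\<bar> ^ 6) \<partial>lebesgue_on \<Omega>) \<le> (\<integral>\<^sup>+x. ennreal (\<bar>\<phi> x\<bar> ^ 6) \<partial>lebesgue)"
    by (subst nn_integral_restrict_space) (auto intro!: nn_integral_mono simp: indicator_def)
  also have "\<dots> = (\<integral>\<^sup>+x. ennreal (\<bar>\<phi> x\<bar> ^ 6) \<partial>lborel)"
    by (rule nn_integral_completion)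
  also have "\<dots> \<le> ennreal K * (\<integral>\<^sup>+x. ennreal (?g x) \<partial>lborel) ^ 3"
    by (rule Sobolev_test[OF \<phi>])
  also have "(\<integral>\<^sup>+x. ennreal (?g x) \<partial>lborel) = ennreal (LINT x|lborel. ?g x)"
    using L2_integrable_sq[OF classical_gradient_L2[OF \<phi>]]
      integrable_lebesgue_on_iff_lborel[OF open_domain gm g0]
    by (intro nn_integral_eq_integral) auto
  also have "(LINT x|lborel. ?g x) = (l2_norm \<Omega> (classical_gradient \<phi>))\<^sup>2"
    using integral_lebesgue_on_eq_lborel[OF open_domain gm g0] by (simp add: l2_norm_sq)
  also have "ennreal K * ennreal ((l2_norm \<Omega> (classical_gradient \<phi>))\<^sup>2) ^ 3
      = ennreal (K * l2_norm \<Omega> (classical_gradient \<phi>) ^ 6)"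
    using K_pos by (simp add: ennreal_mult ennreal_power flip: power_mult)
  finally show ?thesis .
qed

text \<open>
  Fatou's lemma along an almost everywhere convergent subsequence of approximating test functions
\<close>

lemma H10_Sobolev_nn:
  assumes u: "u \<in> H10 \<Omega>"
  shows "(\<integral>\<^sup>+x. ennreal (\<bar>u x\<bar> ^ 6) \<partial>lebesgue_on \<Omega>) \<le> ennreal (K * l2_norm \<Omega> (weak_gradient \<Omega> u) ^ 6)"
proof -
  obtain \<phi> where \<phi>: "\<And>k. \<phi> k \<in> test_functions \<Omega>"
    "(\<lambda>k. l2_norm \<Omega> (\<lambda>x. u x - \<phi> k x)) \<longlonglongrightarrow> 0"
    "(\<lambda>k. l2_norm \<Omega> (\<lambda>x. weak_gradient \<Omega> u x - classical_gradient (\<phi> k) x)) \<longlonglongrightarrow> 0"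
    using u unfolding H10_iff by blast
  have L: "u \<in> L2 \<Omega>" "\<And>k. \<phi> k \<in> L2 \<Omega>"
    using H1_L2[OF H10_H1[OF u]] test_function_L2(1)[OF \<phi>(1)] by auto
  obtain s :: "nat \<Rightarrow> nat" where s: "strict_mono s"
    "AE x in lebesgue_on \<Omega>. (\<lambda>k. \<phi> (s k) x) \<longlonglongrightarrow> u x"
    using l2_convergence_AE_subseq[OF L(2,1) \<phi>(2)] by blast
  let ?b = "\<lambda>k. K * l2_norm \<Omega> (classical_gradient (\<phi> (s k))) ^ 6"
  have "(\<lambda>k. l2_norm \<Omega> (classical_gradient (\<phi> k))) \<longlonglongrightarrow> l2_norm \<Omega> (weak_gradient \<Omega> u)"
    by (intro l2_norm_tendsto \<phi> classical_gradient_L2 weak_gradient_L2 H10_H1 u)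
  then have "(\<lambda>k. l2_norm \<Omega> (classical_gradient (\<phi> (s k)))) \<longlonglongrightarrow> l2_norm \<Omega> (weak_gradient \<Omega> u)"
    using LIMSEQ_subseq_LIMSEQ[OF _ s(1)] by (auto simp: comp_def)
  then have lim: "(\<lambda>k. ennreal (?b k)) \<longlonglongrightarrow> ennreal (K * l2_norm \<Omega> (weak_gradient \<Omega> u) ^ 6)"
    by (intro tendsto_ennrealI tendsto_intros)
  have "(\<integral>\<^sup>+x. ennreal (\<bar>u x\<bar> ^ 6) \<partial>lebesgue_on \<Omega>)
      \<le> (\<integral>\<^sup>+x. liminf (\<lambda>k. ennreal (\<bar>\<phi> (s k) x\<bar> ^ 6)) \<partial>lebesgue_on \<Omega>)"
  proof (rule nn_integral_mono_AE)
    show "AE x in lebesgue_on \<Omega>. ennreal (\<bar>u x\<bar> ^ 6) \<le> liminf (\<lambda>k. ennreal (\<bar>\<phi> (s k) x\<bar> ^ 6))"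
      using s(2)
    proof eventually_elim
      case (elim x)
      then have "(\<lambda>k. ennreal (\<bar>\<phi> (s k) x\<bar> ^ 6)) \<longlonglongrightarrow> ennreal (\<bar>u x\<bar> ^ 6)"
        by (intro tendsto_ennrealI tendsto_intros)
      then show ?case
        using lim_imp_Liminf[OF trivial_limit_sequentially] by fastforce
    qed
  qed
  also have "\<dots> \<le> liminf (\<lambda>k. \<integral>\<^sup>+x. ennreal (\<bar>\<phi> (s k) x\<bar> ^ 6) \<partial>lebesgue_on \<Omega>)"
  proof (rule nn_integral_liminf)
    show "(\<lambda>x. ennreal (\<bar>\<phi> (s k) x\<bar> ^ 6)) \<in> borel_measurable (lebesgue_on \<Omega>)" for k
      using L2_measurable[OF L(2)[of "s k"]] by measurable
  qed
  also have "\<dots> \<le> liminf (\<lambda>k. ennreal (?b k))"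
    by (intro Liminf_mono always_eventually allI Sobolev_test_domain \<phi>)
  also have "\<dots> = ennreal (K * l2_norm \<Omega> (weak_gradient \<Omega> u) ^ 6)"
    by (rule lim_imp_Liminf[OF trivial_limit_sequentially lim])
  finally show ?thesis .
qed

lemma
  assumes u: "u \<in> H10 \<Omega>"
  shows H10_integrable_power6: "integrable (lebesgue_on \<Omega>) (\<lambda>x. u x ^ 6)"
    and H10_Sobolev: "(LINT x|lebesgue_on \<Omega>. u x ^ 6) \<le> K * l2_norm \<Omega> (weak_gradient \<Omega> u) ^ 6"
proof -
  have m: "(\<lambda>x. u x ^ 6) \<in> borel_measurable (lebesgue_on \<Omega>)"
    using L2_measurable[OF H1_L2[OF H10_H1[OF u]]] by measurable
  have nn: "(\<integral>\<^sup>+x. ennreal (u x ^ 6) \<partial>lebesgue_on \<Omega>) \<le> ennreal (K * l2_norm \<Omega> (weak_gradient \<Omega> u) ^ 6)"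
    using H10_Sobolev_nn[OF u] by simp
  show i: "integrable (lebesgue_on \<Omega>) (\<lambda>x. u x ^ 6)"
    using m nn by (intro integrableI_nonneg) (auto intro: le_less_trans)
  then show "(LINT x|lebesgue_on \<Omega>. u x ^ 6) \<le> K * l2_norm \<Omega> (weak_gradient \<Omega> u) ^ 6"
    using nn K_pos by (simp add: nn_integral_eq_integral)
qed

lemma H10_gradient_zero:
  assumes u: "u \<in> H10 \<Omega>" and "l2_norm \<Omega> (weak_gradient \<Omega> u) = 0"
  shows "AE x in lebesgue_on \<Omega>. u x = 0"
proof -
  have "(LINT x|lebesgue_on \<Omega>. u x ^ 6) = 0"
    using H10_Sobolev[OF u] assms(2) by (intro antisym integral_nonneg_AE) auto
  then show ?thesis
    using integral_nonneg_eq_0_iff_AE[OF H10_integrable_power6[OF u]] by simp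
qed

text \<open>
  Integrate \<open>t \<le> 1 + t\<^sup>3\<close> with \<open>t = (u / \<parallel>\<nabla>u\<parallel>)\<^sup>2\<close>, and apply the \<open>L\<^sup>6\<close> bound to the cubic term.
\<close>

lemma H10_Poincare:
  assumes u: "u \<in> H10 \<Omega>"
  shows "(l2_norm \<Omega> u)\<^sup>2 \<le> (measure lebesgue \<Omega> + K) * (l2_norm \<Omega> (weak_gradient \<Omega> u))\<^sup>2"
proof (cases "l2_norm \<Omega> (weak_gradient \<Omega> u) = 0")
  case True
  then have "l2_norm \<Omega> u = 0"
    using H10_gradient_zero[OF u] l2_norm_eq_0_iff[OF H1_L2[OF H10_H1[OF u]]] by simp
  then show ?thesis by (simp add: True)
next
  case False
  let ?a = "l2_norm \<Omega> (weak_gradient \<Omega> u)"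
  have a: "?a > 0" using False l2_norm_nonneg[of \<Omega> "weak_gradient \<Omega> u"] by linarith
  have pw: "(u x)\<^sup>2 \<le> ?a\<^sup>2 * 1 + u x ^ 6 / ?a ^ 4" for x
  proof -
    have "t \<le> 1 + t ^ 3" if "t \<ge> 0" for t :: real
    proof (cases "t \<le> 1")
      case True
      then show ?thesis using that by (simp add: add_increasing2)
    next
      case False
      then show ?thesis using power_increasing[of 1 3 t] by simp
    qed
    from this[of "(u x)\<^sup>2 / ?a\<^sup>2"] have "(u x)\<^sup>2 / ?a\<^sup>2 \<le> 1 + ((u x)\<^sup>2 / ?a\<^sup>2) ^ 3" by simp
    then have "?a\<^sup>2 * ((u x)\<^sup>2 / ?a\<^sup>2) \<le> ?a\<^sup>2 * (1 + ((u x)\<^sup>2 / ?a\<^sup>2) ^ 3)"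
      by (intro mult_left_mono) auto
    moreover have "?a\<^sup>2 * ((u x)\<^sup>2 / ?a\<^sup>2) = (u x)\<^sup>2"
      using a by simp
    moreover have "?a\<^sup>2 * ((u x)\<^sup>2 / ?a\<^sup>2) ^ 3 = u x ^ 6 / ?a ^ 4"
    proof -
      have "c * (t / c) ^ 3 = t ^ 3 / c\<^sup>2" if "c > 0" for c t :: real
        using that by (simp add: power_divide power2_eq_square power3_eq_cube)
      from this[of "?a\<^sup>2" "(u x)\<^sup>2"] show ?thesis
        using a by (simp flip: power_mult)
    qed
    ultimately show ?thesis
      by (simp only: distrib_left)
  qed
  have "(l2_norm \<Omega> u)\<^sup>2 \<le> (LINT x|lebesgue_on \<Omega>. ?a\<^sup>2 * 1 + u x ^ 6 / ?a ^ 4)"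
    unfolding l2_norm_sq[of \<Omega> u]
    by (intro integral_mono L2_integrable_sq H1_L2 H10_H1 u Bochner_Integration.integrable_add
        integrable_mult_right integrable_one integrable_divide H10_integrable_power6) (simp add: pw[simplified])
  also have "\<dots> = (LINT x|lebesgue_on \<Omega>. ?a\<^sup>2 * 1) + (LINT x|lebesgue_on \<Omega>. u x ^ 6 / ?a ^ 4)"
    by (intro Bochner_Integration.integral_add integrable_mult_right integrable_one integrable_divide
        H10_integrable_power6 u)
  also have "(LINT x|lebesgue_on \<Omega>. ?a\<^sup>2 * 1) = ?a\<^sup>2 * (LINT x|lebesgue_on \<Omega>. 1)"
    by (rule integral_mult_right_zero)
  also have "(LINT x|lebesgue_on \<Omega>. u x ^ 6 / ?a ^ 4) = (LINT x|lebesgue_on \<Omega>. u x ^ 6) / ?a ^ 4"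
    by (rule integral_divide_zero)
  also have "(LINT x|lebesgue_on \<Omega>. (1::real)) = measure lebesgue \<Omega>"
    by (simp add: measure_restrict_space)
  also have "(LINT x|lebesgue_on \<Omega>. u x ^ 6) / ?a ^ 4 \<le> K * ?a ^ 6 / ?a ^ 4"
    using H10_Sobolev[OF u] by (intro divide_right_mono) auto
  also have "K * ?a ^ 6 / ?a ^ 4 = K * ?a\<^sup>2"
    using a by (simp add: field_simps eval_nat_numeral)
  finally show ?thesis
    by (simp add: algebra_simps)
qed

text \<open>
  A substitute for Hoelder's inequality: \<open>p q\<^sup>2 \<le> p\<^sup>3 + q\<^sup>3\<close> with \<open>p = (u / \<parallel>\<nabla>u\<parallel>)\<^sup>2\<close> and \<open>q = (w / \<parallel>\<nabla>w\<parallel>)\<^sup>2\<close>.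
  After this normalisation the integrals of \<open>p\<^sup>3\<close> and \<open>q\<^sup>3\<close> are at most \<open>K\<close> each.
\<close>

lemma H10_mult_square_L2:
  assumes u: "u \<in> H10 \<Omega>" and w: "w \<in> H10 \<Omega>"
  shows "(\<lambda>x. u x * (w x)\<^sup>2) \<in> L2 \<Omega>"
    and "(l2_norm \<Omega> (\<lambda>x. u x * (w x)\<^sup>2))\<^sup>2
      \<le> 2 * K * (l2_norm \<Omega> (weak_gradient \<Omega> u))\<^sup>2 * l2_norm \<Omega> (weak_gradient \<Omega> w) ^ 4"
proof -
  let ?a = "l2_norm \<Omega> (weak_gradient \<Omega> u)" and ?b = "l2_norm \<Omega> (weak_gradient \<Omega> w)"
  note m = L2_measurable[OF H1_L2[OF H10_H1[OF u]]] L2_measurable[OF H1_L2[OF H10_H1[OF w]]]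
  note i = H10_integrable_power6[OF u] H10_integrable_power6[OF w]
  have m': "(\<lambda>x. u x * (w x)\<^sup>2) \<in> borel_measurable (lebesgue_on \<Omega>)"
    using m by measurable
  have young: "p * q\<^sup>2 \<le> p ^ 3 + q ^ 3" if "p \<ge> 0" "q \<ge> 0" for p q :: real
  proof (cases "p \<le> q")
    case True
    then have "p * q\<^sup>2 \<le> q * q\<^sup>2" by (intro mult_right_mono) auto
    then show ?thesis using that(1) by (simp add: power2_eq_square power3_eq_cube add_increasing)
  next
    case False
    then have "p * q\<^sup>2 \<le> p * p\<^sup>2" using that by (intro mult_left_mono power_mono) auto
    then show ?thesis using that(2) by (simp add: power2_eq_square power3_eq_cube add_increasing2)
  qed
  have sq: "(norm (u x * (w x)\<^sup>2))\<^sup>2 = (u x)\<^sup>2 * ((w x)\<^sup>2)\<^sup>2" for x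
    by (simp add: power_mult_distrib)
  show L: "(\<lambda>x. u x * (w x)\<^sup>2) \<in> L2 \<Omega>"
    unfolding L2_def mem_Collect_eq
  proof (intro conjI m')
    show "integrable (lebesgue_on \<Omega>) (\<lambda>x. (norm (u x * (w x)\<^sup>2))\<^sup>2)"
    proof (rule Bochner_Integration.integrable_bound)
      show "integrable (lebesgue_on \<Omega>) (\<lambda>x. u x ^ 6 + w x ^ 6)" using i by simp
      show "(\<lambda>x. (norm (u x * (w x)\<^sup>2))\<^sup>2) \<in> borel_measurable (lebesgue_on \<Omega>)"
        using m' by measurable
      show "AE x in lebesgue_on \<Omega>. norm ((norm (u x * (w x)\<^sup>2))\<^sup>2) \<le> norm (u x ^ 6 + w x ^ 6)"
      proof (intro AE_I2)
        fix x
        have "(norm (u x * (w x)\<^sup>2))\<^sup>2 \<le> u x ^ 6 + w x ^ 6"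
          using young[of "(u x)\<^sup>2" "(w x)\<^sup>2"] unfolding sq by (simp flip: power_mult)
        then show "norm ((norm (u x * (w x)\<^sup>2))\<^sup>2) \<le> norm (u x ^ 6 + w x ^ 6)"
          by simp
      qed
    qed
  qed
  show "(l2_norm \<Omega> (\<lambda>x. u x * (w x)\<^sup>2))\<^sup>2 \<le> 2 * K * ?a\<^sup>2 * ?b ^ 4"
  proof (cases "?a = 0 \<or> ?b = 0")
    case True
    then have "AE x in lebesgue_on \<Omega>. u x * (w x)\<^sup>2 = 0"
      using H10_gradient_zero[OF u] H10_gradient_zero[OF w] by auto
    then have "l2_norm \<Omega> (\<lambda>x. u x * (w x)\<^sup>2) = 0"
      using l2_norm_eq_0_iff[OF L] by simp
    then show ?thesis using K_pos by simp
  next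
    case False
    then have pos: "?a > 0" "?b > 0"
      using l2_norm_nonneg[of \<Omega> "weak_gradient \<Omega> u"] l2_norm_nonneg[of \<Omega> "weak_gradient \<Omega> w"] by linarith+
    have pw: "(norm (u x * (w x)\<^sup>2))\<^sup>2 \<le> ?a\<^sup>2 * ?b ^ 4 * (u x ^ 6 / ?a ^ 6 + w x ^ 6 / ?b ^ 6)" for x
    proof -
      have "((u x)\<^sup>2 / ?a\<^sup>2) * ((w x)\<^sup>2 / ?b\<^sup>2)\<^sup>2 \<le> ((u x)\<^sup>2 / ?a\<^sup>2) ^ 3 + ((w x)\<^sup>2 / ?b\<^sup>2) ^ 3"
        by (intro young) auto
      then have "?a\<^sup>2 * ?b ^ 4 * (((u x)\<^sup>2 / ?a\<^sup>2) * ((w x)\<^sup>2 / ?b\<^sup>2)\<^sup>2)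
          \<le> ?a\<^sup>2 * ?b ^ 4 * (((u x)\<^sup>2 / ?a\<^sup>2) ^ 3 + ((w x)\<^sup>2 / ?b\<^sup>2) ^ 3)"
        by (intro mult_left_mono) auto
      moreover have "?a\<^sup>2 * ?b ^ 4 * (((u x)\<^sup>2 / ?a\<^sup>2) * ((w x)\<^sup>2 / ?b\<^sup>2)\<^sup>2) = (norm (u x * (w x)\<^sup>2))\<^sup>2"
        using pos by (simp add: power_divide power_mult_distrib flip: power_mult)
      ultimately show ?thesis
        by (simp add: power_divide flip: power_mult)
    qed
    have "(l2_norm \<Omega> (\<lambda>x. u x * (w x)\<^sup>2))\<^sup>2
        \<le> (LINT x|lebesgue_on \<Omega>. ?a\<^sup>2 * ?b ^ 4 * (u x ^ 6 / ?a ^ 6 + w x ^ 6 / ?b ^ 6))"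
      unfolding l2_norm_sq[of \<Omega> "\<lambda>x. u x * (w x)\<^sup>2"]
      by (intro integral_mono L2_integrable_sq L pw) (use i in simp)
    also have "\<dots> = ?a\<^sup>2 * ?b ^ 4 * ((LINT x|lebesgue_on \<Omega>. u x ^ 6) / ?a ^ 6 + (LINT x|lebesgue_on \<Omega>. w x ^ 6) / ?b ^ 6)"
      using i by simp
    also have "\<dots> \<le> ?a\<^sup>2 * ?b ^ 4 * (K + K)"
      using H10_Sobolev[OF u] H10_Sobolev[OF w] pos
      by (intro mult_left_mono add_mono) (auto simp: field_simps)
    finally show ?thesis by (simp add: algebra_simps)
  qed
qed

text \<open>
  Writing \<open>u\<^sup>2w\<^sup>2 = u \<cdot> u w\<^sup>2\<close> leaves one factor \<open>u\<close> without derivative. This is the origin of the powers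
  \<open>1/2\<close> in the trilinear bound.
\<close>

lemma
  assumes u: "u \<in> H10 \<Omega>" and w: "w \<in> H10 \<Omega>"
  shows H10_mult_integrable: "integrable (lebesgue_on \<Omega>) (\<lambda>x. (u x)\<^sup>2 * (w x)\<^sup>2)"
    and H10_mult_bound: "(LINT x|lebesgue_on \<Omega>. (u x)\<^sup>2 * (w x)\<^sup>2)
      \<le> sqrt (2 * K) * l2_norm \<Omega> u * l2_norm \<Omega> (weak_gradient \<Omega> u) * (l2_norm \<Omega> (weak_gradient \<Omega> w))\<^sup>2"
proof -
  let ?a = "l2_norm \<Omega> (weak_gradient \<Omega> u)" and ?b = "l2_norm \<Omega> (weak_gradient \<Omega> w)"
  note L = H1_L2[OF H10_H1[OF u]]
  note M = H10_mult_square_L2[OF u w]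
  have eq: "(u x)\<^sup>2 * (w x)\<^sup>2 = u x * (u x * (w x)\<^sup>2)" for x
    by (simp add: power2_eq_square)
  show "integrable (lebesgue_on \<Omega>) (\<lambda>x. (u x)\<^sup>2 * (w x)\<^sup>2)"
    unfolding eq by (rule L2_integrable_mult[OF L M(1)])
  have "l2_norm \<Omega> (\<lambda>x. u x * (w x)\<^sup>2) \<le> sqrt (2 * K) * ?a * ?b\<^sup>2"
  proof (rule power2_le_imp_le)
    show "(l2_norm \<Omega> (\<lambda>x. u x * (w x)\<^sup>2))\<^sup>2 \<le> (sqrt (2 * K) * ?a * ?b\<^sup>2)\<^sup>2"
      using M(2) K_pos by (simp add: power_mult_distrib flip: power_mult)
  qed (use K_pos in simp)
  then have "l2_norm \<Omega> u * l2_norm \<Omega> (\<lambda>x. u x * (w x)\<^sup>2) \<le> l2_norm \<Omega> u * (sqrt (2 * K) * ?a * ?b\<^sup>2)"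
    by (intro mult_left_mono) auto
  moreover have "(LINT x|lebesgue_on \<Omega>. (u x)\<^sup>2 * (w x)\<^sup>2) \<le> l2_norm \<Omega> u * l2_norm \<Omega> (\<lambda>x. u x * (w x)\<^sup>2)"
    using l2_Cauchy_Schwarz[OF L M(1)] unfolding eq by (simp add: l2_inner_def)
  ultimately show "(LINT x|lebesgue_on \<Omega>. (u x)\<^sup>2 * (w x)\<^sup>2)
      \<le> sqrt (2 * K) * l2_norm \<Omega> u * ?a * ?b\<^sup>2"
    by (simp add: mult_ac)
qed

end


section \<open>Vector fields\<close>

lemma norm_sq_cart: "(norm v)\<^sup>2 = (\<Sum>i\<in>UNIV. (norm (v $ i))\<^sup>2)"
  for v :: "'a::real_normed_vector ^ 'k"
  by (simp add: norm_vec_def L2_set_def sum_nonneg)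

lemma norm_matrix_vector_le:
  fixes A :: "real^'n^'m"
  shows "norm (A *v x) \<le> norm A * norm x"
proof (rule power2_le_imp_le)
  have "(norm (A *v x))\<^sup>2 = (\<Sum>i\<in>UNIV. (A $ i \<bullet> x)\<^sup>2)"
    by (simp add: norm_sq_cart matrix_vector_mul_component)
  also have "\<dots> \<le> (\<Sum>i\<in>UNIV. (norm (A $ i))\<^sup>2 * (norm x)\<^sup>2)"
    by (intro sum_mono) (metis Cauchy_Schwarz_ineq power2_norm_eq_inner)
  also have "\<dots> = (norm A * norm x)\<^sup>2"
    by (simp add: norm_sq_cart[of A] power_mult_distrib sum_distrib_right)
  finally show "(norm (A *v x))\<^sup>2 \<le> (norm A * norm x)\<^sup>2" .
qed simp

lemma L2_cartI:
  fixes g :: "'a::euclidean_space \<Rightarrow> 'b::euclidean_space ^ 'k"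
  assumes "\<And>i. (\<lambda>x. g x $ i) \<in> L2 \<Omega>"
  shows "g \<in> L2 \<Omega>"
proof (rule L2_componentI)
  fix b :: "'b ^ 'k" assume "b \<in> Basis"
  then obtain i c where "b = axis i c" by (auto simp: Basis_vec_def)
  then show "(\<lambda>x. g x \<bullet> b) \<in> L2 \<Omega>"
    using L2_component[OF assms] by (simp add: inner_axis)
qed

lemma L2_cartD:
  fixes g :: "'a::euclidean_space \<Rightarrow> real ^ 'k"
  shows "g \<in> L2 \<Omega> \<Longrightarrow> (\<lambda>x. g x $ i) \<in> L2 \<Omega>"
  using L2_component[of g \<Omega> "axis i 1"] by (simp add: inner_axis)

lemma l2_norm_cart_sq:
  fixes g :: "'a::euclidean_space \<Rightarrow> 'b::euclidean_space ^ 'k"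
  assumes "\<And>i. (\<lambda>x. g x $ i) \<in> L2 \<Omega>"
  shows "(l2_norm \<Omega> g)\<^sup>2 = (\<Sum>i\<in>UNIV. (l2_norm \<Omega> (\<lambda>x. g x $ i))\<^sup>2)"
  unfolding l2_norm_sq norm_sq_cart
  by (intro Bochner_Integration.integral_sum L2_integrable_sq assms)

lemma l2_norm_cart_le:
  fixes g :: "'a::euclidean_space \<Rightarrow> 'b::euclidean_space ^ 'k"
  assumes "\<And>i. (\<lambda>x. g x $ i) \<in> L2 \<Omega>"
  shows "l2_norm \<Omega> (\<lambda>x. g x $ i) \<le> l2_norm \<Omega> g"
proof (rule power2_le_imp_le)
  show "(l2_norm \<Omega> (\<lambda>x. g x $ i))\<^sup>2 \<le> (l2_norm \<Omega> g)\<^sup>2"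
    unfolding l2_norm_cart_sq[OF assms] by (rule member_le_sum) auto
qed simp

context Sobolev_domain
begin

lemma X_component: "v \<in> X_space \<Omega> \<Longrightarrow> (\<lambda>x. v x $ i) \<in> H10 \<Omega>"
  by (simp add: X_space_def)

lemma X_component_H1: "v \<in> X_space \<Omega> \<Longrightarrow> (\<lambda>x. v x $ i) \<in> H1 \<Omega>"
  using X_component H10_H1 by blast

lemma X_component_L2: "v \<in> X_space \<Omega> \<Longrightarrow> (\<lambda>x. v x $ i) \<in> L2 \<Omega>"
  using X_component_H1 H1_L2 by blast

lemma X_L2: "v \<in> X_space \<Omega> \<Longrightarrow> v \<in> L2 \<Omega>"
  by (intro L2_cartI X_component_L2)

lemma grad_nth: "grad \<Omega> v x $ i = weak_gradient \<Omega> (\<lambda>y. v y $ i) x"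
  by (simp add: grad_def)

lemma grad_row_L2: "v \<in> X_space \<Omega> \<Longrightarrow> (\<lambda>x. grad \<Omega> v x $ i) \<in> L2 \<Omega>"
  unfolding grad_nth by (intro weak_gradient_L2 X_component_H1)

lemma grad_L2: "v \<in> X_space \<Omega> \<Longrightarrow> grad \<Omega> v \<in> L2 \<Omega>"
  by (intro L2_cartI grad_row_L2)

lemma h1_semi_nonneg [simp]: "h1_semi \<Omega> v \<ge> 0"
  by (simp add: h1_semi_def)

lemma h1_semi_sq:
  assumes "v \<in> X_space \<Omega>"
  shows "(h1_semi \<Omega> v)\<^sup>2 = (\<Sum>i\<in>UNIV. (l2_norm \<Omega> (weak_gradient \<Omega> (\<lambda>y. v y $ i)))\<^sup>2)"
  unfolding h1_semi_def l2_norm_cart_sq[OF grad_row_L2[OF assms]] by (simp add: grad_nth)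

lemma weak_gradient_le_h1_semi:
  "v \<in> X_space \<Omega> \<Longrightarrow> l2_norm \<Omega> (weak_gradient \<Omega> (\<lambda>y. v y $ i)) \<le> h1_semi \<Omega> v"
  using l2_norm_cart_le[OF grad_row_L2, of v i] by (simp add: h1_semi_def grad_nth)

lemma X_add: "u \<in> X_space \<Omega> \<Longrightarrow> v \<in> X_space \<Omega> \<Longrightarrow> (\<lambda>x. u x + v x) \<in> X_space \<Omega>"
  by (simp add: X_space_def H10_add)

lemma X_scaleR: "v \<in> X_space \<Omega> \<Longrightarrow> (\<lambda>x. c *\<^sub>R v x) \<in> X_space \<Omega>"
  by (simp add: X_space_def H10_scaleR)

lemma X_diff: "u \<in> X_space \<Omega> \<Longrightarrow> v \<in> X_space \<Omega> \<Longrightarrow> (\<lambda>x. u x - v x) \<in> X_space \<Omega>"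
  using X_add[OF _ X_scaleR[of v "- 1"], of u] by simp

lemma X_cong_AE:
  assumes "u \<in> X_space \<Omega>" "AE x in lebesgue_on \<Omega>. u x = v x"
  shows "v \<in> X_space \<Omega>"
proof -
  have "(\<lambda>x. v x $ i) \<in> H10 \<Omega>" for i
  proof (rule H10_cong_AE[OF X_component[OF assms(1)]])
    show "AE x in lebesgue_on \<Omega>. u x $ i = v x $ i"
      using assms(2) by eventually_elim simp
  qed
  then show ?thesis by (simp add: X_space_def)
qed

lemma grad_add:
  assumes "u \<in> X_space \<Omega>" "v \<in> X_space \<Omega>"
  shows "AE x in lebesgue_on \<Omega>. grad \<Omega> (\<lambda>x. u x + v x) x = grad \<Omega> u x + grad \<Omega> v x"
proof -
  have "AE x in lebesgue_on \<Omega>. \<forall>i\<in>UNIV. grad \<Omega> (\<lambda>x. u x + v x) x $ i = grad \<Omega> u x $ i + grad \<Omega> v x $ i"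
    using weak_gradient_add[OF X_component_H1[OF assms(1)] X_component_H1[OF assms(2)]]
    by (subst AE_ball_countable) (auto simp: grad_nth)
  then show ?thesis
    by eventually_elim (simp add: vec_eq_iff)
qed

lemma grad_scaleR:
  assumes "v \<in> X_space \<Omega>"
  shows "AE x in lebesgue_on \<Omega>. grad \<Omega> (\<lambda>x. c *\<^sub>R v x) x = c *\<^sub>R grad \<Omega> v x"
proof -
  have "AE x in lebesgue_on \<Omega>. \<forall>i\<in>UNIV. grad \<Omega> (\<lambda>x. c *\<^sub>R v x) x $ i = c *\<^sub>R grad \<Omega> v x $ i"
    using weak_gradient_scaleR[OF X_component_H1[OF assms], of c]
    by (subst AE_ball_countable) (auto simp: grad_nth)
  then show ?thesis
    by eventually_elim (simp add: vec_eq_iff)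
qed

lemma grad_diff:
  assumes u: "u \<in> X_space \<Omega>" and v: "v \<in> X_space \<Omega>"
  shows "AE x in lebesgue_on \<Omega>. grad \<Omega> (\<lambda>x. u x - v x) x = grad \<Omega> u x - grad \<Omega> v x"
  using grad_add[OF u X_scaleR[OF v, of "- 1"]] grad_scaleR[OF v, of "- 1"]
  by eventually_elim simp

lemma grad_cong_AE:
  assumes u: "u \<in> X_space \<Omega>" and ae: "AE x in lebesgue_on \<Omega>. u x = v x"
  shows "AE x in lebesgue_on \<Omega>. grad \<Omega> u x = grad \<Omega> v x"
proof -
  have "AE x in lebesgue_on \<Omega>. grad \<Omega> u x $ i = grad \<Omega> v x $ i" for i
    unfolding grad_nth
  proof (rule weak_gradient_cong_AE[OF X_component_H1[OF u]])
    show "AE x in lebesgue_on \<Omega>. u x $ i = v x $ i"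
      using ae by eventually_elim simp
  qed
  then have "AE x in lebesgue_on \<Omega>. \<forall>i\<in>UNIV. grad \<Omega> u x $ i = grad \<Omega> v x $ i"
    by (subst AE_ball_countable) auto
  then show ?thesis
    by eventually_elim (simp add: vec_eq_iff)
qed

lemma h1_semi_triangle_diff:
  assumes u: "u \<in> X_space \<Omega>" and v: "v \<in> X_space \<Omega>"
  shows "h1_semi \<Omega> (\<lambda>x. u x - v x) \<le> h1_semi \<Omega> u + h1_semi \<Omega> v"
proof -
  have "h1_semi \<Omega> (\<lambda>x. u x - v x) = l2_norm \<Omega> (\<lambda>x. grad \<Omega> u x - grad \<Omega> v x)"
    unfolding h1_semi_def
    by (intro l2_norm_cong_AE grad_diff L2_measurable L2_diff grad_L2 X_diff u v)
  also have "\<dots> \<le> h1_semi \<Omega> u + h1_semi \<Omega> v"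
    unfolding h1_semi_def by (intro l2_norm_triangle_diff grad_L2 u v)
  finally show ?thesis .
qed

lemma h1_semi_zero_AE:
  assumes "AE x in lebesgue_on \<Omega>. v x = 0" and v: "v \<in> X_space \<Omega>"
  shows "h1_semi \<Omega> v = 0"
proof -
  have z: "AE x in lebesgue_on \<Omega>. v x = 0 *\<^sub>R v x"
    using assms(1) by eventually_elim simp
  have "AE x in lebesgue_on \<Omega>. grad \<Omega> v x = 0"
    using grad_cong_AE[OF v z] grad_scaleR[OF v, of 0] by eventually_elim simp
  then show ?thesis
    unfolding h1_semi_def using l2_norm_eq_0_iff[OF grad_L2[OF v]] by simp
qed

lemma X_Poincare:
  assumes v: "v \<in> X_space \<Omega>"
  shows "l2_norm \<Omega> v \<le> sqrt (measure lebesgue \<Omega> + K) * h1_semi \<Omega> v"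
proof (rule power2_le_imp_le)
  have "(l2_norm \<Omega> v)\<^sup>2 = (\<Sum>i\<in>UNIV. (l2_norm \<Omega> (\<lambda>x. v x $ i))\<^sup>2)"
    by (rule l2_norm_cart_sq[OF X_component_L2[OF v]])
  also have "\<dots> \<le> (\<Sum>i\<in>UNIV. (measure lebesgue \<Omega> + K) * (l2_norm \<Omega> (weak_gradient \<Omega> (\<lambda>x. v x $ i)))\<^sup>2)"
    by (intro sum_mono H10_Poincare X_component v)
  also have "\<dots> = (sqrt (measure lebesgue \<Omega> + K) * h1_semi \<Omega> v)\<^sup>2"
    using K_pos by (simp add: power_mult_distrib h1_semi_sq[OF v] sum_distrib_left add_nonneg_nonneg)
  finally show "(l2_norm \<Omega> v)\<^sup>2 \<le> (sqrt (measure lebesgue \<Omega> + K) * h1_semi \<Omega> v)\<^sup>2" .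
qed (use K_pos in simp)

section \<open>The convective form\<close>

definition trilinear_const :: real where
  "trilinear_const = sqrt (real CARD('n) * sqrt (2 * K))"

lemma trilinear_const_pos: "trilinear_const > 0"
  using K_pos by (simp add: trilinear_const_def)

lemma
  assumes u: "u \<in> X_space \<Omega>" and w: "w \<in> X_space \<Omega>"
  shows X_mult_L2: "(\<lambda>x. norm (u x) * norm (w x)) \<in> L2 \<Omega>"
    and X_mult_bound: "l2_norm \<Omega> (\<lambda>x. norm (u x) * norm (w x))
      \<le> trilinear_const * sqrt (l2_norm \<Omega> u * h1_semi \<Omega> u) * h1_semi \<Omega> w"
proof -
  let ?T = "\<lambda>x. norm (u x) * norm (w x)"
  let ?g = "\<lambda>v i. l2_norm \<Omega> (weak_gradient \<Omega> (\<lambda>x. v x $ i))"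
  have T: "(norm (?T x))\<^sup>2 = (\<Sum>i\<in>UNIV. \<Sum>j\<in>UNIV. (u x $ i)\<^sup>2 * (w x $ j)\<^sup>2)" for x
    by (simp add: power_mult_distrib norm_sq_cart sum_product)
  have i: "integrable (lebesgue_on \<Omega>) (\<lambda>x. (u x $ i)\<^sup>2 * (w x $ j)\<^sup>2)" for i j
    by (intro H10_mult_integrable X_component u w)
  show "?T \<in> L2 \<Omega>"
    unfolding L2_def mem_Collect_eq T
    by (intro conjI borel_measurable_times L2_measurable[OF L2_norm[OF X_L2[OF u]]]
        L2_measurable[OF L2_norm[OF X_L2[OF w]]] Bochner_Integration.integrable_sum i)
  have "(l2_norm \<Omega> ?T)\<^sup>2 = (\<Sum>i\<in>UNIV. \<Sum>j\<in>UNIV. LINT x|lebesgue_on \<Omega>. (u x $ i)\<^sup>2 * (w x $ j)\<^sup>2)"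
    unfolding l2_norm_sq T
    by (subst Bochner_Integration.integral_sum; intro Bochner_Integration.integrable_sum i sum.cong
        Bochner_Integration.integral_sum refl)
  also have "\<dots> \<le> (\<Sum>i\<in>(UNIV::'n set). \<Sum>j\<in>UNIV. sqrt (2 * K) * (l2_norm \<Omega> u * h1_semi \<Omega> u) * (?g w j)\<^sup>2)"
  proof (intro sum_mono)
    fix i j
    have "(LINT x|lebesgue_on \<Omega>. (u x $ i)\<^sup>2 * (w x $ j)\<^sup>2)
        \<le> sqrt (2 * K) * l2_norm \<Omega> (\<lambda>x. u x $ i) * ?g u i * (?g w j)\<^sup>2"
      by (intro H10_mult_bound X_component u w)
    also have "\<dots> \<le> sqrt (2 * K) * (l2_norm \<Omega> u * h1_semi \<Omega> u) * (?g w j)\<^sup>2"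
      unfolding mult.assoc[of "sqrt (2 * K)" "l2_norm \<Omega> (\<lambda>x. u x $ i)"]
      using K_pos
      by (intro mult_right_mono mult_left_mono mult_mono l2_norm_cart_le X_component_L2
          weak_gradient_le_h1_semi u) auto
    finally show "(LINT x|lebesgue_on \<Omega>. (u x $ i)\<^sup>2 * (w x $ j)\<^sup>2)
        \<le> sqrt (2 * K) * (l2_norm \<Omega> u * h1_semi \<Omega> u) * (?g w j)\<^sup>2" .
  qed
  also have "\<dots> = real CARD('n) * (sqrt (2 * K) * (l2_norm \<Omega> u * h1_semi \<Omega> u) * (h1_semi \<Omega> w)\<^sup>2)"
    by (simp add: h1_semi_sq[OF w] sum_distrib_left)
  also have "\<dots> = (trilinear_const * sqrt (l2_norm \<Omega> u * h1_semi \<Omega> u) * h1_semi \<Omega> w)\<^sup>2"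
    using K_pos by (simp add: trilinear_const_def power_mult_distrib)
  finally show "l2_norm \<Omega> ?T \<le> trilinear_const * sqrt (l2_norm \<Omega> u * h1_semi \<Omega> u) * h1_semi \<Omega> w"
    by (rule power2_le_imp_le) (use trilinear_const_pos in simp)
qed

text \<open>
  The gradient is paired with \<open>\<bar>u\<bar> \<bar>w\<bar>\<close>, which is square integrable by the bound for products.
\<close>

lemma
  assumes u: "u \<in> X_space \<Omega>" and v: "v \<in> X_space \<Omega>" and w: "w \<in> X_space \<Omega>"
  shows b_form_integrable: "integrable (lebesgue_on \<Omega>) (\<lambda>x. (grad \<Omega> v x *v u x) \<bullet> w x)"
    and b_form_bound: "\<bar>b_form \<Omega> u v w\<bar>
      \<le> trilinear_const * sqrt (l2_norm \<Omega> u * h1_semi \<Omega> u) * h1_semi \<Omega> v * h1_semi \<Omega> w"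
proof -
  let ?T = "\<lambda>x. norm (u x) * norm (w x)"
  have expand: "(grad \<Omega> v x *v u x) \<bullet> w x = (\<Sum>i\<in>UNIV. (grad \<Omega> v x $ i \<bullet> u x) * w x $ i)" for x
    by (simp add: inner_vec_def matrix_vector_mul_component)
  have m: "(\<lambda>x. (grad \<Omega> v x *v u x) \<bullet> w x) \<in> borel_measurable (lebesgue_on \<Omega>)"
    unfolding expand
    by (intro borel_measurable_sum borel_measurable_times borel_measurable_inner
        L2_measurable[OF grad_row_L2[OF v]] L2_measurable[OF X_L2[OF u]] L2_measurable[OF X_component_L2[OF w]])
  have bd: "\<bar>(grad \<Omega> v x *v u x) \<bullet> w x\<bar> \<le> norm (grad \<Omega> v x) * ?T x" for x
  proof -
    have "\<bar>(grad \<Omega> v x *v u x) \<bullet> w x\<bar> \<le> norm (grad \<Omega> v x *v u x) * norm (w x)"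
      by (rule Cauchy_Schwarz_ineq2)
    also have "\<dots> \<le> (norm (grad \<Omega> v x) * norm (u x)) * norm (w x)"
      by (intro mult_right_mono norm_matrix_vector_le) auto
    finally show ?thesis by (simp add: mult.assoc)
  qed
  note L = L2_norm[OF grad_L2[OF v]] X_mult_L2[OF u w]
  have iT: "integrable (lebesgue_on \<Omega>) (\<lambda>x. norm (grad \<Omega> v x) * ?T x)"
    by (rule L2_integrable_mult[OF L])
  show i: "integrable (lebesgue_on \<Omega>) (\<lambda>x. (grad \<Omega> v x *v u x) \<bullet> w x)"
    by (rule Bochner_Integration.integrable_bound[OF iT m]) (use bd in \<open>auto simp: abs_mult\<close>)
  have "\<bar>b_form \<Omega> u v w\<bar> \<le> (LINT x|lebesgue_on \<Omega>. \<bar>(grad \<Omega> v x *v u x) \<bullet> w x\<bar>)"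
    unfolding b_form_def by (rule integral_abs_bound)
  also have "\<dots> \<le> (LINT x|lebesgue_on \<Omega>. norm (grad \<Omega> v x) * ?T x)"
    using i iT bd by (intro integral_mono) auto
  also have "\<dots> \<le> h1_semi \<Omega> v * l2_norm \<Omega> ?T"
    using l2_Cauchy_Schwarz[OF L] by (simp add: l2_inner_def l2_norm_norm h1_semi_def)
  also have "\<dots> \<le> h1_semi \<Omega> v * (trilinear_const * sqrt (l2_norm \<Omega> u * h1_semi \<Omega> u) * h1_semi \<Omega> w)"
    by (intro mult_left_mono X_mult_bound u w) simp
  finally show "\<bar>b_form \<Omega> u v w\<bar>
      \<le> trilinear_const * sqrt (l2_norm \<Omega> u * h1_semi \<Omega> u) * h1_semi \<Omega> v * h1_semi \<Omega> w"
    by (simp add: mult_ac)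
qed

lemma b_form_diff_1:
  assumes "u \<in> X_space \<Omega>" "u' \<in> X_space \<Omega>" "v \<in> X_space \<Omega>" "w \<in> X_space \<Omega>"
  shows "b_form \<Omega> (\<lambda>x. u x - u' x) v w = b_form \<Omega> u v w - b_form \<Omega> u' v w"
  unfolding b_form_def matrix_vector_mult_diff_distrib inner_diff_left
  by (intro Bochner_Integration.integral_diff b_form_integrable assms)

lemma b_form_diff_3:
  assumes "u \<in> X_space \<Omega>" "v \<in> X_space \<Omega>" "w \<in> X_space \<Omega>" "w' \<in> X_space \<Omega>"
  shows "b_form \<Omega> u v (\<lambda>x. w x - w' x) = b_form \<Omega> u v w - b_form \<Omega> u v w'"
  unfolding b_form_def inner_diff_right
  by (intro Bochner_Integration.integral_diff b_form_integrable assms)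

lemma b_form_diff_2:
  assumes "u \<in> X_space \<Omega>" "v \<in> X_space \<Omega>" "v' \<in> X_space \<Omega>" "w \<in> X_space \<Omega>"
  shows "b_form \<Omega> u (\<lambda>x. v x - v' x) w = b_form \<Omega> u v w - b_form \<Omega> u v' w"
proof -
  note i = b_form_integrable[OF assms(1,2,4)] b_form_integrable[OF assms(1,3,4)]
  have "b_form \<Omega> u (\<lambda>x. v x - v' x) w
      = (LINT x|lebesgue_on \<Omega>. (grad \<Omega> v x *v u x) \<bullet> w x - (grad \<Omega> v' x *v u x) \<bullet> w x)"
    unfolding b_form_def
  proof (rule integral_cong_AE)
    show "AE x in lebesgue_on \<Omega>. (grad \<Omega> (\<lambda>x. v x - v' x) x *v u x) \<bullet> w x
        = (grad \<Omega> v x *v u x) \<bullet> w x - (grad \<Omega> v' x *v u x) \<bullet> w x"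
      using grad_diff[OF assms(2,3)]
      by eventually_elim (simp add: matrix_vector_mult_diff_rdistrib inner_diff_left)
  qed (use i b_form_integrable[OF assms(1) X_diff[OF assms(2,3)] assms(4)] in auto)
  also have "\<dots> = b_form \<Omega> u v w - b_form \<Omega> u v' w"
    unfolding b_form_def by (rule Bochner_Integration.integral_diff[OF i])
  finally show ?thesis .
qed

lemma
  assumes "u \<in> X_space \<Omega>" "u' \<in> X_space \<Omega>" "v \<in> X_space \<Omega>" "v' \<in> X_space \<Omega>" "w \<in> X_space \<Omega>"
  shows b_skew_diff_1: "b_skew \<Omega> (\<lambda>x. u x - u' x) v w = b_skew \<Omega> u v w - b_skew \<Omega> u' v w"
    and b_skew_diff_2: "b_skew \<Omega> u (\<lambda>x. v x - v' x) w = b_skew \<Omega> u v w - b_skew \<Omega> u v' w"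
  using assms
  by (simp_all add: b_skew_def b_form_diff_1 b_form_diff_2 b_form_diff_3 field_simps)

lemma b_skew_self: "b_skew \<Omega> u v v = 0"
  by (simp add: b_skew_def)

text \<open>
  Exchanging the last two arguments leaves \<open>u\<close> undifferentiated, so both halves of the form obey the
  same bound, with half a derivative on the advecting field.
\<close>

lemma b_skew_bound:
  assumes "u \<in> X_space \<Omega>" "v \<in> X_space \<Omega>" "w \<in> X_space \<Omega>"
  shows "\<bar>b_skew \<Omega> u v w\<bar>
    \<le> trilinear_const * sqrt (l2_norm \<Omega> u * h1_semi \<Omega> u) * h1_semi \<Omega> v * h1_semi \<Omega> w"
  using b_form_bound[OF assms] b_form_bound[OF assms(1,3,2)]
  unfolding b_skew_def by (simp add: mult_ac abs_le_iff)

text \<open>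
  The bound on the quotients defining \<open>N\<close> that results from Poincare's inequality
\<close>

definition embedding_const :: real where
  "embedding_const = trilinear_const * sqrt (sqrt (measure lebesgue \<Omega> + K))"

lemma embedding_const_nonneg: "embedding_const \<ge> 0"
  using trilinear_const_pos K_pos by (simp add: embedding_const_def)

lemma b_skew_continuous:
  assumes "u \<in> X_space \<Omega>" "v \<in> X_space \<Omega>" "w \<in> X_space \<Omega>"
  shows "\<bar>b_skew \<Omega> u v w\<bar> \<le> embedding_const * (h1_semi \<Omega> u * h1_semi \<Omega> v * h1_semi \<Omega> w)"
proof -
  have "sqrt (l2_norm \<Omega> u * h1_semi \<Omega> u) \<le> sqrt (sqrt (measure lebesgue \<Omega> + K) * h1_semi \<Omega> u * h1_semi \<Omega> u)"
    by (intro real_sqrt_le_mono mult_right_mono X_Poincare assms) auto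
  also have "\<dots> = sqrt (sqrt (measure lebesgue \<Omega> + K)) * h1_semi \<Omega> u"
    by (simp add: real_sqrt_mult mult.assoc)
  finally have "trilinear_const * sqrt (l2_norm \<Omega> u * h1_semi \<Omega> u) * h1_semi \<Omega> v * h1_semi \<Omega> w
     \<le> trilinear_const * (sqrt (sqrt (measure lebesgue \<Omega> + K)) * h1_semi \<Omega> u) * h1_semi \<Omega> v * h1_semi \<Omega> w"
    using trilinear_const_pos by (intro mult_right_mono mult_left_mono) auto
  then show ?thesis
    using b_skew_bound[OF assms] by (simp add: embedding_const_def mult_ac)
qed

section \<open>The viscous form and the divergence form\<close>

lemma a_form_eq: "a_form \<Omega> Rey u v = inverse Rey * l2_inner \<Omega> (grad \<Omega> u) (grad \<Omega> v)"
  by (simp add: a_form_def l2_inner_def)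

lemma a_form_self: "a_form \<Omega> Rey v v = inverse Rey * (h1_semi \<Omega> v)\<^sup>2"
  by (simp add: a_form_eq l2_inner_self h1_semi_def)

lemma a_form_diff:
  assumes "u \<in> X_space \<Omega>" "u' \<in> X_space \<Omega>" "w \<in> X_space \<Omega>"
  shows "a_form \<Omega> Rey (\<lambda>x. u x - u' x) w = a_form \<Omega> Rey u w - a_form \<Omega> Rey u' w"
proof -
  have "l2_inner \<Omega> (grad \<Omega> (\<lambda>x. u x - u' x)) (grad \<Omega> w)
      = l2_inner \<Omega> (\<lambda>x. grad \<Omega> u x - grad \<Omega> u' x) (grad \<Omega> w)"
    unfolding l2_inner_def
  proof (rule integral_cong_AE)
    show "AE x in lebesgue_on \<Omega>. grad \<Omega> (\<lambda>x. u x - u' x) x \<bullet> grad \<Omega> w x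
        = (grad \<Omega> u x - grad \<Omega> u' x) \<bullet> grad \<Omega> w x"
      using grad_diff[OF assms(1,2)] by eventually_elim simp
  qed (intro borel_measurable_inner L2_measurable L2_diff grad_L2 X_diff assms)+
  then show ?thesis
    using assms by (simp add: a_form_eq l2_inner_diff_left grad_L2 right_diff_distrib)
qed

lemma a_form_bound:
  assumes "u \<in> X_space \<Omega>" "w \<in> X_space \<Omega>" "Rey > 0"
  shows "\<bar>a_form \<Omega> Rey u w\<bar> \<le> inverse Rey * h1_semi \<Omega> u * h1_semi \<Omega> w"
  using l2_Cauchy_Schwarz[OF grad_L2 grad_L2, OF assms(1,2)] assms(3)
  by (simp add: a_form_eq abs_mult h1_semi_def mult.assoc)

lemma divergence_expand: "divergence \<Omega> v x = (\<Sum>i\<in>UNIV. grad \<Omega> v x $ i $ i)"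
  by (simp add: divergence_def trace_def)

lemma grad_entry_L2: "v \<in> X_space \<Omega> \<Longrightarrow> (\<lambda>x. grad \<Omega> v x $ i $ j) \<in> L2 \<Omega>"
  by (intro L2_cartD grad_row_L2)

lemma L2_sum:
  assumes "finite I" "\<And>i. i \<in> I \<Longrightarrow> F i \<in> L2 \<Omega>"
  shows "(\<lambda>x. \<Sum>i\<in>I. F i x) \<in> L2 \<Omega>"
  using assms by (induction I rule: finite_induct) (auto intro: L2_zero L2_add)

lemma divergence_L2: "v \<in> X_space \<Omega> \<Longrightarrow> divergence \<Omega> v \<in> L2 \<Omega>"
  unfolding divergence_expand[abs_def] by (intro L2_sum grad_entry_L2) auto

text \<open>
  Since \<open>\<partial>\<^sub>iv\<^sub>i \<partial>\<^sub>jv\<^sub>j\<close> and \<open>\<partial>\<^sub>jv\<^sub>i \<partial>\<^sub>iv\<^sub>j\<close> have the same integral, the square of the divergence integrates to the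
  trace of \<open>(\<nabla>v)\<^sup>2\<close>, which is pointwise at most \<open>\<bar>\<nabla>v\<bar>\<^sup>2\<close>.
\<close>

lemma divergence_le_h1_semi:
  assumes v: "v \<in> X_space \<Omega>"
  shows "l2_norm \<Omega> (divergence \<Omega> v) \<le> h1_semi \<Omega> v"
proof (rule power2_le_imp_le)
  let ?D = "\<lambda>i j x. grad \<Omega> v x $ i $ j"
  let ?I = "\<lambda>f. LINT x|lebesgue_on \<Omega>. f x"
  have int: "integrable (lebesgue_on \<Omega>) (\<lambda>x. ?D i j x * ?D k l x)" for i j k l
    by (intro L2_integrable_mult grad_entry_L2 v)
  have comm: "?I (\<lambda>x. ?D i i x * ?D j j x) = ?I (\<lambda>x. ?D i j x * ?D j i x)" for i j
  proof -
    have B: "axis k (1::real) \<in> Basis" for k :: 'n by (simp add: axis_in_Basis_iff Basis_real_def)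
    show ?thesis
      using H10_partial_partial_commute[OF X_component[OF v, of i] X_component[OF v, of j] B B, of i j]
      by (simp add: grad_nth inner_axis)
  qed
  have "(l2_norm \<Omega> (divergence \<Omega> v))\<^sup>2 = ?I (\<lambda>x. \<Sum>i\<in>UNIV. \<Sum>j\<in>UNIV. ?D i i x * ?D j j x)"
    unfolding l2_norm_sq divergence_expand by (simp add: power2_eq_square sum_product)
  also have "\<dots> = (\<Sum>i\<in>UNIV. \<Sum>j\<in>UNIV. ?I (\<lambda>x. ?D i i x * ?D j j x))"
    by (simp add: Bochner_Integration.integral_sum Bochner_Integration.integrable_sum int)
  also have "\<dots> = (\<Sum>i\<in>UNIV. \<Sum>j\<in>UNIV. ?I (\<lambda>x. ?D i j x * ?D j i x))"
    by (intro sum.cong refl comm)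
  also have "\<dots> \<le> (\<Sum>i\<in>UNIV. \<Sum>j\<in>UNIV. (?I (\<lambda>x. ?D i j x * ?D i j x) + ?I (\<lambda>x. ?D j i x * ?D j i x)) / 2)"
  proof (intro sum_mono)
    fix i j
    have "?I (\<lambda>x. ?D i j x * ?D j i x) \<le> ?I (\<lambda>x. (?D i j x * ?D i j x + ?D j i x * ?D j i x) / 2)"
    proof (rule integral_mono)
      show "?D i j x * ?D j i x \<le> (?D i j x * ?D i j x + ?D j i x * ?D j i x) / 2" for x
        using sum_squares_bound[of "?D i j x" "?D j i x"] by (simp add: power2_eq_square)
    qed (use int in auto)
    also have "\<dots> = (?I (\<lambda>x. ?D i j x * ?D i j x) + ?I (\<lambda>x. ?D j i x * ?D j i x)) / 2"
      using int by simp
    finally show "?I (\<lambda>x. ?D i j x * ?D j i x) \<le> (?I (\<lambda>x. ?D i j x * ?D i j x) + ?I (\<lambda>x. ?D j i x * ?D j i x)) / 2" .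
  qed
  also have "\<dots> = (\<Sum>i\<in>UNIV. \<Sum>j\<in>UNIV. ?I (\<lambda>x. ?D i j x * ?D i j x))"
  proof -
    have "(\<Sum>i\<in>UNIV. \<Sum>j\<in>UNIV. ?I (\<lambda>x. ?D j i x * ?D j i x)) = (\<Sum>i\<in>UNIV. \<Sum>j\<in>UNIV. ?I (\<lambda>x. ?D i j x * ?D i j x))"
      by (rule sum.swap)
    then show ?thesis
      by (simp add: sum.distrib add_divide_distrib flip: sum_divide_distrib)
  qed
  also have "\<dots> = (h1_semi \<Omega> v)\<^sup>2"
  proof -
    have "(\<Sum>j\<in>UNIV. ?I (\<lambda>x. ?D i j x * ?D i j x)) = (l2_norm \<Omega> (weak_gradient \<Omega> (\<lambda>y. v y $ i)))\<^sup>2" for i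
    proof -
      have "?I (\<lambda>x. ?D i j x * ?D i j x) = (l2_norm \<Omega> (?D i j))\<^sup>2" for j
        unfolding l2_norm_sq by (simp add: power2_eq_square)
      then have "(\<Sum>j\<in>UNIV. ?I (\<lambda>x. ?D i j x * ?D i j x)) = (\<Sum>j\<in>UNIV. (l2_norm \<Omega> (?D i j))\<^sup>2)"
        by simp
      also have "\<dots> = (l2_norm \<Omega> (\<lambda>x. grad \<Omega> v x $ i))\<^sup>2"
        by (rule l2_norm_cart_sq[OF grad_entry_L2[OF v], symmetric])
      finally show ?thesis by (simp add: grad_nth)
    qed
    then show ?thesis by (simp add: h1_semi_sq[OF v])
  qed
  finally show "(l2_norm \<Omega> (divergence \<Omega> v))\<^sup>2 \<le> (h1_semi \<Omega> v)\<^sup>2" .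
qed simp

lemma c_form_eq: "c_form \<Omega> p v = - l2_inner \<Omega> (divergence \<Omega> v) p"
  by (simp add: c_form_def l2_inner_def)

lemma c_form_bound:
  assumes "v \<in> X_space \<Omega>" "p \<in> L2 \<Omega>"
  shows "\<bar>c_form \<Omega> p v\<bar> \<le> l2_norm \<Omega> p * h1_semi \<Omega> v"
proof -
  have "\<bar>c_form \<Omega> p v\<bar> \<le> l2_norm \<Omega> (divergence \<Omega> v) * l2_norm \<Omega> p"
    unfolding c_form_eq abs_minus by (intro l2_Cauchy_Schwarz divergence_L2 assms)
  also have "\<dots> \<le> h1_semi \<Omega> v * l2_norm \<Omega> p"
    by (intro mult_right_mono divergence_le_h1_semi assms) simp
  finally show ?thesis by (simp add: mult.commute)
qed

lemma c_form_diff: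
  assumes "v \<in> X_space \<Omega>" "p \<in> L2 \<Omega>" "q \<in> L2 \<Omega>"
  shows "c_form \<Omega> (\<lambda>x. p x - q x) v = c_form \<Omega> p v - c_form \<Omega> q v"
  using assms by (simp add: c_form_eq l2_inner_diff_right divergence_L2)

lemma c_form_cong:
  assumes "AE x in lebesgue_on \<Omega>. divergence \<Omega> v x = d x" "v \<in> X_space \<Omega>" "d \<in> L2 \<Omega>" "q \<in> L2 \<Omega>"
  shows "c_form \<Omega> q v = - l2_inner \<Omega> d q"
  unfolding c_form_eq l2_inner_def
proof (intro arg_cong[where f=uminus] integral_cong_AE)
  show "AE x in lebesgue_on \<Omega>. divergence \<Omega> v x \<bullet> q x = d x \<bullet> q x"
    using assms(1) by eventually_elim simp
qed (intro borel_measurable_inner L2_measurable divergence_L2 assms)+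

lemma c_form_add:
  assumes "u \<in> X_space \<Omega>" "v \<in> X_space \<Omega>" "q \<in> L2 \<Omega>"
  shows "c_form \<Omega> q (\<lambda>x. u x + v x) = c_form \<Omega> q u + c_form \<Omega> q v"
proof -
  have "c_form \<Omega> q (\<lambda>x. u x + v x) = - l2_inner \<Omega> (\<lambda>x. divergence \<Omega> u x + divergence \<Omega> v x) q"
  proof (rule c_form_cong)
    show "AE x in lebesgue_on \<Omega>. divergence \<Omega> (\<lambda>x. u x + v x) x = divergence \<Omega> u x + divergence \<Omega> v x"
      using grad_add[OF assms(1,2)] by eventually_elim (simp add: divergence_expand sum.distrib)
  qed (intro X_add L2_add divergence_L2 assms)+
  then show ?thesis
    using assms by (simp add: c_form_eq l2_inner_add_left divergence_L2)
qed

lemma c_form_scaleR: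
  assumes "v \<in> X_space \<Omega>" "q \<in> L2 \<Omega>"
  shows "c_form \<Omega> q (\<lambda>x. c *\<^sub>R v x) = c * c_form \<Omega> q v"
proof -
  have "c_form \<Omega> q (\<lambda>x. c *\<^sub>R v x) = - l2_inner \<Omega> (\<lambda>x. c *\<^sub>R divergence \<Omega> v x) q"
  proof (rule c_form_cong)
    show "AE x in lebesgue_on \<Omega>. divergence \<Omega> (\<lambda>x. c *\<^sub>R v x) x = c *\<^sub>R divergence \<Omega> v x"
      using grad_scaleR[OF assms(1), of c] by eventually_elim (simp add: divergence_expand sum_distrib_left)
  qed (intro X_scaleR L2_scaleR divergence_L2 assms)+
  then show ?thesis
    unfolding c_form_eq l2_inner_scaleR_left by simp
qed

lemma c_form_cong_AE:
  assumes "u \<in> X_space \<Omega>" "AE x in lebesgue_on \<Omega>. u x = v x" "q \<in> L2 \<Omega>"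
  shows "c_form \<Omega> q u = c_form \<Omega> q v"
proof -
  have "c_form \<Omega> q u = - l2_inner \<Omega> (divergence \<Omega> v) q"
  proof (rule c_form_cong)
    show "AE x in lebesgue_on \<Omega>. divergence \<Omega> u x = divergence \<Omega> v x"
      using grad_cong_AE[OF assms(1,2)] by eventually_elim (simp add: divergence_expand)
  qed (intro divergence_L2 assms X_cong_AE[OF assms(1,2)])+
  then show ?thesis
    by (simp add: c_form_eq)
qed

end


section \<open>Spans\<close>

lemma lin_span_subset:
  assumes zero: "(\<lambda>x. 0) \<in> S"
    and add: "\<And>u v. u \<in> S \<Longrightarrow> v \<in> S \<Longrightarrow> (\<lambda>x. u x + v x) \<in> S"
    and scale: "\<And>c v. v \<in> S \<Longrightarrow> (\<lambda>x. c *\<^sub>R v x) \<in> S"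
    and cong: "\<And>u v. u \<in> S \<Longrightarrow> AE x in lebesgue_on \<Omega>. u x = v x \<Longrightarrow> v \<in> S"
    and base: "\<And>i. i \<in> {1..k} \<Longrightarrow> \<phi> i \<in> S"
  shows "lin_span \<Omega> k \<phi> \<subseteq> S"
proof
  fix v assume "v \<in> lin_span \<Omega> k \<phi>"
  then obtain c where c: "AE x in lebesgue_on \<Omega>. v x = (\<Sum>i=1..k. c i *\<^sub>R \<phi> i x)"
    by (auto simp: lin_span_def)
  have "(\<lambda>x. \<Sum>i=1..m. c i *\<^sub>R \<phi> i x) \<in> S" if "m \<le> k" for m
    using that
  proof (induction m)
    case (Suc m)
    have "(\<lambda>x. (\<Sum>i=1..m. c i *\<^sub>R \<phi> i x) + c (Suc m) *\<^sub>R \<phi> (Suc m) x) \<in> S"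
      using Suc by (intro add scale base) auto
    then show ?case by simp
  qed (use zero in simp)
  from this[of k] show "v \<in> S"
    by (rule cong) (use c in \<open>auto elim: eventually_mono\<close>)
qed

lemma lin_spanI:
  "AE x in lebesgue_on \<Omega>. v x = (\<Sum>i=1..k. c i *\<^sub>R \<phi> i x) \<Longrightarrow> v \<in> lin_span \<Omega> k \<phi>"
  unfolding lin_span_def by (rule CollectI) (rule exI)

lemma lin_span_base:
  assumes "i \<in> {1..k}"
  shows "\<phi> i \<in> lin_span \<Omega> k \<phi>"
proof -
  have "\<phi> i x = (\<Sum>j=1..k. (if j = i then 1 else 0) *\<^sub>R \<phi> j x)" for x
  proof -
    have "(\<Sum>j=1..k. (if j = i then 1 else 0) *\<^sub>R \<phi> j x) = (\<Sum>j=1..k. if j = i then \<phi> j x else 0)"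
      by (rule sum.cong) auto
    then show ?thesis using assms by simp
  qed
  then show ?thesis
    by (intro lin_spanI[where c="\<lambda>j. if j = i then 1 else 0"] AE_I2)
qed

lemma lin_span_diff:
  assumes "u \<in> lin_span \<Omega> k \<phi>" "v \<in> lin_span \<Omega> k \<phi>"
  shows "(\<lambda>x. u x - v x) \<in> lin_span \<Omega> k \<phi>"
proof -
  obtain c d where cd: "AE x in lebesgue_on \<Omega>. u x = (\<Sum>i=1..k. c i *\<^sub>R \<phi> i x)"
    "AE x in lebesgue_on \<Omega>. v x = (\<Sum>i=1..k. d i *\<^sub>R \<phi> i x)"
    using assms by (auto simp: lin_span_def)
  have "AE x in lebesgue_on \<Omega>. u x - v x = (\<Sum>i=1..k. (c i - d i) *\<^sub>R \<phi> i x)"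
    using cd by eventually_elim (simp add: scaleR_diff_left sum_subtractf)
  then show ?thesis
    by (rule lin_spanI)
qed

lemma lin_span_zero: "(\<lambda>x. 0) \<in> lin_span \<Omega> k \<phi>"
  unfolding lin_span_def by (auto intro!: exI[of _ "\<lambda>_. 0"])

text \<open>
  The hypothesis itself supplies the lower bounds that make both infima meaningful.
\<close>

lemma le_INF_add_INF:
  fixes F :: "'a \<Rightarrow> real" and G :: "'b \<Rightarrow> real"
  assumes "\<And>v q. v \<in> A \<Longrightarrow> q \<in> B \<Longrightarrow> x \<le> F v + k * G q + D" "A \<noteq> {}" "B \<noteq> {}" "k > 0"
  shows "x \<le> (INF v\<in>A. F v) + k * (INF q\<in>B. G q) + D"
proof -
  have "(x - D - (INF v\<in>A. F v)) / k \<le> G q" if q: "q \<in> B" for q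
  proof -
    have "x - k * G q - D \<le> (INF v\<in>A. F v)"
    proof (rule cINF_greatest[OF assms(2)])
      show "x - k * G q - D \<le> F v" if "v \<in> A" for v
        using assms(1)[OF that q] by simp
    qed
    then show ?thesis using assms(4) by (simp add: field_simps)
  qed
  then have "(x - D - (INF v\<in>A. F v)) / k \<le> (INF q\<in>B. G q)"
    by (rule cINF_greatest[OF assms(3)])
  then show ?thesis using assms(4) by (simp add: field_simps)
qed

context Sobolev_domain
begin

lemma X_zero: "(\<lambda>x. 0) \<in> X_space \<Omega>"
proof -
  have "(\<lambda>x::real^'n. 0::real) \<in> test_functions \<Omega>"
    using Ck_on_const[where c="0::real"] by (auto simp: test_functions_def intro!: exI[of _ "{}"])
  note H = test_function_H1[OF this]
  have "l2_norm \<Omega> (weak_gradient \<Omega> (\<lambda>x. 0)) = 0"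
    using weak_gradient_scaleR[OF H, of 0] l2_norm_eq_0_iff[OF weak_gradient_L2[OF H]] by simp
  then have "h1_norm \<Omega> (\<lambda>x. 0) = 0"
    by (simp add: h1_norm_def l2_norm_def[of \<Omega> "\<lambda>x. 0"])
  then have "(\<lambda>x::real^'n. 0::real) \<in> H10 \<Omega>"
    using \<open>(\<lambda>x. 0) \<in> test_functions \<Omega>\<close> by (intro H10I[where \<phi>="\<lambda>_ _. 0"] H) simp_all
  then show ?thesis by (simp add: X_space_def)
qed

lemma lin_span_subset_X:
  assumes "\<And>i. i \<in> {1..k} \<Longrightarrow> \<phi> i \<in> X_space \<Omega>"
  shows "lin_span \<Omega> k \<phi> \<subseteq> X_space \<Omega>"
  by (rule lin_span_subset) (use X_zero X_add X_scaleR X_cong_AE assms in auto)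

lemma lin_span_subset_L2:
  fixes \<phi> :: "nat \<Rightarrow> real^'n \<Rightarrow> real"
  assumes "\<And>i. i \<in> {1..k} \<Longrightarrow> \<phi> i \<in> L2 \<Omega>"
  shows "lin_span \<Omega> k \<phi> \<subseteq> L2 \<Omega>"
proof (rule lin_span_subset)
  show "v \<in> L2 \<Omega>" if "u \<in> L2 \<Omega>" "AE x in lebesgue_on \<Omega>. u x = v x" for u v :: "real^'n \<Rightarrow> real"
    by (rule L2_cong_AE[OF that(1) domain_sets that(2)])
  show "(\<lambda>x. c *\<^sub>R v x) \<in> L2 \<Omega>" if "v \<in> L2 \<Omega>" for c and v :: "real^'n \<Rightarrow> real"
    by (rule L2_scaleR[OF that])
qed (use L2_zero L2_add assms in auto)

lemma lin_span_divergence_free: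
  assumes q: "q \<in> L2 \<Omega>" and base: "\<And>i. i \<in> {1..k} \<Longrightarrow> \<phi> i \<in> X_space \<Omega> \<and> c_form \<Omega> q (\<phi> i) = 0"
    and v: "v \<in> lin_span \<Omega> k \<phi>"
  shows "c_form \<Omega> q v = 0"
proof -
  have "lin_span \<Omega> k \<phi> \<subseteq> {v \<in> X_space \<Omega>. c_form \<Omega> q v = 0}"
  proof (rule lin_span_subset)
    show "(\<lambda>x. 0) \<in> {v \<in> X_space \<Omega>. c_form \<Omega> q v = 0}"
      using X_zero c_form_scaleR[OF X_zero q, of 0] by simp
    show "v \<in> {v \<in> X_space \<Omega>. c_form \<Omega> q v = 0}"
      if "u \<in> {v \<in> X_space \<Omega>. c_form \<Omega> q v = 0}" "AE x in lebesgue_on \<Omega>. u x = v x" for u v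
      using that X_cong_AE c_form_cong_AE[OF _ that(2) q] by auto
  qed (use X_add X_scaleR c_form_add[OF _ _ q] c_form_scaleR[OF _ q] base in auto)
  then show ?thesis using v by blast
qed

section \<open>The suprema \<open>N\<close>, \<open>N\<^sub>R\<^sub>,\<^sub>r\<close> and the dual norm\<close>

lemma trilinear_quotient_bounds:
  assumes "u \<in> X_space \<Omega>" "v \<in> X_space \<Omega>" "w \<in> X_space \<Omega>"
  shows "0 \<le> \<bar>b_skew \<Omega> u v w\<bar> / (h1_semi \<Omega> u * h1_semi \<Omega> v * h1_semi \<Omega> w)"
    and "\<bar>b_skew \<Omega> u v w\<bar> / (h1_semi \<Omega> u * h1_semi \<Omega> v * h1_semi \<Omega> w) \<le> embedding_const"
proof -
  let ?d = "h1_semi \<Omega> u * h1_semi \<Omega> v * h1_semi \<Omega> w"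
  have d: "?d \<ge> 0" by (intro mult_nonneg_nonneg) auto
  then show "0 \<le> \<bar>b_skew \<Omega> u v w\<bar> / ?d" by simp
  show "\<bar>b_skew \<Omega> u v w\<bar> / ?d \<le> embedding_const"
  proof (cases "?d = 0")
    case False
    then have "?d > 0" using d by linarith
    then show ?thesis
      using b_skew_continuous[OF assms] by (simp add: pos_divide_le_eq)
  next
    case True
    then show ?thesis
      unfolding True by (simp add: embedding_const_nonneg)
  qed
qed

lemma nonzero_subset: "V \<subseteq> W \<Longrightarrow> v \<in> nonzero \<Omega> V \<Longrightarrow> v \<in> W"
  by (auto simp: nonzero_def)

lemma h1_semi_zero_if_not_nonzero:
  assumes "v \<in> V" "V \<subseteq> X_space \<Omega>" "v \<notin> nonzero \<Omega> V"
  shows "h1_semi \<Omega> v = 0"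
  using assms h1_semi_zero_AE by (auto simp: nonzero_def)

text \<open>
  If one of the seminorms vanishes, the quotient is zero by convention and gives no information; then
  the form vanishes by continuity. Functions excluded from the supremum are of this kind.
\<close>

lemma
  assumes sub: "XR \<subseteq> X_space \<Omega>" "Xr \<subseteq> X_space \<Omega>"
  shows b_skew_le_NRr_const: "u \<in> XR \<Longrightarrow> v \<in> Xr \<Longrightarrow> w \<in> XR \<Longrightarrow>
      \<bar>b_skew \<Omega> u v w\<bar> \<le> NRr_const \<Omega> XR Xr * (h1_semi \<Omega> u * h1_semi \<Omega> v * h1_semi \<Omega> w)"
    and NRr_const_nonneg: "nonzero \<Omega> XR \<noteq> {} \<Longrightarrow> nonzero \<Omega> Xr \<noteq> {} \<Longrightarrow> 0 \<le> NRr_const \<Omega> XR Xr"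
    and NRr_const_le_N_const: "nonzero \<Omega> XR \<noteq> {} \<Longrightarrow> nonzero \<Omega> Xr \<noteq> {} \<Longrightarrow> NRr_const \<Omega> XR Xr \<le> N_const \<Omega>"
proof -
  let ?S = "\<lambda>V W. {\<bar>b_skew \<Omega> u v w\<bar> / (h1_semi \<Omega> u * h1_semi \<Omega> v * h1_semi \<Omega> w) | u v w.
      u \<in> nonzero \<Omega> V \<and> v \<in> nonzero \<Omega> W \<and> w \<in> nonzero \<Omega> V}"
  have bdd: "bdd_above (?S V W)" if "V \<subseteq> X_space \<Omega>" "W \<subseteq> X_space \<Omega>" for V W
    by (rule bdd_aboveI[where M=embedding_const])
      (use trilinear_quotient_bounds(2) nonzero_subset that in blast)
  show "\<bar>b_skew \<Omega> u v w\<bar> \<le> NRr_const \<Omega> XR Xr * (h1_semi \<Omega> u * h1_semi \<Omega> v * h1_semi \<Omega> w)"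
    if uvw: "u \<in> XR" "v \<in> Xr" "w \<in> XR"
  proof (cases "h1_semi \<Omega> u * h1_semi \<Omega> v * h1_semi \<Omega> w = 0")
    case True
    then show ?thesis
      using b_skew_continuous[of u v w] uvw sub unfolding True by (simp add: subset_iff)
  next
    case False
    then have "u \<in> nonzero \<Omega> XR" "v \<in> nonzero \<Omega> Xr" "w \<in> nonzero \<Omega> XR"
      using h1_semi_zero_if_not_nonzero uvw sub by auto
    then have "\<bar>b_skew \<Omega> u v w\<bar> / (h1_semi \<Omega> u * h1_semi \<Omega> v * h1_semi \<Omega> w) \<le> NRr_const \<Omega> XR Xr"
      unfolding NRr_const_def by (intro cSup_upper bdd sub) blast
    moreover have "h1_semi \<Omega> u * h1_semi \<Omega> v * h1_semi \<Omega> w > 0"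
      using False by (simp add: less_le)
    ultimately show ?thesis by (simp add: divide_le_eq)
  qed
  assume ne: "nonzero \<Omega> XR \<noteq> {}" "nonzero \<Omega> Xr \<noteq> {}"
  then obtain u v where uv: "u \<in> nonzero \<Omega> XR" "v \<in> nonzero \<Omega> Xr" by blast
  have "0 \<le> \<bar>b_skew \<Omega> u v u\<bar> / (h1_semi \<Omega> u * h1_semi \<Omega> v * h1_semi \<Omega> u)"
    by (intro trilinear_quotient_bounds(1)) (use uv nonzero_subset sub in blast)+
  also have "\<dots> \<le> NRr_const \<Omega> XR Xr"
    unfolding NRr_const_def by (intro cSup_upper bdd sub) (use uv in blast)
  finally show "0 \<le> NRr_const \<Omega> XR Xr" .
  have nz: "nonzero \<Omega> V \<subseteq> nonzero \<Omega> (X_space \<Omega>)" if "V \<subseteq> X_space \<Omega>" for V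
    using that by (auto simp: nonzero_def)
  show "NRr_const \<Omega> XR Xr \<le> N_const \<Omega>"
    unfolding NRr_const_def N_const_def
  proof (rule cSup_subset_mono)
    show "?S XR Xr \<noteq> {}" using uv by blast
    show "bdd_above (?S (X_space \<Omega>) (X_space \<Omega>))" by (intro bdd order_refl)
    show "?S XR Xr \<subseteq> ?S (X_space \<Omega>) (X_space \<Omega>)" using nz sub by blast
  qed
qed

lemma
  assumes f: "f \<in> X_dual \<Omega>"
  shows le_dual_norm: "v \<in> X_space \<Omega> \<Longrightarrow> \<bar>f v\<bar> \<le> dual_norm \<Omega> f * h1_semi \<Omega> v"
    and dual_norm_nonneg: "nonzero \<Omega> (X_space \<Omega>) \<noteq> {} \<Longrightarrow> 0 \<le> dual_norm \<Omega> f"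
proof -
  let ?S = "{\<bar>f v\<bar> / h1_semi \<Omega> v | v. v \<in> nonzero \<Omega> (X_space \<Omega>)}"
  obtain L where L: "\<And>v. v \<in> X_space \<Omega> \<Longrightarrow> \<bar>f v\<bar> \<le> L * h1_semi \<Omega> v"
    using f unfolding X_dual_def by blast
  have bdd: "bdd_above ?S"
  proof (rule bdd_aboveI)
    fix t assume "t \<in> ?S"
    then obtain v where v: "t = \<bar>f v\<bar> / h1_semi \<Omega> v" "v \<in> X_space \<Omega>"
      by (auto simp: nonzero_def)
    show "t \<le> \<bar>L\<bar>"
    proof (cases "h1_semi \<Omega> v = 0")
      case False
      then have "h1_semi \<Omega> v > 0" by (simp add: less_le)
      then have "t \<le> L" using L[OF v(2)] v(1) by (simp add: divide_le_eq)
      then show ?thesis by linarith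
    qed (simp add: v(1))
  qed
  show "\<bar>f v\<bar> \<le> dual_norm \<Omega> f * h1_semi \<Omega> v" if v: "v \<in> X_space \<Omega>"
  proof (cases "h1_semi \<Omega> v = 0")
    case True
    then show ?thesis using L[OF v] by simp
  next
    case False
    then have "v \<in> nonzero \<Omega> (X_space \<Omega>)"
      using h1_semi_zero_if_not_nonzero v by blast
    then have "\<bar>f v\<bar> / h1_semi \<Omega> v \<le> dual_norm \<Omega> f"
      unfolding dual_norm_def by (intro cSup_upper bdd) blast
    moreover have "h1_semi \<Omega> v > 0" using False by (simp add: less_le)
    ultimately show ?thesis by (simp add: divide_le_eq)
  qed
  assume "nonzero \<Omega> (X_space \<Omega>) \<noteq> {}"
  then obtain v where v: "v \<in> nonzero \<Omega> (X_space \<Omega>)" by blast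
  have "0 \<le> \<bar>f v\<bar> / h1_semi \<Omega> v" by simp
  also have "\<dots> \<le> dual_norm \<Omega> f"
    unfolding dual_norm_def by (intro cSup_upper bdd) (use v in blast)
  finally show "0 \<le> dual_norm \<Omega> f" .
qed

section \<open>The error estimate\<close>

text \<open>
  Tested with \<open>u\<^sup>r\<close>, the convective term drops out of the first reduced equation.
\<close>

lemma ROM_stability:
  assumes f: "f \<in> X_dual \<Omega>" and "Rey > 0" and ur: "ur \<in> X_space \<Omega>"
    and eq: "a_form \<Omega> Rey ur ur + b_skew \<Omega> ur ur ur = f ur" and "0 \<le> dual_norm \<Omega> f"
  shows "h1_semi \<Omega> ur \<le> Rey * dual_norm \<Omega> f"
proof (cases "h1_semi \<Omega> ur = 0")
  case False
  then have pos: "h1_semi \<Omega> ur > 0" by (simp add: less_le)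
  have "inverse Rey * (h1_semi \<Omega> ur)\<^sup>2 \<le> dual_norm \<Omega> f * h1_semi \<Omega> ur"
    using eq le_dual_norm[OF f ur] by (simp add: a_form_self b_skew_self)
  then have "h1_semi \<Omega> ur * h1_semi \<Omega> ur \<le> (Rey * dual_norm \<Omega> f) * h1_semi \<Omega> ur"
    using \<open>Rey > 0\<close> by (simp add: field_simps power2_eq_square)
  then show ?thesis using pos by simp
qed (use assms in simp)

text \<open>
  The form is bilinear in its first two arguments, so that
  \<open>b(u;u,\<cdot>) - b(u;u\<^sup>r,\<cdot>) - b(u\<^sup>r;u,\<cdot>) + b(u\<^sup>r;u\<^sup>r,\<cdot>) = b(d;d,\<cdot>)\<close>.
\<close>

lemma two_level_error_identity:
  assumes X: "u \<in> X_space \<Omega>" "ur \<in> X_space \<Omega>" "uR \<in> X_space \<Omega>" "v \<in> X_space \<Omega>"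
    and pq: "p \<in> L2 \<Omega>" "q \<in> L2 \<Omega>"
  defines "\<phi> \<equiv> (\<lambda>x. uR x - v x)" and "\<eta> \<equiv> (\<lambda>x. u x - v x)" and "d \<equiv> (\<lambda>x. u x - ur x)"
  assumes NSE: "a_form \<Omega> Rey u \<phi> + b_skew \<Omega> u u \<phi> + c_form \<Omega> p \<phi> = F"
    and ROM: "a_form \<Omega> Rey uR \<phi> + b_skew \<Omega> uR ur \<phi> + b_skew \<Omega> ur uR \<phi> = F + b_skew \<Omega> ur ur \<phi>"
    and q: "c_form \<Omega> q \<phi> = 0"
  shows "a_form \<Omega> Rey \<phi> \<phi> + b_skew \<Omega> \<phi> ur \<phi> = a_form \<Omega> Rey \<eta> \<phi> + b_skew \<Omega> \<eta> ur \<phi>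
    + b_skew \<Omega> ur \<eta> \<phi> + b_skew \<Omega> d d \<phi> + c_form \<Omega> (\<lambda>x. p x - q x) \<phi>"
proof -
  have D: "\<phi> \<in> X_space \<Omega>" "d \<in> X_space \<Omega>"
    unfolding \<phi>_def d_def by (intro X_diff X)+
  note zero = b_skew_self[of ur \<phi>]
  have "a_form \<Omega> Rey \<phi> \<phi> = a_form \<Omega> Rey uR \<phi> - a_form \<Omega> Rey v \<phi>"
    using a_form_diff[OF X(3,4) D(1)] by (simp add: \<phi>_def)
  moreover have "b_skew \<Omega> \<phi> ur \<phi> = b_skew \<Omega> uR ur \<phi> - b_skew \<Omega> v ur \<phi>"
    using b_skew_diff_1[OF X(3,4,2,2) D(1)] by (simp add: \<phi>_def)
  moreover have "b_skew \<Omega> ur \<phi> \<phi> = b_skew \<Omega> ur uR \<phi> - b_skew \<Omega> ur v \<phi>"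
    using b_skew_diff_2[OF X(2,2,3,4) D(1)] by (simp add: \<phi>_def)
  moreover have "a_form \<Omega> Rey \<eta> \<phi> = a_form \<Omega> Rey u \<phi> - a_form \<Omega> Rey v \<phi>"
    unfolding \<eta>_def by (rule a_form_diff[OF X(1,4) D(1)])
  moreover have "b_skew \<Omega> \<eta> ur \<phi> = b_skew \<Omega> u ur \<phi> - b_skew \<Omega> v ur \<phi>"
    unfolding \<eta>_def by (rule b_skew_diff_1[OF X(1,4,2,2) D(1)])
  moreover have "b_skew \<Omega> ur \<eta> \<phi> = b_skew \<Omega> ur u \<phi> - b_skew \<Omega> ur v \<phi>"
    unfolding \<eta>_def by (rule b_skew_diff_2[OF X(2,2,1,4) D(1)])
  moreover have "b_skew \<Omega> d d \<phi> = b_skew \<Omega> u d \<phi> - b_skew \<Omega> ur d \<phi>"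
    using b_skew_diff_1[OF X(1,2) D(2,2,1)] by (simp add: d_def)
  moreover have "b_skew \<Omega> u d \<phi> = b_skew \<Omega> u u \<phi> - b_skew \<Omega> u ur \<phi>"
    unfolding d_def by (rule b_skew_diff_2[OF X(1,1,1,2) D(1)])
  moreover have "b_skew \<Omega> ur d \<phi> = b_skew \<Omega> ur u \<phi> - b_skew \<Omega> ur ur \<phi>"
    unfolding d_def by (rule b_skew_diff_2[OF X(2,2,1,2) D(1)])
  moreover have "c_form \<Omega> (\<lambda>x. p x - q x) \<phi> = c_form \<Omega> p \<phi> - c_form \<Omega> q \<phi>"
    by (rule c_form_diff[OF D(1) pq])
  ultimately show ?thesis
    using NSE ROM q zero by linarith
qed

text \<open>
  In the error identity, \<open>b(\<phi>;u\<^sup>r,\<phi>)\<close> is absorbed by the viscous term through \<open>N\<^sub>R\<^sub>,\<^sub>r\<close> and the stability of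
  \<open>u\<^sup>r\<close>. What remains is \<open>Re\<^sup>-\<^sup>1 \<alpha> \<bar>\<phi>\<bar>\<^sub>1\<^sup>2\<close> on the left and a multiple of \<open>\<bar>\<phi>\<bar>\<^sub>1\<close> on the right.
\<close>

lemma two_level_error_estimate:
  assumes f: "f \<in> X_dual \<Omega>" and Rey: "Rey > 0"
    and sub: "XR \<subseteq> X_space \<Omega>" "Xr \<subseteq> X_space \<Omega>" and Qh: "Qh \<subseteq> L2 \<Omega>"
    and XR_diff: "\<And>v w. v \<in> XR \<Longrightarrow> w \<in> XR \<Longrightarrow> (\<lambda>x. v x - w x) \<in> XR"
    and div_free: "\<And>v q. v \<in> XR \<Longrightarrow> q \<in> Qh \<Longrightarrow> c_form \<Omega> q v = 0"
    and NSE: "weak_NSE \<Omega> (X_space \<Omega>) (Q_space \<Omega>) Rey f u p"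
    and ROM: "two_level_ROM \<Omega> Xr XR Rey f ur uR"
    and nonneg: "0 \<le> NRr_const \<Omega> XR Xr" "0 \<le> dual_norm \<Omega> f"
  defines "\<alpha> \<equiv> 1 - Rey\<^sup>2 * NRr_const \<Omega> XR Xr * dual_norm \<Omega> f"
  assumes \<alpha>: "\<alpha> > 0" and v: "v \<in> XR" and q: "q \<in> Qh"
  defines "\<eta> \<equiv> (\<lambda>x. u x - v x)" and "d \<equiv> (\<lambda>x. u x - ur x)"
  shows "h1_semi \<Omega> (\<lambda>x. u x - uR x) \<le> h1_semi \<Omega> \<eta> + inverse \<alpha> * Rey *
    (inverse Rey * h1_semi \<Omega> \<eta>
      + trilinear_const * sqrt (l2_norm \<Omega> \<eta> * h1_semi \<Omega> \<eta>) * h1_semi \<Omega> ur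
      + trilinear_const * sqrt (l2_norm \<Omega> ur * h1_semi \<Omega> ur) * h1_semi \<Omega> \<eta>
      + trilinear_const * sqrt (l2_norm \<Omega> d * h1_semi \<Omega> d) * h1_semi \<Omega> d
      + l2_norm \<Omega> (\<lambda>x. p x - q x))"
    (is "_ \<le> _ + _ * ?S")
proof -
  have u: "u \<in> X_space \<Omega>" and p: "p \<in> Q_space \<Omega>"
    and NSE': "\<And>w. w \<in> X_space \<Omega> \<Longrightarrow> a_form \<Omega> Rey u w + b_skew \<Omega> u u w + c_form \<Omega> p w = f w"
    using NSE by (auto simp: weak_NSE_def)
  have ur: "ur \<in> Xr" and uR: "uR \<in> XR"
    and ROM1: "\<And>w. w \<in> Xr \<Longrightarrow> a_form \<Omega> Rey ur w + b_skew \<Omega> ur ur w = f w"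
    and ROM2: "\<And>w. w \<in> XR \<Longrightarrow> a_form \<Omega> Rey uR w + b_skew \<Omega> uR ur w + b_skew \<Omega> ur uR w
      = f w + b_skew \<Omega> ur ur w"
    using ROM by (auto simp: two_level_ROM_def)
  define \<phi> where "\<phi> = (\<lambda>x. uR x - v x)"
  have \<phi>R: "\<phi> \<in> XR" unfolding \<phi>_def by (rule XR_diff[OF uR v])
  have X: "u \<in> X_space \<Omega>" "ur \<in> X_space \<Omega>" "uR \<in> X_space \<Omega>" "v \<in> X_space \<Omega>" "\<phi> \<in> X_space \<Omega>"
    using u ur uR v \<phi>R sub by auto
  have E: "\<eta> \<in> X_space \<Omega>" "d \<in> X_space \<Omega>"
    unfolding \<eta>_def d_def by (intro X_diff X)+
  have pq: "p \<in> L2 \<Omega>" "q \<in> L2 \<Omega>"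
    using p q Qh by (auto simp: Q_space_def)
  define F where "F = h1_semi \<Omega> \<phi>"
  have F0: "F \<ge> 0" by (simp add: F_def)
  have stab: "h1_semi \<Omega> ur \<le> Rey * dual_norm \<Omega> f"
    by (rule ROM_stability[OF f Rey X(2) ROM1[OF ur] nonneg(2)])
  have "a_form \<Omega> Rey \<phi> \<phi> + b_skew \<Omega> \<phi> ur \<phi> = a_form \<Omega> Rey \<eta> \<phi> + b_skew \<Omega> \<eta> ur \<phi>
      + b_skew \<Omega> ur \<eta> \<phi> + b_skew \<Omega> d d \<phi> + c_form \<Omega> (\<lambda>x. p x - q x) \<phi>"
    unfolding \<eta>_def d_def \<phi>_def
    by (rule two_level_error_identity[OF X(1-4) pq NSE' ROM2 div_free[OF _ q]])
      (use X(5) \<phi>R in \<open>simp_all add: \<phi>_def\<close>)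
  moreover have "\<bar>a_form \<Omega> Rey \<eta> \<phi>\<bar> \<le> inverse Rey * h1_semi \<Omega> \<eta> * F"
    unfolding F_def by (rule a_form_bound[OF E(1) X(5) Rey])
  moreover have "\<bar>b_skew \<Omega> \<eta> ur \<phi>\<bar> \<le> trilinear_const * sqrt (l2_norm \<Omega> \<eta> * h1_semi \<Omega> \<eta>) * h1_semi \<Omega> ur * F"
    unfolding F_def by (rule b_skew_bound[OF E(1) X(2,5)])
  moreover have "\<bar>b_skew \<Omega> ur \<eta> \<phi>\<bar> \<le> trilinear_const * sqrt (l2_norm \<Omega> ur * h1_semi \<Omega> ur) * h1_semi \<Omega> \<eta> * F"
    unfolding F_def by (rule b_skew_bound[OF X(2) E(1) X(5)])
  moreover have "\<bar>b_skew \<Omega> d d \<phi>\<bar> \<le> trilinear_const * sqrt (l2_norm \<Omega> d * h1_semi \<Omega> d) * h1_semi \<Omega> d * F"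
    unfolding F_def by (rule b_skew_bound[OF E(2,2) X(5)])
  moreover have "\<bar>c_form \<Omega> (\<lambda>x. p x - q x) \<phi>\<bar> \<le> l2_norm \<Omega> (\<lambda>x. p x - q x) * F"
    unfolding F_def by (intro c_form_bound L2_diff X pq)
  moreover have "\<bar>b_skew \<Omega> \<phi> ur \<phi>\<bar> \<le> Rey * NRr_const \<Omega> XR Xr * dual_norm \<Omega> f * F\<^sup>2"
  proof -
    have "\<bar>b_skew \<Omega> \<phi> ur \<phi>\<bar> \<le> NRr_const \<Omega> XR Xr * (F * h1_semi \<Omega> ur * F)"
      unfolding F_def by (rule b_skew_le_NRr_const[OF sub \<phi>R ur \<phi>R])
    also have "\<dots> \<le> NRr_const \<Omega> XR Xr * (F * (Rey * dual_norm \<Omega> f) * F)"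
      by (intro mult_left_mono mult_right_mono stab nonneg F0)
    finally show ?thesis by (simp add: power2_eq_square mult_ac)
  qed
  moreover have "a_form \<Omega> Rey \<phi> \<phi> = inverse Rey * F\<^sup>2"
    by (simp add: a_form_self F_def)
  ultimately have "inverse Rey * F\<^sup>2 - Rey * NRr_const \<Omega> XR Xr * dual_norm \<Omega> f * F\<^sup>2 \<le> ?S * F"
    unfolding distrib_right by linarith
  moreover have "inverse Rey * F\<^sup>2 - Rey * NRr_const \<Omega> XR Xr * dual_norm \<Omega> f * F\<^sup>2 = inverse Rey * \<alpha> * F * F"
    using Rey by (simp add: \<alpha>_def field_simps power2_eq_square)
  ultimately have main: "inverse Rey * \<alpha> * F * F \<le> ?S * F" by simp
  have S0: "?S \<ge> 0"
    using trilinear_const_pos Rey by (intro add_nonneg_nonneg mult_nonneg_nonneg) auto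
  have "F \<le> inverse \<alpha> * Rey * ?S"
  proof (cases "F = 0")
    case True
    then show ?thesis using S0 \<alpha> Rey by simp
  next
    case False
    then have "inverse Rey * \<alpha> * F \<le> ?S" using main F0 by simp
    then have "inverse \<alpha> * Rey * (inverse Rey * \<alpha> * F) \<le> inverse \<alpha> * Rey * ?S"
      using \<alpha> Rey by (intro mult_left_mono) auto
    then show ?thesis using \<alpha> Rey by (simp add: field_simps)
  qed
  moreover have "h1_semi \<Omega> (\<lambda>x. u x - uR x) \<le> h1_semi \<Omega> \<eta> + F"
    using h1_semi_triangle_diff[OF E(1) X(5)] by (simp add: \<eta>_def \<phi>_def F_def)
  ultimately show ?thesis by linarith
qed

lemma finite_dim_subspace_X:
  assumes "finite_dim_subspace \<Omega> V (X_space \<Omega>)"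
  shows "V \<subseteq> X_space \<Omega>"
proof -
  obtain m \<psi> where \<psi>: "\<And>i. i \<in> {1..m} \<Longrightarrow> \<psi> i \<in> X_space \<Omega>" "V = lin_span \<Omega> m \<psi>"
    using assms unfolding finite_dim_subspace_def by blast
  show ?thesis
    unfolding \<psi>(2) by (rule lin_span_subset_X[OF \<psi>(1)])
qed

lemma finite_dim_subspace_Q:
  assumes "finite_dim_subspace \<Omega> V (Q_space \<Omega>)"
  shows "V \<subseteq> L2 \<Omega>" "V \<noteq> {}"
proof -
  obtain m \<psi> where \<psi>: "\<And>i. i \<in> {1..m} \<Longrightarrow> \<psi> i \<in> Q_space \<Omega>" "V = lin_span \<Omega> m \<psi>"
    using assms unfolding finite_dim_subspace_def by blast
  show "V \<subseteq> L2 \<Omega>"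
    unfolding \<psi>(2) by (rule lin_span_subset_L2) (use \<psi>(1) in \<open>auto simp: Q_space_def\<close>)
  show "V \<noteq> {}"
    unfolding \<psi>(2) using lin_span_zero by blast
qed

text \<open>
  This makes the sets over which the suprema are taken nonempty.
\<close>

lemma orthonormal_not_AE_zero:
  assumes "orthonormal_in_X \<Omega> ip k \<phi>" "ip \<in> {l2_inner \<Omega>, h1_inner0 \<Omega>}" "i \<in> {1..k}"
  shows "\<not> (AE x in lebesgue_on \<Omega>. \<phi> i x = 0)"
proof
  assume z: "AE x in lebesgue_on \<Omega>. \<phi> i x = 0"
  have X: "\<phi> i \<in> X_space \<Omega>" and one: "ip (\<phi> i) (\<phi> i) = 1"
    using assms by (auto simp: orthonormal_in_X_def)
  have "l2_inner \<Omega> (\<phi> i) (\<phi> i) = 0"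
    using l2_norm_eq_0_iff[OF X_L2[OF X]] z by (simp add: l2_inner_self)
  moreover have "h1_inner0 \<Omega> (\<phi> i) (\<phi> i) = 0"
    using h1_semi_zero_AE[OF z X] by (simp add: h1_inner0_def l2_inner_self h1_semi_def)
  ultimately show False
    using one assms(2) by auto
qed

end

theorem theorem4p1:
  fixes \<Omega> :: "(real^'n) set"
  assumes "CARD('n) \<in> {2, 3}"
    and "open \<Omega>" "connected \<Omega>" "\<Omega> \<noteq> {}" "bounded \<Omega>"
    and "lipschitz_boundary \<Omega>" "C2_boundary \<Omega>"
  shows "\<exists>C>0. \<forall>f Rey M Res us Xh Qh ip l \<phi> r R Xr XR u p ur uR.
    f \<in> X_dual \<Omega> \<longrightarrow>
    Rey > 0 \<longrightarrow>
    Rey\<^sup>2 * N_const \<Omega> * dual_norm \<Omega> f < 1 \<longrightarrow>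
    finite_dim_subspace \<Omega> Xh (X_space \<Omega>) \<longrightarrow>
    finite_dim_subspace \<Omega> Qh (Q_space \<Omega>) \<longrightarrow>
    (\<forall>j\<in>{1..M}. Res j > 0 \<and> (\<exists>ph. weak_NSE \<Omega> Xh Qh (Res j) f (us j) ph)) \<longrightarrow>
    ip \<in> {l2_inner \<Omega>, h1_inner0 \<Omega>} \<longrightarrow>
    POD_basis \<Omega> ip M us l \<phi> \<longrightarrow>
    1 \<le> r \<longrightarrow> r < R \<longrightarrow> R \<le> l \<longrightarrow>
    Xr = lin_span \<Omega> r \<phi> \<longrightarrow>
    XR = lin_span \<Omega> R \<phi> \<longrightarrow>
    weak_NSE \<Omega> (X_space \<Omega>) (Q_space \<Omega>) Rey f u p \<longrightarrow>
    two_level_ROM \<Omega> Xr XR Rey f ur uR \<longrightarrow>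
    (let \<alpha> = 1 - Rey\<^sup>2 * NRr_const \<Omega> XR Xr * dual_norm \<Omega> f;
         n0 = l2_norm \<Omega>;
         n1 = h1_semi \<Omega>;
         e = (\<lambda>v x. u x - v x)
     in \<alpha> > 0 \<and>
        n1 (e uR) \<le>
          (INF v\<in>XR.
              (inverse \<alpha> + 1) * n1 (e v)
            + inverse \<alpha> * Rey * C * n0 (e v) powr (1/2) * n1 (e v) powr (1/2) * n1 ur
            + inverse \<alpha> * Rey * C * n0 ur powr (1/2) * n1 ur powr (1/2) * n1 (e v))
          + inverse \<alpha> * Rey * (INF q\<in>Qh. l2_norm \<Omega> (\<lambda>x. p x - q x))
          + inverse \<alpha> * Rey * C * n0 (e ur) powr (1/2) * n1 (e ur) powr (3/2))"
proof -
  obtain K where K: "K > 0" "\<And>\<phi>. \<phi> \<in> test_functions \<Omega> \<Longrightarrow>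
    (\<integral>\<^sup>+x. ennreal (\<bar>\<phi> x\<bar> ^ 6) \<partial>lborel)
      \<le> ennreal K * (\<integral>\<^sup>+x. ennreal ((norm (classical_gradient \<phi> x))\<^sup>2) \<partial>lborel) ^ 3"
    using test_functions_Sobolev[OF assms(5,1)] by metis
  interpret Sobolev_domain \<Omega> K
    by unfold_locales (use assms K in auto)
  show ?thesis
  proof (intro exI[of _ trilinear_const] conjI allI impI trilinear_const_pos)
    fix f Rey M Res us Xh Qh ip l \<phi> r R Xr XR u p ur uR
    assume f: "f \<in> X_dual \<Omega>" and Rey: "Rey > (0::real)"
      and small: "Rey\<^sup>2 * N_const \<Omega> * dual_norm \<Omega> f < 1"
      and Xh: "finite_dim_subspace \<Omega> Xh (X_space \<Omega>)" and Qh: "finite_dim_subspace \<Omega> Qh (Q_space \<Omega>)"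
      and snapshots: "\<forall>j\<in>{1..M}. Res j > 0 \<and> (\<exists>ph. weak_NSE \<Omega> Xh Qh (Res j) f (us j) ph)"
      and ip: "ip \<in> {l2_inner \<Omega>, h1_inner0 \<Omega>}" and POD: "POD_basis \<Omega> ip M us l \<phi>"
      and rR: "1 \<le> r" "r < R" "R \<le> l"
      and Xr: "Xr = lin_span \<Omega> r \<phi>" and XR: "XR = lin_span \<Omega> R \<phi>"
      and NSE: "weak_NSE \<Omega> (X_space \<Omega>) (Q_space \<Omega>) Rey f u p"
      and ROM: "two_level_ROM \<Omega> Xr XR Rey f ur uR"
    have ortho: "orthonormal_in_X \<Omega> ip l \<phi>" and span: "lin_span \<Omega> l \<phi> = lin_span \<Omega> M us"
      using POD by (auto simp: POD_basis_def)
    have \<phi>X: "\<phi> i \<in> X_space \<Omega>" if "i \<in> {1..l}" for i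
      using ortho that by (auto simp: orthonormal_in_X_def)
    have sub: "XR \<subseteq> X_space \<Omega>" "Xr \<subseteq> X_space \<Omega>"
      unfolding XR Xr by (rule lin_span_subset_X, rule \<phi>X, use rR in simp)+
    have us: "us j \<in> X_space \<Omega>" "q \<in> Qh \<Longrightarrow> c_form \<Omega> q (us j) = 0" if "j \<in> {1..M}" for j q
      using snapshots that finite_dim_subspace_X[OF Xh] unfolding weak_NSE_def by blast+
    \<comment> \<open>the snapshots are discretely divergence-free, hence so are the basis functions and their span\<close>
    have div_free: "c_form \<Omega> q v = 0" if v: "v \<in> XR" and q: "q \<in> Qh" for v q
    proof -
      have q2: "q \<in> L2 \<Omega>" using q finite_dim_subspace_Q[OF Qh] by blast
      have "c_form \<Omega> q (\<phi> i) = 0" if "i \<in> {1..l}" for i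
        by (rule lin_span_divergence_free[OF q2, where \<phi>=us and k=M])
          (use us q lin_span_base[OF that, of \<phi> \<Omega>] span in auto)
      then show ?thesis
        using v unfolding XR
        by (intro lin_span_divergence_free[OF q2, where \<phi>=\<phi> and k=R]) (use \<phi>X rR in auto)
    qed
    have one: "1 \<in> {1..l}" "1 \<in> {1..r}" "1 \<in> {1..R}" using rR by auto
    have nz: "nonzero \<Omega> XR \<noteq> {}" "nonzero \<Omega> Xr \<noteq> {}" "nonzero \<Omega> (X_space \<Omega>) \<noteq> {}"
      using orthonormal_not_AE_zero[OF ortho ip one(1)] lin_span_base[OF one(2), of \<phi> \<Omega>]
        lin_span_base[OF one(3), of \<phi> \<Omega>] \<phi>X[OF one(1)]
      unfolding nonzero_def XR Xr by blast+
    define \<alpha> where "\<alpha> = 1 - Rey\<^sup>2 * NRr_const \<Omega> XR Xr * dual_norm \<Omega> f"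
    note dual0 = dual_norm_nonneg[OF f nz(3)]
    have "Rey\<^sup>2 * NRr_const \<Omega> XR Xr * dual_norm \<Omega> f \<le> Rey\<^sup>2 * N_const \<Omega> * dual_norm \<Omega> f"
      by (intro mult_right_mono mult_left_mono NRr_const_le_N_const sub nz dual0) simp
    then have \<alpha>: "\<alpha> > 0" using small by (simp add: \<alpha>_def)
    let ?C = trilinear_const
    let ?e = "\<lambda>v x. u x - v x"
    let ?F = "\<lambda>v. (inverse \<alpha> + 1) * h1_semi \<Omega> (?e v)
      + inverse \<alpha> * Rey * ?C * l2_norm \<Omega> (?e v) powr (1/2) * h1_semi \<Omega> (?e v) powr (1/2) * h1_semi \<Omega> ur
      + inverse \<alpha> * Rey * ?C * l2_norm \<Omega> ur powr (1/2) * h1_semi \<Omega> ur powr (1/2) * h1_semi \<Omega> (?e v)"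
    let ?D = "inverse \<alpha> * Rey * ?C * l2_norm \<Omega> (?e ur) powr (1/2) * h1_semi \<Omega> (?e ur) powr (3/2)"
    have "h1_semi \<Omega> (?e uR) \<le> (INF v\<in>XR. ?F v)
        + inverse \<alpha> * Rey * (INF q\<in>Qh. l2_norm \<Omega> (\<lambda>x. p x - q x)) + ?D"
    proof (rule le_INF_add_INF)
      fix v q assume v: "v \<in> XR" and q: "q \<in> Qh"
      have XR_diff: "\<And>v w. v \<in> XR \<Longrightarrow> w \<in> XR \<Longrightarrow> (\<lambda>x. v x - w x) \<in> XR"
        unfolding XR by (rule lin_span_diff)
      have half: "sqrt (a * b) = a powr (1/2) * b powr (1/2)" if "a \<ge> 0" "b \<ge> 0" for a b :: real
        using that by (simp add: powr_half_sqrt real_sqrt_mult)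
      have three_halves: "b powr (3/2) = b powr (1/2) * b" if "b \<ge> 0" for b :: real
        using that powr_add[of b "1/2" 1] by simp
      have "h1_semi \<Omega> (?e uR) \<le> h1_semi \<Omega> (?e v) + inverse \<alpha> * Rey *
        (inverse Rey * h1_semi \<Omega> (?e v)
          + ?C * sqrt (l2_norm \<Omega> (?e v) * h1_semi \<Omega> (?e v)) * h1_semi \<Omega> ur
          + ?C * sqrt (l2_norm \<Omega> ur * h1_semi \<Omega> ur) * h1_semi \<Omega> (?e v)
          + ?C * sqrt (l2_norm \<Omega> (?e ur) * h1_semi \<Omega> (?e ur)) * h1_semi \<Omega> (?e ur)
          + l2_norm \<Omega> (\<lambda>x. p x - q x))"
        unfolding \<alpha>_def
        by (rule two_level_error_estimate[OF f Rey sub finite_dim_subspace_Q(1)[OF Qh] XR_diff div_free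
              NSE ROM NRr_const_nonneg[OF sub nz(1,2)] dual0 \<alpha>[unfolded \<alpha>_def] v q])
      also have "\<dots> = ?F v + inverse \<alpha> * Rey * l2_norm \<Omega> (\<lambda>x. p x - q x) + ?D"
        using Rey by (simp add: half three_halves distrib_left distrib_right mult_ac)
      finally show "h1_semi \<Omega> (?e uR) \<le> ?F v + inverse \<alpha> * Rey * l2_norm \<Omega> (\<lambda>x. p x - q x) + ?D" .
    next
      show "XR \<noteq> {}" unfolding XR using lin_span_zero by blast
      show "Qh \<noteq> {}" by (rule finite_dim_subspace_Q(2)[OF Qh])
      show "inverse \<alpha> * Rey > 0" using \<alpha> Rey by simp
    qed
    with \<alpha> show "let \<alpha> = 1 - Rey\<^sup>2 * NRr_const \<Omega> XR Xr * dual_norm \<Omega> f;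
         n0 = l2_norm \<Omega>;
         n1 = h1_semi \<Omega>;
         e = (\<lambda>v x. u x - v x)
     in \<alpha> > 0 \<and>
        n1 (e uR) \<le>
          (INF v\<in>XR.
              (inverse \<alpha> + 1) * n1 (e v)
            + inverse \<alpha> * Rey * trilinear_const * n0 (e v) powr (1/2) * n1 (e v) powr (1/2) * n1 ur
            + inverse \<alpha> * Rey * trilinear_const * n0 ur powr (1/2) * n1 ur powr (1/2) * n1 (e v))
          + inverse \<alpha> * Rey * (INF q\<in>Qh. l2_norm \<Omega> (\<lambda>x. p x - q x))
          + inverse \<alpha> * Rey * trilinear_const * n0 (e ur) powr (1/2) * n1 (e ur) powr (3/2)"
      by (simp only: Let_def \<alpha>_def)
  qed
qed

end
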